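(* Let $\Lambda$ be a lattice in $\mathbb{R}^2$ with $\operatorname{vol}(\Lambda)=\tfrac12$ which possesses a (necessarily unique) generator matrix in Hermite normal form $A=\begin{bmatrix} a & b\\ 0 & d\end{bmatrix}$ (so $a,d>0$, $0\le b<a$, $ad=\tfrac12$, $\Lambda=A\mathbb{Z}^2$). Define the unitary operator $U$ on $L^2(\mathbb{R})$ by $$U=\mathcal{D}_{1/d}\circ\mathcal{F}\circ\mathcal{N}_{-b/d}\circ\mathcal{F}^{-1}.$$ Let $g\in L^2(\mathbb{R})$ be such that (i) $\widehat{Ug}$ is real-valued, and (ii) $\{g_{ma+nb,\,nd}\}_{m,n\in\mathbb{Z}}$ is a tight frame for $L^2(\mathbb{R})$ with frame bound $2$. Then the Wilson system $\mathcal{W}(g,\Lambda,L^2(\mathbb{R}))$ is an orthonormal basis for $L^2(\mathbb{R})$.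
   Context: For $(x,y)\in\mathbb{R}^2$ and $g\in L^2(\mathbb{R})$, $g_{x,y}(t)=e^{2\pi i y t}g(t-x)$. The Fourier transform is $\mathcal{F}f(\omega)=\hat f(\omega)=\int_{\mathbb{R}} f(t)e^{-2\pi i t\omega}\,dt$, with inverse $\mathcal{F}^{-1}$. Dilation: $\mathcal{D}_b f(t)=|b|^{1/2}f(bt)$; chirp: $\mathcal{N}_c f(t)=e^{-\pi i c t^2}f(t)$, for $b,c\in\mathbb{R}$. The volume of $\Lambda=A\mathbb{Z}^2$ is $|\det A|$. A matrix $\begin{bmatrix} a & b\\ c & d\end{bmatrix}$ is in Hermite normal form if $c=0$, $a,d>0$, $0\le b<a$. For $\Lambda$ with Hermite-normal-form generator matrix $\begin{bmatrix} a & b\\ 0 & d\end{bmatrix}$ and $g\in L^2(\mathbb{R})$, the Wilson system $\mathcal{W}(g,\Lambda,L^2(\mathbb{R}))=\{\psi^\Lambda_{m,n}\}_{m\in\mathbb{Z},\,n\ge0}$ is defined by $\psi^\Lambda_{m,0}=g_{2ma,0}$; $\psi^\Lambda_{m,n}=\tfrac{1}{\sqrt2}e^{-\pi i bdn^2}\big(g_{ma+nb,\,nd}+g_{ma-nb,\,-nd}\big)$ if $n\ge1$ and $m+n$ is even; $\psi^\Lambda_{m,n}=\tfrac{i}{\sqrt2}e^{-\pi i bdn^2}\big(g_{ma+nb,\,nd}-g_{ma-nb,\,-nd}\big)$ if $n\ge1$ and $m+n$ is odd. *)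

theory Defs
  imports "HOL-Analysis.Analysis"
begin

text \<open>Elements of L^2(R) are represented by functions real => complex that are
Borel measurable and square integrable; equality in L^2 is equality a.e.\<close>

definition sq_int :: "(real \<Rightarrow> complex) \<Rightarrow> bool" where
  "sq_int f \<longleftrightarrow> f \<in> borel_measurable lborel \<and> integrable lborel (\<lambda>t. (norm (f t))\<^sup>2)"

definition inner_L2 :: "(real \<Rightarrow> complex) \<Rightarrow> (real \<Rightarrow> complex) \<Rightarrow> complex" where
  "inner_L2 f g = (LINT t|lborel. f t * cnj (g t))"

definition norm_L2 :: "(real \<Rightarrow> complex) \<Rightarrow> real" where
  "norm_L2 f = sqrt (LINT t|lborel. (norm (f t))\<^sup>2)"

definition tfshift :: "(real \<Rightarrow> complex) \<Rightarrow> real \<Rightarrow> real \<Rightarrow> real \<Rightarrow> complex" where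
  "tfshift g x y = (\<lambda>t. exp (complex_of_real (2 * pi * y * t) * \<i>) * g (t - x))"

definition dil :: "real \<Rightarrow> (real \<Rightarrow> complex) \<Rightarrow> real \<Rightarrow> complex" where
  "dil b f = (\<lambda>t. complex_of_real (sqrt \<bar>b\<bar>) * f (b * t))"

definition chirp :: "real \<Rightarrow> (real \<Rightarrow> complex) \<Rightarrow> real \<Rightarrow> complex" where
  "chirp c f = (\<lambda>t. exp (- complex_of_real (pi * c * t\<^sup>2) * \<i>) * f t)"

definition fourier1 :: "(real \<Rightarrow> complex) \<Rightarrow> real \<Rightarrow> complex" where
  "fourier1 f = (\<lambda>\<omega>. LINT t|lborel. f t * exp (- complex_of_real (2 * pi * t * \<omega>) * \<i>))"

definition invfourier1 :: "(real \<Rightarrow> complex) \<Rightarrow> real \<Rightarrow> complex" where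
  "invfourier1 f = (\<lambda>t. LINT \<omega>|lborel. f \<omega> * exp (complex_of_real (2 * pi * t * \<omega>) * \<i>))"

text \<open>Fourier transform on L^2 (Plancherel): the L^2-limit of the Fourier integrals of the
truncations f * 1_{[-N,N]}; the result is determined only almost everywhere.\<close>
definition fourierL2 :: "(real \<Rightarrow> complex) \<Rightarrow> real \<Rightarrow> complex" where
  "fourierL2 f = (SOME h. sq_int h \<and>
     (\<lambda>N::nat. norm_L2 (\<lambda>\<omega>. h \<omega> - fourier1 (\<lambda>t. indicator {- real N..real N} t * f t) \<omega>))
       \<longlonglongrightarrow> 0)"

definition invfourierL2 :: "(real \<Rightarrow> complex) \<Rightarrow> real \<Rightarrow> complex" where
  "invfourierL2 f = (SOME h. sq_int h \<and>
     (\<lambda>N::nat. norm_L2 (\<lambda>t. h t - invfourier1 (\<lambda>\<omega>. indicator {- real N..real N} \<omega> * f \<omega>) t))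
       \<longlonglongrightarrow> 0)"

definition opU :: "real \<Rightarrow> real \<Rightarrow> (real \<Rightarrow> complex) \<Rightarrow> real \<Rightarrow> complex" where
  "opU b d g = dil (1 / d) (fourierL2 (chirp (- b / d) (invfourierL2 g)))"

definition wilson :: "(real \<Rightarrow> complex) \<Rightarrow> real \<Rightarrow> real \<Rightarrow> real \<Rightarrow> int \<Rightarrow> nat \<Rightarrow> real \<Rightarrow> complex" where
  "wilson g a b d m n =
     (if n = 0 then tfshift g (2 * of_int m * a) 0
      else if even (m + int n) then
        (\<lambda>t. (1 / complex_of_real (sqrt 2)) * exp (- complex_of_real (pi * b * d * (real n)\<^sup>2) * \<i>) *
              (tfshift g (of_int m * a + real n * b) (real n * d) t
               + tfshift g (of_int m * a - real n * b) (- (real n * d)) t))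
      else
        (\<lambda>t. (\<i> / complex_of_real (sqrt 2)) * exp (- complex_of_real (pi * b * d * (real n)\<^sup>2) * \<i>) *
              (tfshift g (of_int m * a + real n * b) (real n * d) t
               - tfshift g (of_int m * a - real n * b) (- (real n * d)) t)))"

definition tight_frame_L2 :: "('i \<Rightarrow> real \<Rightarrow> complex) \<Rightarrow> real \<Rightarrow> bool" where
  "tight_frame_L2 e A \<longleftrightarrow> (\<forall>i. sq_int (e i)) \<and>
     (\<forall>f. sq_int f \<longrightarrow> ((\<lambda>i. (norm (inner_L2 f (e i)))\<^sup>2) has_sum (A * (norm_L2 f)\<^sup>2)) UNIV)"

definition onb_L2 :: "('i \<Rightarrow> real \<Rightarrow> complex) \<Rightarrow> bool" where
  "onb_L2 e \<longleftrightarrow> (\<forall>i. sq_int (e i)) \<and>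
     (\<forall>i j. inner_L2 (e i) (e j) = (if i = j then 1 else 0)) \<and>
     (\<forall>f. sq_int f \<longrightarrow> (\<forall>i. inner_L2 f (e i) = 0) \<longrightarrow> (AE t in lborel. f t = 0))"

end

theory Submission
  imports Defs "HOL-Probability.Probability"
begin

text \<open>
  The Fourier transform of \<open>U f\<close> is the chirped, dilated transform of \<open>f\<close>, so \<open>\<F> \<circ> U\<close> is unitary;
  it maps \<open>g\<close> to a real function \<open>r\<close> and, up to unimodular constants, the Gabor system of \<open>g\<close> over
  the lattice to the functions \<open>r (\<omega> - n) e\<^bsup>-\<pi>im\<omega>\<^esup>\<close>. This reduces the theorem to a rectangular lattice.
  There the Wilson coefficients of \<open>F\<close> have square sum \<open>\<parallel>F\<parallel>\<^sup>2 + X / 2\<close>, where \<open>X\<close> is the sum of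
  \<open>(-1)\<^bsup>m+n\<^esup> c\<^sub>m\<^sub>,\<^sub>n \<cdot> cnj c\<^sub>m\<^sub>,\<^sub>-\<^sub>n\<close> over the Gabor coefficients \<open>c\<^sub>m\<^sub>,\<^sub>n\<close>. Summing over \<open>m\<close> by Parseval's
  identity for Fourier series and using that \<open>r\<close> is real, \<open>X\<close> changes sign under a reflection of \<open>n\<close>,
  so \<open>X = 0\<close> and the Wilson system is a Parseval frame. The tight frame property forces
  \<open>\<parallel>g\<parallel> \<ge> 1\<close>, while elements of a Parseval frame have norm at most one; comparing both parities of
  \<open>m\<close> shows that all Wilson functions have norm one, and a Parseval frame of unit vectors is an
  orthonormal basis.
\<close>

section \<open>Square-integrable functions\<close>

text \<open>Because \<open>a * d = 1 / 2\<close>, time shifts by \<open>m * a\<close> turn into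
  characters of period 2, while frequency shifts turn into translations by 1. This factor of two
  drives the vanishing of X: for coefficients over a period of length 2, the sign (-1)^m is a
  translation by half a period. For two functions living on unit cells, once both cells are moved to
  [0, 1), it either disappears or separates the supports, according to the parity of the distance of
  the cells. Parseval needs the products of F with translates of r to be square integrable, but r is
  merely in L^2. Hence X is computed for bounded functions on one cell and extended by continuity,
  and it must be treated as a form in two arguments, since the pieces of one function lie in
  different cells. An L^2 transform is fixed by a choice operator up to null sets only. Formulas for
  it are obtained by testing against modulated Gaussians, whose transforms are explicit. Plancherel
  follows from a contraction estimate and inversion: a contraction whose square is a reflection is
  isometric.\<close>

lemma sq_int_measurable [measurable_dest]: "sq_int f \<Longrightarrow> f \<in> borel_measurable borel"
  by (simp add: sq_int_def)

lemma sq_int_integrable: "sq_int f \<Longrightarrow> integrable lborel (\<lambda>t. (norm (f t))\<^sup>2)"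
  by (simp add: sq_int_def)

lemma norm_mult_le_sum_squares: "norm (x * y) \<le> (norm x)\<^sup>2 + (norm y)\<^sup>2"
  for x y :: complex
proof -
  have "0 \<le> (norm x - norm y)\<^sup>2" by simp
  moreover have "0 \<le> norm x * norm y" by simp
  ultimately show ?thesis
    unfolding norm_mult power2_diff by linarith
qed

lemma integrable_mult_sq_int:
  assumes "sq_int f" "sq_int g"
  shows "integrable lborel (\<lambda>t. f t * g t)"
proof (rule Bochner_Integration.integrable_bound)
  show "integrable lborel (\<lambda>t. (norm (f t))\<^sup>2 + (norm (g t))\<^sup>2)"
    using assms by (intro Bochner_Integration.integrable_add) (auto dest: sq_int_integrable)
  show "(\<lambda>t. f t * g t) \<in> borel_measurable lborel"
    using assms[THEN sq_int_measurable] by simp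
  show "AE t in lborel. norm (f t * g t) \<le> norm ((norm (f t))\<^sup>2 + (norm (g t))\<^sup>2)"
    using norm_mult_le_sum_squares by (intro AE_I2) (metis abs_ge_self order_trans real_norm_def)
qed

lemma borel_measurable_cnj [measurable]: "cnj \<in> borel_measurable borel"
  by (intro borel_measurable_continuous_onI continuous_intros)

lemma sq_int_cnj: "sq_int f \<Longrightarrow> sq_int (\<lambda>t. cnj (f t))"
  using measurable_compose[OF _ borel_measurable_cnj, of f borel] by (auto simp: sq_int_def)

lemma integrable_mult_cnj_sq_int:
  "sq_int f \<Longrightarrow> sq_int g \<Longrightarrow> integrable lborel (\<lambda>t. f t * cnj (g t))"
  by (intro integrable_mult_sq_int sq_int_cnj)

lemma sq_int_bounded_mult:
  assumes "sq_int f" and [measurable]: "m \<in> borel_measurable borel" and "\<And>t. norm (m t) \<le> C"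
  shows "sq_int (\<lambda>t. m t * f t)"
  unfolding sq_int_def
proof
  have [measurable]: "f \<in> borel_measurable borel" using assms sq_int_measurable by blast
  show "(\<lambda>t. m t * f t) \<in> borel_measurable lborel" by simp
  show "integrable lborel (\<lambda>t. (norm (m t * f t))\<^sup>2)"
  proof (rule Bochner_Integration.integrable_bound)
    show "integrable lborel (\<lambda>t. C\<^sup>2 * (norm (f t))\<^sup>2)"
      using assms by (simp add: sq_int_def)
    show "AE t in lborel. norm ((norm (m t * f t))\<^sup>2) \<le> norm (C\<^sup>2 * (norm (f t))\<^sup>2)"
      using assms(3) by (auto simp: norm_mult power_mult_distrib intro!: mult_right_mono power_mono)
  qed simp
qed

lemma sq_int_cmult: "sq_int f \<Longrightarrow> sq_int (\<lambda>t. c * f t)"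
  by (rule sq_int_bounded_mult[where C = "norm c"]) auto

lemma sq_int_add:
  assumes "sq_int f" "sq_int g"
  shows "sq_int (\<lambda>t. f t + g t)"
  unfolding sq_int_def
proof
  have [measurable]: "f \<in> borel_measurable borel" "g \<in> borel_measurable borel"
    using assms sq_int_measurable by blast+
  show "(\<lambda>t. f t + g t) \<in> borel_measurable lborel" by simp
  have *: "(norm (x + y))\<^sup>2 \<le> 2 * (norm x)\<^sup>2 + 2 * (norm y)\<^sup>2" for x y :: complex
  proof -
    have "(norm (x + y))\<^sup>2 \<le> (norm x + norm y)\<^sup>2"
      by (intro power_mono norm_triangle_ineq) auto
    moreover have "0 \<le> (norm x - norm y)\<^sup>2" by simp
    ultimately show ?thesis unfolding power2_diff power2_sum by linarith
  qed
  show "integrable lborel (\<lambda>t. (norm (f t + g t))\<^sup>2)"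
  proof (rule Bochner_Integration.integrable_bound)
    show "integrable lborel (\<lambda>t. 2 * (norm (f t))\<^sup>2 + 2 * (norm (g t))\<^sup>2)"
      using assms by (simp add: sq_int_def)
  qed (use * in auto)
qed

lemma sq_int_uminus: "sq_int f \<Longrightarrow> sq_int (\<lambda>t. - f t)"
  using sq_int_cmult[of f "-1"] by simp

lemma sq_int_diff: "sq_int f \<Longrightarrow> sq_int g \<Longrightarrow> sq_int (\<lambda>t. f t - g t)"
  using sq_int_add[of f "\<lambda>t. - g t"] sq_int_uminus by simp

lemma sq_int_zero: "sq_int (\<lambda>t. 0)"
  by (simp add: sq_int_def)

lemma sq_int_sum: "(\<And>i. i \<in> I \<Longrightarrow> sq_int (f i)) \<Longrightarrow> sq_int (\<lambda>t. \<Sum>i\<in>I. f i t)"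
  by (induction I rule: infinite_finite_induct) (auto intro: sq_int_add sq_int_zero)

lemma sq_int_indicator_mult:
  "sq_int f \<Longrightarrow> A \<in> sets borel \<Longrightarrow> sq_int (\<lambda>t. indicator A t * f t)"
  by (rule sq_int_bounded_mult[where C = 1]) (auto simp: indicator_def)

lemma sq_int_AE_cong:
  assumes "sq_int f" "h \<in> borel_measurable borel" "AE t in lborel. h t = f t"
  shows "sq_int h"
proof -
  have [measurable]: "f \<in> borel_measurable borel" "h \<in> borel_measurable borel"
    using assms sq_int_measurable by blast+
  have "integrable lborel (\<lambda>t. (norm (h t))\<^sup>2) \<longleftrightarrow> integrable lborel (\<lambda>t. (norm (f t))\<^sup>2)"
    using assms(3) by (intro integrable_cong_AE) auto
  then show ?thesis using assms by (simp add: sq_int_def)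
qed

section \<open>Norm and inner product, up to null sets\<close>

lemma norm_L2_nonneg [simp]: "0 \<le> norm_L2 f"
  by (simp add: norm_L2_def)

lemma power2_norm_L2: "(norm_L2 f)\<^sup>2 = (LINT t|lborel. (norm (f t))\<^sup>2)"
  by (simp add: norm_L2_def)

lemma norm_L2_cong_AE:
  assumes "f \<in> borel_measurable borel" "h \<in> borel_measurable borel" "AE t in lborel. f t = h t"
  shows "norm_L2 f = norm_L2 h"
  unfolding norm_L2_def using assms
  by (intro arg_cong[where f = sqrt] integral_cong_AE) auto

lemma inner_L2_cong_AE:
  assumes "sq_int f" "sq_int f'" "sq_int g" "sq_int g'"
    and "AE t in lborel. f t = f' t" "AE t in lborel. g t = g' t"
  shows "inner_L2 f g = inner_L2 f' g'"
proof -
  have [measurable]: "f \<in> borel_measurable borel" "f' \<in> borel_measurable borel"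
     "g \<in> borel_measurable borel" "g' \<in> borel_measurable borel"
    using assms sq_int_measurable by blast+
  show ?thesis
    unfolding inner_L2_def
  proof (rule integral_cong_AE)
    show "(\<lambda>t. f t * cnj (g t)) \<in> borel_measurable lborel"
      "(\<lambda>t. f' t * cnj (g' t)) \<in> borel_measurable lborel" by measurable
  qed (use assms(5,6) in auto)
qed

lemma inner_L2_self: "inner_L2 f f = complex_of_real ((norm_L2 f)\<^sup>2)"
  unfolding inner_L2_def power2_norm_L2 complex_norm_square[symmetric]
  by (metis (no_types) integral_complex_of_real of_real_power)

lemma inner_L2_commute: "inner_L2 g f = cnj (inner_L2 f g)"
  unfolding inner_L2_def by (subst Bochner_Integration.integral_cnj[symmetric]) (simp add: mult.commute)

lemma inner_L2_add_left:
  "sq_int f \<Longrightarrow> sq_int g \<Longrightarrow> sq_int h \<Longrightarrow> inner_L2 (\<lambda>t. f t + g t) h = inner_L2 f h + inner_L2 g h"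
  unfolding inner_L2_def
  by (simp add: distrib_right integrable_mult_cnj_sq_int)

lemma inner_L2_cmult_left: "inner_L2 (\<lambda>t. c * f t) h = c * inner_L2 f h"
  unfolding inner_L2_def by (simp add: mult.assoc)

lemma inner_L2_uminus_left: "inner_L2 (\<lambda>t. - f t) h = - inner_L2 f h"
  using inner_L2_cmult_left[of "-1" f h] by simp

lemma inner_L2_diff_left:
  "sq_int f \<Longrightarrow> sq_int g \<Longrightarrow> sq_int h \<Longrightarrow> inner_L2 (\<lambda>t. f t - g t) h = inner_L2 f h - inner_L2 g h"
  unfolding inner_L2_def
  by (simp add: left_diff_distrib integrable_mult_cnj_sq_int)

lemma inner_L2_zero_left: "inner_L2 (\<lambda>t. 0) h = 0"
  by (simp add: inner_L2_def)

lemma inner_L2_sum_left: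
  "(\<And>i. i \<in> I \<Longrightarrow> sq_int (f i)) \<Longrightarrow> sq_int h \<Longrightarrow>
    inner_L2 (\<lambda>t. \<Sum>i\<in>I. f i t) h = (\<Sum>i\<in>I. inner_L2 (f i) h)"
  by (induction I rule: infinite_finite_induct)
    (auto simp: inner_L2_zero_left inner_L2_add_left sq_int_sum)

lemma inner_L2_add_right:
  "sq_int f \<Longrightarrow> sq_int g \<Longrightarrow> sq_int h \<Longrightarrow> inner_L2 h (\<lambda>t. f t + g t) = inner_L2 h f + inner_L2 h g"
  by (simp add: inner_L2_commute[of h] inner_L2_add_left)

lemma inner_L2_cmult_right: "inner_L2 h (\<lambda>t. c * f t) = cnj c * inner_L2 h f"
  by (simp add: inner_L2_commute[of h] inner_L2_cmult_left)

lemma power2_norm_L2_add: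
  assumes "sq_int f" "sq_int g"
  shows "(norm_L2 (\<lambda>t. f t + g t))\<^sup>2 = (norm_L2 f)\<^sup>2 + (norm_L2 g)\<^sup>2 + 2 * Re (inner_L2 f g)"
proof -
  have "complex_of_real ((norm_L2 (\<lambda>t. f t + g t))\<^sup>2)
      = inner_L2 f f + inner_L2 g g + (inner_L2 f g + cnj (inner_L2 f g))"
    using assms unfolding inner_L2_self[symmetric] inner_L2_commute[of g f, symmetric]
    by (simp add: inner_L2_add_left inner_L2_add_right sq_int_add)
  also have "\<dots> = complex_of_real ((norm_L2 f)\<^sup>2 + (norm_L2 g)\<^sup>2 + 2 * Re (inner_L2 f g))"
    by (simp add: inner_L2_self complex_add_cnj)
  finally show ?thesis using of_real_eq_iff by blast
qed

lemma norm_L2_cmult: "norm_L2 (\<lambda>t. c * f t) = norm c * norm_L2 f"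
  unfolding norm_L2_def by (simp add: norm_mult power_mult_distrib real_sqrt_mult)

lemma norm_L2_uminus: "norm_L2 (\<lambda>t. - f t) = norm_L2 f"
  using norm_L2_cmult[of "-1" f] by simp

lemma power2_norm_L2_diff:
  assumes "sq_int f" "sq_int g"
  shows "(norm_L2 (\<lambda>t. f t - g t))\<^sup>2 = (norm_L2 f)\<^sup>2 + (norm_L2 g)\<^sup>2 - 2 * Re (inner_L2 f g)"
proof -
  have "inner_L2 f (\<lambda>t. - g t) = - inner_L2 f g"
    by (simp add: inner_L2_commute[of f] inner_L2_uminus_left)
  then show ?thesis
    using power2_norm_L2_add[of f "\<lambda>t. - g t"] assms by (simp add: sq_int_uminus norm_L2_uminus)
qed

text \<open>The quadratic behind Cauchy-Schwarz: \<open>A\<close> and \<open>B\<close> are squared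
  norms, \<open>z\<close> is the squared modulus of the inner product. Keeping \<open>z\<close> as a
  factor of both terms in \<open>x\<close> avoids dividing by the inner product.\<close>

lemma discriminant_bound:
  fixes A B z :: real
  assumes *: "\<And>x. 2 * x * z \<le> A + x\<^sup>2 * z * B" and "0 \<le> A" "0 \<le> B" "0 \<le> z"
  shows "z \<le> A * B"
proof (cases "B = 0")
  case True
  have "z = 0"
  proof (rule ccontr)
    \<comment> \<open>For \<open>B = 0\<close> the bound is affine in \<open>x\<close>; the value
      \<open>(A + 1) / z\<close> turns it into 2 (A + 1) <= A.\<close>
    assume "z \<noteq> 0"
    then show False
      using *[of "(A + 1) / z"] True \<open>0 \<le> A\<close> by simp
  qed
  then show ?thesis using True by simp
next
  case False
  then have "B > 0" using \<open>0 \<le> B\<close> by simp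
  then show ?thesis
    using *[of "1 / B"] by (simp add: field_simps power2_eq_square)
qed

lemma norm_inner_L2_le:
  assumes f: "sq_int f" and g: "sq_int g"
  shows "norm (inner_L2 f g) \<le> norm_L2 f * norm_L2 g"
proof -
  let ?A = "(norm_L2 f)\<^sup>2" and ?B = "(norm_L2 g)\<^sup>2" and ?z = "inner_L2 f g"
  have *: "2 * x * (norm ?z)\<^sup>2 \<le> ?A + x\<^sup>2 * (norm ?z)\<^sup>2 * ?B" for x
  proof -
    \<comment> \<open>The multiple of \<open>g\<close> carries the phase of the inner product, so
      the mixed term is real and a real parameter \<open>x\<close> suffices.\<close>
    let ?c = "complex_of_real x * ?z"
    have "0 \<le> (norm_L2 (\<lambda>t. f t - ?c * g t))\<^sup>2" by simp
    also have "\<dots> = ?A + (norm ?c)\<^sup>2 * ?B - 2 * Re (cnj ?c * ?z)"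
      using f g by (simp add: power2_norm_L2_diff sq_int_cmult norm_L2_cmult inner_L2_cmult_right
          power_mult_distrib)
    also have "cnj ?c * ?z = complex_of_real (x * (norm ?z)\<^sup>2)"
      using complex_norm_square[of ?z] by (simp add: mult.commute)
    finally show ?thesis by (simp add: norm_mult power_mult_distrib)
  qed
  have "(norm ?z)\<^sup>2 \<le> ?A * ?B"
    by (rule discriminant_bound[OF *]) auto
  then have "(norm ?z)\<^sup>2 \<le> (norm_L2 f * norm_L2 g)\<^sup>2" by (simp add: power_mult_distrib)
  then show ?thesis by (rule power2_le_imp_le) simp
qed

lemma norm_L2_triangle:
  assumes "sq_int f" "sq_int g"
  shows "norm_L2 (\<lambda>t. f t + g t) \<le> norm_L2 f + norm_L2 g"
proof (rule power2_le_imp_le)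
  have "Re (inner_L2 f g) \<le> norm_L2 f * norm_L2 g"
    using norm_inner_L2_le[OF assms] complex_Re_le_cmod order_trans by blast
  then show "(norm_L2 (\<lambda>t. f t + g t))\<^sup>2 \<le> (norm_L2 f + norm_L2 g)\<^sup>2"
    using power2_norm_L2_add[OF assms] by (simp add: power2_sum)
qed simp

lemma norm_L2_triangle_diff:
  assumes "sq_int f" "sq_int g" "sq_int h"
  shows "norm_L2 (\<lambda>t. f t - h t) \<le> norm_L2 (\<lambda>t. f t - g t) + norm_L2 (\<lambda>t. g t - h t)"
  using norm_L2_triangle[of "\<lambda>t. f t - g t" "\<lambda>t. g t - h t"] assms by (simp add: sq_int_diff)

lemma norm_L2_minus_commute: "norm_L2 (\<lambda>t. f t - h t) = norm_L2 (\<lambda>t. h t - f t)"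
  using norm_L2_uminus[of "\<lambda>t. h t - f t"] by simp

lemma norm_L2_eq_0_iff:
  assumes "sq_int f"
  shows "norm_L2 f = 0 \<longleftrightarrow> (AE t in lborel. f t = 0)"
  unfolding norm_L2_def using assms
  by (simp add: sq_int_def integral_nonneg_eq_0_iff_AE)

lemma norm_L2_diff_eq_0_iff:
  "sq_int f \<Longrightarrow> sq_int h \<Longrightarrow> norm_L2 (\<lambda>t. f t - h t) = 0 \<longleftrightarrow> (AE t in lborel. f t = h t)"
  by (simp add: norm_L2_eq_0_iff sq_int_diff)

lemma ennreal_norm_L2_sq:
  "sq_int f \<Longrightarrow> (\<integral>\<^sup>+ t. ennreal ((norm (f t))\<^sup>2) \<partial>lborel) = ennreal ((norm_L2 f)\<^sup>2)"
  unfolding power2_norm_L2 by (intro nn_integral_eq_integral) (auto simp: sq_int_def)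

text \<open>Lets a Fatou estimate deliver square integrability and a norm bound at once.\<close>

lemma sq_int_nn_integral:
  assumes [measurable]: "f \<in> borel_measurable borel"
    and "(\<integral>\<^sup>+ t. ennreal ((norm (f t))\<^sup>2) \<partial>lborel) \<le> ennreal C" "0 \<le> C"
  shows "sq_int f" "(norm_L2 f)\<^sup>2 \<le> C"
proof -
  show 1: "sq_int f"
    unfolding sq_int_def
  proof
    show "integrable lborel (\<lambda>t. (norm (f t))\<^sup>2)"
      using assms(2) by (intro integrableI_nonneg) (auto simp: le_less_trans)
  qed simp
  show "(norm_L2 f)\<^sup>2 \<le> C"
    using assms(2,3) unfolding ennreal_norm_L2_sq[OF 1] by (simp add: ennreal_le_iff)
qed

section \<open>Limits in L^2 and completeness\<close>

lemma inner_L2_tendsto_left: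
  assumes "\<And>n. sq_int (s n)" "sq_int f" "sq_int h"
    and "(\<lambda>n. norm_L2 (\<lambda>t. f t - s n t)) \<longlonglongrightarrow> 0"
  shows "(\<lambda>n. inner_L2 (s n) h) \<longlonglongrightarrow> inner_L2 f h"
proof -
  have "(\<lambda>n. inner_L2 f h - inner_L2 (s n) h) \<longlonglongrightarrow> 0"
  proof (rule Lim_null_comparison)
    show "\<forall>\<^sub>F n in sequentially. norm (inner_L2 f h - inner_L2 (s n) h)
        \<le> norm_L2 (\<lambda>t. f t - s n t) * norm_L2 h"
      using assms by (auto simp: inner_L2_diff_left[symmetric] intro!: norm_inner_L2_le sq_int_diff always_eventually)
    show "(\<lambda>n. norm_L2 (\<lambda>t. f t - s n t) * norm_L2 h) \<longlonglongrightarrow> 0"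
      using assms(4) by (rule tendsto_mult_left_zero)
  qed
  then show ?thesis
    using tendsto_diff[OF tendsto_const[of "inner_L2 f h"]] by fastforce
qed

lemma norm_L2_tendsto:
  assumes "\<And>n. sq_int (s n)" "sq_int f" "(\<lambda>n. norm_L2 (\<lambda>t. f t - s n t)) \<longlonglongrightarrow> 0"
  shows "(\<lambda>n. norm_L2 (s n)) \<longlonglongrightarrow> norm_L2 f"
proof -
  have "(\<lambda>n. norm_L2 f - norm_L2 (s n)) \<longlonglongrightarrow> 0"
  proof (rule Lim_null_comparison[OF always_eventually assms(3)], rule allI)
    fix n
    have "norm_L2 f \<le> norm_L2 (\<lambda>t. f t - s n t) + norm_L2 (s n)"
      using norm_L2_triangle[of "\<lambda>t. f t - s n t" "s n"] assms by (simp add: sq_int_diff)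
    moreover have "norm_L2 (s n) \<le> norm_L2 (\<lambda>t. f t - s n t) + norm_L2 f"
      using norm_L2_triangle[of "\<lambda>t. s n t - f t" "f"] assms
      by (simp add: sq_int_diff norm_L2_minus_commute[of f])
    ultimately show "norm (norm_L2 f - norm_L2 (s n)) \<le> norm_L2 (\<lambda>t. f t - s n t)"
      by (simp add: abs_le_iff)
  qed
  then show ?thesis
    using tendsto_diff[OF tendsto_const[of "norm_L2 f"]] by fastforce
qed

lemma norm_L2_limit_unique:
  assumes "\<And>n. sq_int (s n)" "sq_int f" "sq_int h"
    and "(\<lambda>n. norm_L2 (\<lambda>t. f t - s n t)) \<longlonglongrightarrow> 0" "(\<lambda>n. norm_L2 (\<lambda>t. h t - s n t)) \<longlonglongrightarrow> 0"
  shows "AE t in lborel. f t = h t"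
proof -
  have "(\<lambda>n. norm_L2 (\<lambda>t. f t - s n t) + norm_L2 (\<lambda>t. h t - s n t)) \<longlonglongrightarrow> 0"
    using tendsto_add[OF assms(4,5)] by simp
  moreover have "norm_L2 (\<lambda>t. f t - h t) \<le> norm_L2 (\<lambda>t. f t - s n t) + norm_L2 (\<lambda>t. h t - s n t)" for n
    using norm_L2_triangle_diff[of f "s n" h] assms by (simp add: norm_L2_minus_commute[of h])
  ultimately have "norm_L2 (\<lambda>t. f t - h t) \<le> 0"
    by (intro LIMSEQ_le_const) auto
  then have "norm_L2 (\<lambda>t. f t - h t) = 0" by (simp add: order_antisym)
  then show ?thesis
    using assms(2,3) norm_L2_diff_eq_0_iff by blast
qed

text \<open>Riesz-Fischer. A subsequence whose steps have norm at most \<open>(1/2)^k\<close>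
  converges almost everywhere, and Fatou's lemma transfers the Cauchy estimate to the pointwise
  limit.\<close>

theorem L2_complete:
  assumes s: "\<And>n. sq_int (s n)"
    and Cauchy: "\<And>e. e > 0 \<Longrightarrow> \<exists>N::nat. \<forall>m\<ge>N. \<forall>n\<ge>N. norm_L2 (\<lambda>t. s m t - s n t) < e"
  obtains h where "sq_int h" "(\<lambda>n. norm_L2 (\<lambda>t. h t - s n t)) \<longlonglongrightarrow> 0"
proof -
  have [measurable]: "s n \<in> borel_measurable borel" for n
    using s sq_int_measurable by blast
  have "\<exists>N. \<forall>m\<ge>N. \<forall>n\<ge>N. norm_L2 (\<lambda>t. s m t - s n t) < (1/2)^k" for k
    by (rule Cauchy) simp
  then obtain M where M: "\<And>k m n. m \<ge> M k \<Longrightarrow> n \<ge> M k \<Longrightarrow> norm_L2 (\<lambda>t. s m t - s n t) < (1/2)^k"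
    by metis
  \<comment> \<open>The partial sums make \<open>r\<close> monotone and at least \<open>M k\<close>;
    the summand \<open>k\<close> makes it exceed every \<open>N\<close>, as the Fatou argument
    requires.\<close>
  define r where "r k = k + (\<Sum>j\<le>k. M j)" for k
  have rM: "M k \<le> r k" for k
    unfolding r_def by (meson atMost_iff finite_atMost le_refl member_le_sum trans_le_add2 zero_le)
  have r_mono: "r k \<le> r (Suc k)" for k by (simp add: r_def)
  define D where "D k t = s (r (Suc k)) t - s (r k) t" for k t
  have [measurable]: "D k \<in> borel_measurable borel" for k unfolding D_def by measurable
  have Dsq: "sq_int (D k)" for k unfolding D_def by (intro sq_int_diff s)
  have Dn: "(norm_L2 (D k))\<^sup>2 \<le> (1/4)^k" for k
  proof -
    have "norm_L2 (D k) \<le> (1/2)^k"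
      unfolding D_def using M[of k "r (Suc k)" "r k"] rM[of k] r_mono[of k] by simp
    then have "(norm_L2 (D k))\<^sup>2 \<le> ((1/2)^k)\<^sup>2" by (intro power_mono) auto
    then show ?thesis by (simp add: power_mult[symmetric] mult.commute power_mult power2_eq_square power_mult_distrib[symmetric])
  qed
  \<comment> \<open>The squared norms are at most \<open>(1/4)^k\<close>, so the weight
    \<open>2^k\<close> still leaves a convergent series; it is what turns summability of squares
    into summability of \<open>D k t\<close> below.\<close>
  have "(\<integral>\<^sup>+ t. (\<Sum>k. ennreal (2^k * (norm (D k t))\<^sup>2)) \<partial>lborel)
      = (\<Sum>k. \<integral>\<^sup>+ t. ennreal (2^k * (norm (D k t))\<^sup>2) \<partial>lborel)"
    by (rule nn_integral_suminf) simp
  also have "\<dots> = (\<Sum>k. ennreal (2^k * (norm_L2 (D k))\<^sup>2))"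
    by (simp add: ennreal_mult nn_integral_cmult ennreal_norm_L2_sq Dsq)
  also have "\<dots> \<le> (\<Sum>k. ennreal ((1/2)^k))"
  proof (intro suminf_le allI ennreal_leI)
    fix k :: nat
    have "2^k * (norm_L2 (D k))\<^sup>2 \<le> 2^k * (1/4)^k" using Dn by (intro mult_left_mono) auto
    also have "\<dots> = (1/2::real)^k" by (simp add: power_mult_distrib[symmetric])
    finally show "2^k * (norm_L2 (D k))\<^sup>2 \<le> (1/2)^k" .
  qed auto
  also have "\<dots> = ennreal (\<Sum>k. (1/2)^k)"
    by (rule suminf_ennreal2) (auto intro: summable_geometric)
  also have "\<dots> < \<infinity>" by simp
  finally have "AE t in lborel. (\<Sum>k. ennreal (2^k * (norm (D k t))\<^sup>2)) \<noteq> \<infinity>"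
    by (intro nn_integral_PInf_AE) auto
  then have conv: "AE t in lborel. convergent (\<lambda>k. s (r k) t)"
  proof eventually_elim
    case (elim t)
    then have "summable (\<lambda>k. 2^k * (norm (D k t))\<^sup>2)"
      by (intro summable_suminf_not_top) auto
    then have "summable (\<lambda>k. (1/2)^k + 2^k * (norm (D k t))\<^sup>2)"
      by (intro summable_add summable_geometric) auto
    then have "summable (\<lambda>k. D k t)"
    proof (rule summable_comparison_test'[where N = 0])
      fix k :: nat
      let ?x = "norm (D k t)"
      \<comment> \<open>Weighted arithmetic-geometric mean inequality: the right side expands to
        \<open>2^k * ?x\<^sup>2 - 2 * ?x + (1/2)^k\<close>.\<close>
      have "0 \<le> 2^k * (?x - (1/2)^k)\<^sup>2" by simp
      also have "\<dots> = 2^k * ?x\<^sup>2 - 2 * ?x * (2^k * (1/2)^k) + (2^k * (1/2)^k) * (1/2)^k"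
        by (simp add: power2_eq_square algebra_simps)
      also have "2^k * (1/2)^k = (1::real)" by (simp add: power_mult_distrib[symmetric])
      finally show "norm (D k t) \<le> (1/2)^k + 2^k * (norm (D k t))\<^sup>2"
        by simp (smt (verit) norm_ge_zero)
    qed
    then have "convergent (\<lambda>n. \<Sum>k<n. D k t)" by (simp add: summable_iff_convergent)
    moreover have "(\<Sum>k<n. D k t) = s (r n) t - s (r 0) t" for n
      unfolding D_def by (rule sum_lessThan_telescope)
    ultimately have "convergent (\<lambda>n. s (r n) t - s (r 0) t)" by simp
    then show ?case using convergent_diff_const_right_iff by blast
  qed
  define h where "h t = lim (\<lambda>k. s (r k) t)" for t
  have [measurable]: "h \<in> borel_measurable borel" unfolding h_def by measurable
  have key: "sq_int (\<lambda>t. h t - s n t) \<and> (norm_L2 (\<lambda>t. h t - s n t))\<^sup>2 \<le> e\<^sup>2"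
    if N: "\<forall>m\<ge>N. \<forall>n\<ge>N. norm_L2 (\<lambda>t. s m t - s n t) < e" and n: "n \<ge> N" for n N e
  proof -
    have "(\<integral>\<^sup>+ t. ennreal ((norm (h t - s n t))\<^sup>2) \<partial>lborel)
        = (\<integral>\<^sup>+ t. liminf (\<lambda>k. ennreal ((norm (s (r k) t - s n t))\<^sup>2)) \<partial>lborel)"
    proof (rule nn_integral_cong_AE)
      show "AE t in lborel. ennreal ((norm (h t - s n t))\<^sup>2) = liminf (\<lambda>k. ennreal ((norm (s (r k) t - s n t))\<^sup>2))"
        using conv
      proof eventually_elim
        case (elim t)
        then have "(\<lambda>k. s (r k) t) \<longlonglongrightarrow> h t" unfolding h_def by (simp add: convergent_LIMSEQ_iff)
        then have "(\<lambda>k. ennreal ((norm (s (r k) t - s n t))\<^sup>2)) \<longlonglongrightarrow> ennreal ((norm (h t - s n t))\<^sup>2)"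
          by (intro tendsto_ennrealI tendsto_intros)
        then show ?case by (metis lim_imp_Liminf trivial_limit_sequentially)
      qed
    qed
    also have "\<dots> \<le> liminf (\<lambda>k. \<integral>\<^sup>+ t. ennreal ((norm (s (r k) t - s n t))\<^sup>2) \<partial>lborel)"
      by (rule nn_integral_liminf) simp
    also have "\<dots> \<le> ennreal (e\<^sup>2)"
    proof (rule Liminf_le)
      show "\<forall>\<^sub>F k in sequentially. (\<integral>\<^sup>+ t. ennreal ((norm (s (r k) t - s n t))\<^sup>2) \<partial>lborel) \<le> ennreal (e\<^sup>2)"
        using eventually_ge_at_top[of N]
      proof eventually_elim
        case (elim k)
        then have "r k \<ge> N" unfolding r_def by simp
        then have "norm_L2 (\<lambda>t. s (r k) t - s n t) < e" using N n by blast
        then have "(norm_L2 (\<lambda>t. s (r k) t - s n t))\<^sup>2 \<le> e\<^sup>2" by (intro power_mono) auto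
        then show ?case by (simp add: ennreal_norm_L2_sq sq_int_diff s ennreal_leI)
      qed
    qed simp
    finally show ?thesis using sq_int_nn_integral[of "\<lambda>t. h t - s n t" "e\<^sup>2"] by simp
  qed
  have hs: "sq_int h"
  proof -
    obtain N where "\<forall>m\<ge>N. \<forall>n\<ge>N. norm_L2 (\<lambda>t. s m t - s n t) < 1" using Cauchy[of 1] by auto
    then have "sq_int (\<lambda>t. h t - s N t)" using key by blast
    then have "sq_int (\<lambda>t. (h t - s N t) + s N t)" by (intro sq_int_add s)
    then show ?thesis by simp
  qed
  moreover have "(\<lambda>n. norm_L2 (\<lambda>t. h t - s n t)) \<longlonglongrightarrow> 0"
  proof (rule LIMSEQ_I)
    fix e :: real assume "e > 0"
    then obtain N where "\<forall>m\<ge>N. \<forall>n\<ge>N. norm_L2 (\<lambda>t. s m t - s n t) < e/2"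
      using Cauchy[of "e/2"] by auto
    then have "(norm_L2 (\<lambda>t. h t - s n t))\<^sup>2 \<le> (e/2)\<^sup>2" if "n \<ge> N" for n using key that by blast
    then have "norm_L2 (\<lambda>t. h t - s n t) \<le> e/2" if "n \<ge> N" for n
      using that \<open>e > 0\<close> power2_le_imp_le[of _ "e/2"] by simp
    then show "\<exists>N. \<forall>n\<ge>N. norm (norm_L2 (\<lambda>t. h t - s n t) - 0) < e"
      using \<open>e > 0\<close> by (intro exI[of _ N]) fastforce
  qed
  ultimately show ?thesis using that by blast
qed

lemma L2_truncation_tendsto:
  assumes f: "sq_int f" and [measurable]: "\<And>n::nat. A n \<in> sets borel"
    and "\<And>t. \<forall>\<^sub>F n in sequentially. t \<in> A n"
  shows "(\<lambda>n. norm_L2 (\<lambda>t. f t - indicator (A n) t * f t)) \<longlonglongrightarrow> 0"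
proof -
  have [measurable]: "f \<in> borel_measurable borel" using f sq_int_measurable by blast
  have "(\<lambda>n. LINT t|lborel. (norm (f t - indicator (A n) t * f t))\<^sup>2) \<longlonglongrightarrow> (LINT t|(lborel::real measure). 0)"
  proof (rule integral_dominated_convergence[where w = "\<lambda>t. (norm (f t))\<^sup>2"])
    show "integrable lborel (\<lambda>t. (norm (f t))\<^sup>2)" using f by (rule sq_int_integrable)
    show "AE t in lborel. (\<lambda>n. (norm (f t - indicator (A n) t * f t))\<^sup>2) \<longlonglongrightarrow> 0"
    proof (rule AE_I2)
      fix t
      have "\<forall>\<^sub>F n in sequentially. (norm (f t - indicator (A n) t * f t))\<^sup>2 = 0"
        using assms(3)[of t] by eventually_elim simp
      then show "(\<lambda>n. (norm (f t - indicator (A n) t * f t))\<^sup>2) \<longlonglongrightarrow> 0" by (rule tendsto_eventually)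
    qed
    show "\<And>n. AE t in lborel. norm ((norm (f t - indicator (A n) t * f t))\<^sup>2) \<le> (norm (f t))\<^sup>2"
      by (auto simp: indicator_def)
  qed auto
  then have "(\<lambda>n. sqrt (LINT t|lborel. (norm (f t - indicator (A n) t * f t))\<^sup>2)) \<longlonglongrightarrow> sqrt 0"
    by (intro tendsto_real_sqrt) simp
  then show ?thesis unfolding norm_L2_def by simp
qed

lemma Cauchy_L2_of_convergent:
  assumes "\<And>n. sq_int (s n)" "sq_int f" "(\<lambda>n. norm_L2 (\<lambda>t. f t - s n t)) \<longlonglongrightarrow> 0" "e > 0"
  shows "\<exists>N::nat. \<forall>m\<ge>N. \<forall>n\<ge>N. norm_L2 (\<lambda>t. s m t - s n t) < e"
proof -
  obtain N where N: "\<And>n. n \<ge> N \<Longrightarrow> norm_L2 (\<lambda>t. f t - s n t) < e / 2"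
    using LIMSEQ_D[OF assms(3), of "e/2"] assms(4) by auto
  have "norm_L2 (\<lambda>t. s m t - s n t) < e" if "m \<ge> N" "n \<ge> N" for m n
    using norm_L2_triangle_diff[of "s m" f "s n"] assms N[OF that(1)] N[OF that(2)]
    by (simp add: norm_L2_minus_commute[of "s m" f])
  then show ?thesis by blast
qed

section \<open>The Fourier transform on \<open>L\<^sup>1\<close>\<close>

lemma exp_eq_cis: "exp (complex_of_real x * \<i>) = cis x" "exp (- complex_of_real x * \<i>) = cis (- x)"
  by (simp_all add: cis_conv_exp mult.commute)

lemma borel_measurable_cis [measurable]: "cis \<in> borel_measurable borel"
  by (intro borel_measurable_continuous_onI continuous_intros)

lemma fourier1_cis: "fourier1 f \<omega> = (LINT t|lborel. f t * cis (- (2 * pi * t * \<omega>)))"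
  unfolding fourier1_def exp_eq_cis ..

lemma invfourier1_fourier1: "invfourier1 f t = fourier1 f (- t)"
  unfolding fourier1_cis invfourier1_def exp_eq_cis by (simp add: mult.commute mult.left_commute)

lemma integrable_mult_bounded:
  fixes f m :: "real \<Rightarrow> complex"
  assumes f: "integrable lborel f" and [measurable]: "m \<in> borel_measurable borel" and "\<And>t. norm (m t) \<le> C"
  shows "integrable lborel (\<lambda>t. f t * m t)"
proof (rule Bochner_Integration.integrable_bound)
  show "integrable lborel (\<lambda>t. C * norm (f t))" using f by simp
  have [measurable]: "f \<in> borel_measurable borel" using f by auto
  show "(\<lambda>t. f t * m t) \<in> borel_measurable lborel" by simp
  have "norm (f t * m t) \<le> \<bar>C\<bar> * norm (f t)" for t
    using assms(3)[of t] mult_left_mono[of "norm (m t)" "\<bar>C\<bar>" "norm (f t)"]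
    by (simp add: norm_mult mult.commute)
  then show "AE t in lborel. norm (f t * m t) \<le> norm (C * norm (f t))" by (simp add: abs_mult)
qed

lemma integrable_mult_cis:
  "integrable lborel f \<Longrightarrow> integrable lborel (\<lambda>t. f t * cis (c * t))"
  by (rule integrable_mult_bounded[where C = 1]) auto

lemma integrable_fourier_kernel:
  "integrable lborel f \<Longrightarrow> integrable lborel (\<lambda>t. f t * cis (- (2 * pi * t * \<omega>)))"
  by (rule integrable_mult_bounded[where C = 1]) auto

lemma borel_measurable_fourier1:
  assumes [measurable]: "f \<in> borel_measurable borel"
  shows "fourier1 f \<in> borel_measurable borel"
  unfolding fourier1_cis by measurable

lemma norm_fourier1_le: "norm (fourier1 f \<omega>) \<le> (LINT t|lborel. norm (f t))"
  unfolding fourier1_cis by (rule order_trans[OF integral_norm_bound]) (simp add: norm_mult)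

lemma fourier1_add:
  "integrable lborel f \<Longrightarrow> integrable lborel h \<Longrightarrow>
    fourier1 (\<lambda>t. f t + h t) \<omega> = fourier1 f \<omega> + fourier1 h \<omega>"
  unfolding fourier1_cis by (simp add: distrib_right integrable_fourier_kernel)

lemma fourier1_diff:
  "integrable lborel f \<Longrightarrow> integrable lborel h \<Longrightarrow>
    fourier1 (\<lambda>t. f t - h t) \<omega> = fourier1 f \<omega> - fourier1 h \<omega>"
  unfolding fourier1_cis by (simp add: left_diff_distrib integrable_fourier_kernel)

lemma fourier1_modulate:
  "fourier1 (\<lambda>t. cis (2 * pi * y * t) * f t) \<omega> = fourier1 f (\<omega> - y)"
proof -
  have "cis (2 * pi * y * t) * f t * cis (- (2 * pi * t * \<omega>)) = f t * cis (- (2 * pi * t * (\<omega> - y)))" for t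
    by (simp add: cis_mult algebra_simps)
  then show ?thesis unfolding fourier1_cis by presburger
qed

lemma fourier1_translate:
  "fourier1 (\<lambda>t. f (t - x)) \<omega> = cis (- (2 * pi * x * \<omega>)) * fourier1 f \<omega>"
proof -
  have "fourier1 (\<lambda>t. f (t - x)) \<omega> = (LINT t|lborel. f t * cis (- (2 * pi * (x + t) * \<omega>)))"
    unfolding fourier1_cis by (subst lborel_integral_real_affine[where c = 1 and t = x]) auto
  also have "\<dots> = (LINT t|lborel. cis (- (2 * pi * x * \<omega>)) * (f t * cis (- (2 * pi * t * \<omega>))))"
    by (intro Bochner_Integration.integral_cong) (auto simp: cis_mult algebra_simps mult.left_commute[of _ "f _"])
  finally show ?thesis unfolding fourier1_cis by simp
qed

lemma fourier1_dilate:
  assumes "c \<noteq> 0"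
  shows "fourier1 (\<lambda>t. f (c * t)) \<omega> = complex_of_real (1 / \<bar>c\<bar>) * fourier1 f (\<omega> / c)"
proof -
  have "fourier1 (\<lambda>t. f (c * t)) \<omega> = \<bar>1 / c\<bar> *\<^sub>R (LINT t|lborel. f t * cis (- (2 * pi * (t / c) * \<omega>)))"
    unfolding fourier1_cis using assms
    by (subst lborel_integral_real_affine[where c = "1 / c" and t = 0]) auto
  then show ?thesis unfolding fourier1_cis by (simp add: scaleR_conv_of_real mult.assoc)
qed

text \<open>The kernel is symmetric in its two variables, so this is Fubini. Transforms of L^2
  functions are later computed by moving the transform onto an explicit test function in this
  way.\<close>

lemma fourier1_duality:
  assumes f: "integrable lborel f" and \<phi>: "integrable lborel \<phi>"
  shows "(LINT \<omega>|lborel. fourier1 f \<omega> * \<phi> \<omega>) = (LINT t|lborel. f t * fourier1 \<phi> t)"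
proof -
  have [measurable]: "f \<in> borel_measurable borel" "\<phi> \<in> borel_measurable borel"
    using f \<phi> by auto
  let ?k = "\<lambda>t \<omega>. f t * \<phi> \<omega> * cis (- (2 * pi * t * \<omega>))"
  have "integrable (lborel \<Otimes>\<^sub>M lborel) (case_prod ?k)"
  proof (rule lborel_pair.Fubini_integrable)
    have "(\<integral>\<omega>. norm (case_prod ?k (t, \<omega>)) \<partial>lborel) = norm (f t) * (LINT \<omega>|lborel. norm (\<phi> \<omega>))" for t
      by (simp add: norm_mult)
    then show "integrable lborel (\<lambda>t. \<integral>\<omega>. norm (case_prod ?k (t, \<omega>)) \<partial>lborel)"
      using f by simp
    have "integrable lborel (\<lambda>\<omega>. f t * (\<phi> \<omega> * cis (- (2 * pi * t * \<omega>))))" for t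
      by (intro integrable_mult_right integrable_mult_bounded[where C = 1] \<phi>) auto
    then show "AE t in lborel. integrable lborel (\<lambda>\<omega>. case_prod ?k (t, \<omega>))"
      by (simp add: mult.assoc)
  qed measurable
  then have "(\<integral>\<omega>. (\<integral>t. ?k t \<omega> \<partial>lborel) \<partial>lborel) = (\<integral>t. (\<integral>\<omega>. ?k t \<omega> \<partial>lborel) \<partial>lborel)"
    by (rule lborel_pair.Fubini_integral)
  moreover have "(\<integral>t. ?k t \<omega> \<partial>lborel) = fourier1 f \<omega> * \<phi> \<omega>" for \<omega>
    unfolding fourier1_cis by (subst integral_mult_left_zero[symmetric]) (simp add: mult_ac)
  moreover have "(\<integral>\<omega>. ?k t \<omega> \<partial>lborel) = f t * fourier1 \<phi> t" for t
    unfolding fourier1_cis by (subst integral_mult_right_zero[symmetric]) (simp add: mult_ac)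
  ultimately show ?thesis by simp
qed

text \<open>Scaled so that \<open>gauss 1\<close> is its own Fourier transform. The parameter is a
  dilation: as it tends to 0 the function tends to 1, which makes it a removable damping
  factor.\<close>

definition gauss :: "real \<Rightarrow> real \<Rightarrow> complex" where
  "gauss \<epsilon> t = complex_of_real (exp (- (pi * (\<epsilon> * t)\<^sup>2)))"

lemma borel_measurable_gauss [measurable]: "gauss \<epsilon> \<in> borel_measurable borel"
  unfolding gauss_def by measurable

text \<open>This standard deviation is the one for which the density centred at 0 is the transform
  of \<open>gauss \<epsilon>\<close>.\<close>

lemma normal_density_scaled:
  assumes "\<epsilon> > 0"
  shows "normal_density x (\<epsilon> / sqrt (2 * pi)) t = exp (- (pi * ((t - x) / \<epsilon>)\<^sup>2)) / \<epsilon>"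
  using assms unfolding normal_density_def
  by (simp add: power_divide real_sqrt_divide real_sqrt_mult field_simps)

lemma gauss_normal_density: "gauss 1 t = complex_of_real (normal_density 0 (1 / sqrt (2 * pi)) t)"
  using normal_density_scaled[of 1 0 t] by (simp add: gauss_def)

lemma integrable_gauss: "\<epsilon> \<noteq> 0 \<Longrightarrow> integrable lborel (gauss \<epsilon>)"
proof -
  assume \<epsilon>: "\<epsilon> \<noteq> 0"
  have "integrable lborel (gauss 1)"
    unfolding gauss_normal_density[abs_def] by (intro integrable_of_real integrable_normal_density) auto
  then have "integrable lborel (\<lambda>t. gauss 1 (0 + \<epsilon> * t))"
    using \<epsilon> by (rule lborel_integrable_real_affine)
  then show ?thesis by (simp add: gauss_def[abs_def])
qed

text \<open>The characteristic function of the standard normal law, with both variables rescaled by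
  \<open>sqrt (2 * pi)\<close>.\<close>

lemma fourier1_gauss_1: "fourier1 (gauss 1) \<omega> = gauss 1 \<omega>"
proof -
  let ?s = "- sqrt (2 * pi) * \<omega>"
  have "complex_of_real (exp (- (?s\<^sup>2) / 2)) = char std_normal_distribution ?s"
    by (simp add: char_std_normal_distribution)
  also have "\<dots> = (LINT x|lborel. std_normal_density x *\<^sub>R iexp (?s * x))"
    unfolding char_def by (subst integral_density) auto
  also have "\<dots> = \<bar>sqrt (2 * pi)\<bar> *\<^sub>R (LINT t|lborel. std_normal_density (0 + sqrt (2 * pi) * t) *\<^sub>R iexp (?s * (0 + sqrt (2 * pi) * t)))"
    by (rule lborel_integral_real_affine) simp
  also have "\<dots> = (LINT t|lborel. gauss 1 t * cis (- (2 * pi * t * \<omega>)))"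
    unfolding integral_scaleR_right[symmetric]
  proof (intro Bochner_Integration.integral_cong refl)
    fix t
    have 1: "?s * (0 + sqrt (2 * pi) * t) = - (2 * pi * t * \<omega>)" by (simp add: field_simps)
    have 2: "sqrt (2 * pi) * std_normal_density (0 + sqrt (2 * pi) * t) = exp (- (pi * t\<^sup>2))"
      by (simp add: std_normal_density_def power_mult_distrib)
    show "\<bar>sqrt (2 * pi)\<bar> *\<^sub>R (std_normal_density (0 + sqrt (2 * pi) * t) *\<^sub>R iexp (?s * (0 + sqrt (2 * pi) * t)))
       = gauss 1 t * cis (- (2 * pi * t * \<omega>))"
      unfolding 1 unfolding cis_conv_exp gauss_def scaleR_scaleR using 2 by (simp add: scaleR_conv_of_real)
  qed
  finally show ?thesis
    unfolding fourier1_cis[symmetric] by (simp add: gauss_def[of _ \<omega>] power_mult_distrib)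
qed

lemma fourier1_gauss:
  assumes "\<epsilon> > 0"
  shows "fourier1 (gauss \<epsilon>) \<omega> = complex_of_real (normal_density 0 (\<epsilon> / sqrt (2 * pi)) \<omega>)"
proof -
  have "gauss \<epsilon> = (\<lambda>t. gauss 1 (\<epsilon> * t))" by (simp add: gauss_def fun_eq_iff)
  then show ?thesis
    using assms by (simp add: fourier1_dilate fourier1_gauss_1 normal_density_scaled) (simp add: gauss_def)
qed

lemma fourier1_gauss_packet:
  "fourier1 (\<lambda>t. cis (2 * pi * y * t) * gauss 1 t) \<omega> = gauss 1 (\<omega> - y)"
  by (simp add: fourier1_modulate fourier1_gauss_1)

lemma fourier1_gauss_translate:
  "fourier1 (\<lambda>t. gauss 1 (t - y)) \<omega> = cis (- (2 * pi * y * \<omega>)) * gauss 1 \<omega>"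
  by (simp add: fourier1_translate fourier1_gauss_1)

section \<open>The L^2 bound for Fourier integrals\<close>

lemma nn_integral_normal_density:
  assumes "\<sigma> > 0"
  shows "(\<integral>\<^sup>+ t. ennreal (normal_density x \<sigma> t) \<partial>lborel) = 1"
  using assms by (simp add: nn_integral_eq_integral integrable_normal_density integral_normal_density)

lemma norm_integral_le_nn_integral:
  fixes f :: "'a \<Rightarrow> 'b :: {banach, second_countable_topology}"
  shows "ennreal (norm (integral\<^sup>L M f)) \<le> (\<integral>\<^sup>+ x. ennreal (norm (f x)) \<partial>M)"
  by (cases "integrable M f") (auto simp: integral_norm_bound_ennreal not_integrable_integral_eq)

text \<open>Pairing the transform of \<open>f\<close> with its conjugate, damped by a Gaussian, gives a quadratic form
  in \<open>f\<close> whose kernel is a probability density in each variable; Schur's test bounds it by the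
  squared norm of \<open>f\<close>.\<close>

lemma gauss_damped_fourier1_le:
  assumes f: "integrable lborel f" "sq_int f" and \<epsilon>: "\<epsilon> > 0"
  shows "(\<integral>\<^sup>+ \<omega>. ennreal ((norm (fourier1 f \<omega>))\<^sup>2 * exp (- (pi * (\<epsilon> * \<omega>)\<^sup>2))) \<partial>lborel) \<le> ennreal ((norm_L2 f)\<^sup>2)"
proof -
  have [measurable]: "f \<in> borel_measurable borel" using f by auto
  have [measurable]: "fourier1 f \<in> borel_measurable borel" by (rule borel_measurable_fourier1) simp
  define \<sigma> where "\<sigma> = \<epsilon> / sqrt (2 * pi)"
  have \<sigma>: "\<sigma> > 0" using \<epsilon> by (simp add: \<sigma>_def)
  let ?\<kappa> = "normal_density 0 \<sigma>"
  let ?\<phi> = "\<lambda>\<omega>. gauss \<epsilon> \<omega> * cnj (fourier1 f \<omega>)"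
  have \<phi>: "integrable lborel ?\<phi>"
    using \<epsilon> norm_fourier1_le[of f] by (intro integrable_mult_bounded integrable_gauss) auto
  \<comment> \<open>Duality against the modulated Gaussian turns the damped transform into a
    convolution of \<open>f\<close> with a normal density; positivity and total mass one of the
    kernel come from here.\<close>
  have \<phi>_hat: "cnj (fourier1 ?\<phi> s) = (LINT t|lborel. f t * complex_of_real (?\<kappa> (t - s)))" for s
  proof -
    have "cnj (fourier1 ?\<phi> s) = (LINT \<omega>|lborel. fourier1 f \<omega> * (cis (2 * pi * s * \<omega>) * gauss \<epsilon> \<omega>))"
      unfolding fourier1_cis[of ?\<phi>] Bochner_Integration.integral_cnj[symmetric]
      by (intro Bochner_Integration.integral_cong) (auto simp: cis_cnj gauss_def mult_ac)
    also have "\<dots> = (LINT t|lborel. f t * fourier1 (\<lambda>\<omega>. cis (2 * pi * s * \<omega>) * gauss \<epsilon> \<omega>) t)"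
      using integrable_mult_cis[OF integrable_gauss, of \<epsilon> "2 * pi * s"] \<epsilon>
      by (intro fourier1_duality f) (simp add: mult.commute)
    finally show ?thesis
      using \<epsilon> by (simp add: fourier1_modulate fourier1_gauss \<sigma>_def)
  qed
  have \<phi>_hat_le: "ennreal (norm (fourier1 ?\<phi> s)) \<le> (\<integral>\<^sup>+ t. ennreal (norm (f t) * ?\<kappa> (t - s)) \<partial>lborel)" for s
  proof -
    have "norm (fourier1 ?\<phi> s) = norm (LINT t|lborel. f t * complex_of_real (?\<kappa> (t - s)))"
      unfolding \<phi>_hat[symmetric] by simp
    also have "ennreal \<dots> \<le> (\<integral>\<^sup>+ t. ennreal (norm (f t * complex_of_real (?\<kappa> (t - s)))) \<partial>lborel)"
      by (rule norm_integral_le_nn_integral)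
    finally show ?thesis by (simp add: norm_mult)
  qed
  have "(\<integral>\<^sup>+ \<omega>. ennreal ((norm (fourier1 f \<omega>))\<^sup>2 * exp (- (pi * (\<epsilon> * \<omega>)\<^sup>2))) \<partial>lborel)
      = ennreal (norm (LINT \<omega>|lborel. fourier1 f \<omega> * ?\<phi> \<omega>))"
  proof -
    let ?u = "\<lambda>\<omega>. (norm (fourier1 f \<omega>))\<^sup>2 * exp (- (pi * (\<epsilon> * \<omega>)\<^sup>2))"
    have u: "fourier1 f \<omega> * ?\<phi> \<omega> = complex_of_real (?u \<omega>)" for \<omega>
      using complex_norm_square[of "fourier1 f \<omega>"] by (simp add: gauss_def mult_ac)
    have "integrable lborel (\<lambda>\<omega>. ?\<phi> \<omega> * fourier1 f \<omega>)"
      using norm_fourier1_le[of f] by (intro integrable_mult_bounded \<phi>) auto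
    then have "integrable lborel (\<lambda>\<omega>. complex_of_real (?u \<omega>))"
      unfolding u[symmetric] by (simp add: mult_ac)
    then have "integrable lborel ?u" using complex_of_real_integrable_eq by blast
    then have "(\<integral>\<^sup>+ \<omega>. ennreal (?u \<omega>) \<partial>lborel) = ennreal (integral\<^sup>L lborel ?u)"
      by (intro nn_integral_eq_integral) auto
    moreover have "norm (LINT \<omega>|lborel. fourier1 f \<omega> * ?\<phi> \<omega>) = integral\<^sup>L lborel ?u"
      unfolding u integral_complex_of_real by simp
    ultimately show ?thesis by simp
  qed
  also have "(LINT \<omega>|lborel. fourier1 f \<omega> * ?\<phi> \<omega>) = (LINT s|lborel. f s * fourier1 ?\<phi> s)"
    by (intro fourier1_duality f \<phi>)
  also have "ennreal (norm \<dots>) \<le> (\<integral>\<^sup>+ s. ennreal (norm (f s * fourier1 ?\<phi> s)) \<partial>lborel)"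
    by (rule norm_integral_le_nn_integral)
  also have "\<dots> \<le> (\<integral>\<^sup>+ s. (\<integral>\<^sup>+ t. ennreal ((norm (f s))\<^sup>2 / 2) * ennreal (?\<kappa> (t - s)) + ennreal ((norm (f t))\<^sup>2 / 2) * ennreal (?\<kappa> (t - s)) \<partial>lborel) \<partial>lborel)"
  proof (rule nn_integral_mono)
    fix s :: real
    have "ennreal (norm (f s * fourier1 ?\<phi> s)) \<le> ennreal (norm (f s)) * (\<integral>\<^sup>+ t. ennreal (norm (f t) * ?\<kappa> (t - s)) \<partial>lborel)"
      unfolding norm_mult using \<phi>_hat_le[of s] by (simp add: ennreal_mult mult_left_mono)
    also have "\<dots> = (\<integral>\<^sup>+ t. ennreal (norm (f s)) * ennreal (norm (f t) * ?\<kappa> (t - s)) \<partial>lborel)"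
      by (rule nn_integral_cmult[symmetric]) simp
    also have "\<dots> \<le> (\<integral>\<^sup>+ t. ennreal ((norm (f s))\<^sup>2 / 2) * ennreal (?\<kappa> (t - s)) + ennreal ((norm (f t))\<^sup>2 / 2) * ennreal (?\<kappa> (t - s)) \<partial>lborel)"
    proof (rule nn_integral_mono)
      fix t
      \<comment> \<open>Splitting the product into squares lets the density be integrated out, in
        each term, over the variable that the square does not involve.\<close>
      have "0 \<le> (norm (f s) - norm (f t))\<^sup>2" by simp
      then have "norm (f s) * norm (f t) \<le> (norm (f s))\<^sup>2 / 2 + (norm (f t))\<^sup>2 / 2"
        by (simp add: power2_diff)
      then have "norm (f s) * norm (f t) * ?\<kappa> (t - s) \<le> ((norm (f s))\<^sup>2 / 2 + (norm (f t))\<^sup>2 / 2) * ?\<kappa> (t - s)"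
        by (rule mult_right_mono) simp
      then show "ennreal (norm (f s)) * ennreal (norm (f t) * ?\<kappa> (t - s))
         \<le> ennreal ((norm (f s))\<^sup>2 / 2) * ennreal (?\<kappa> (t - s)) + ennreal ((norm (f t))\<^sup>2 / 2) * ennreal (?\<kappa> (t - s))"
        by (simp add: ennreal_mult[symmetric] ennreal_plus[symmetric] distrib_right mult.assoc del: ennreal_plus)
    qed
    finally show "ennreal (norm (f s * fourier1 ?\<phi> s)) \<le> \<dots>" .
  qed
  also have "\<dots> = (\<integral>\<^sup>+ s. (\<integral>\<^sup>+ t. ennreal ((norm (f s))\<^sup>2 / 2) * ennreal (?\<kappa> (t - s)) \<partial>lborel) \<partial>lborel)
      + (\<integral>\<^sup>+ s. (\<integral>\<^sup>+ t. ennreal ((norm (f t))\<^sup>2 / 2) * ennreal (?\<kappa> (t - s)) \<partial>lborel) \<partial>lborel)"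
    by (simp add: nn_integral_add)
  also have "(\<integral>\<^sup>+ s. (\<integral>\<^sup>+ t. ennreal ((norm (f t))\<^sup>2 / 2) * ennreal (?\<kappa> (t - s)) \<partial>lborel) \<partial>lborel)
     = (\<integral>\<^sup>+ t. (\<integral>\<^sup>+ s. ennreal ((norm (f t))\<^sup>2 / 2) * ennreal (?\<kappa> (t - s)) \<partial>lborel) \<partial>lborel)"
    by (rule lborel_pair.Fubini') measurable
  also have "(\<integral>\<^sup>+ t. (\<integral>\<^sup>+ s. ennreal ((norm (f t))\<^sup>2 / 2) * ennreal (?\<kappa> (t - s)) \<partial>lborel) \<partial>lborel)
     = (\<integral>\<^sup>+ t. ennreal ((norm (f t))\<^sup>2 / 2) \<partial>lborel)"
  proof -
    have "?\<kappa> (t - s) = normal_density t \<sigma> s" for t s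
      by (simp add: normal_density_def power2_commute)
    then show ?thesis using \<sigma> by (simp add: nn_integral_cmult nn_integral_normal_density)
  qed
  also have "(\<integral>\<^sup>+ s. (\<integral>\<^sup>+ t. ennreal ((norm (f s))\<^sup>2 / 2) * ennreal (?\<kappa> (t - s)) \<partial>lborel) \<partial>lborel)
     = (\<integral>\<^sup>+ t. ennreal ((norm (f t))\<^sup>2 / 2) \<partial>lborel)"
  proof -
    have "?\<kappa> (t - s) = normal_density s \<sigma> t" for t s
      by (simp add: normal_density_def)
    then show ?thesis using \<sigma> by (simp add: nn_integral_cmult nn_integral_normal_density)
  qed
  also have "(\<integral>\<^sup>+ t. ennreal ((norm (f t))\<^sup>2 / 2) \<partial>lborel) + (\<integral>\<^sup>+ t. ennreal ((norm (f t))\<^sup>2 / 2) \<partial>lborel)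
     = (\<integral>\<^sup>+ t. ennreal ((norm (f t))\<^sup>2) \<partial>lborel)"
    by (subst nn_integral_add[symmetric]) (auto simp: ennreal_plus[symmetric] simp del: ennreal_plus)
  finally show ?thesis by (simp add: ennreal_norm_L2_sq f)
qed

text \<open>The damping is removed by Fatou as its parameter \<open>1 / real (Suc n)\<close> tends
  to 0. This yields an inequality only; equality comes with inversion.\<close>

theorem fourier1_L2_contraction:
  assumes f: "integrable lborel f" "sq_int f"
  shows "sq_int (fourier1 f)" "norm_L2 (fourier1 f) \<le> norm_L2 f"
proof -
  have [measurable]: "fourier1 f \<in> borel_measurable borel"
    using f by (intro borel_measurable_fourier1) auto
  let ?u = "\<lambda>n \<omega>. ennreal ((norm (fourier1 f \<omega>))\<^sup>2 * exp (- (pi * (1 / real (Suc n) * \<omega>)\<^sup>2)))"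
  have lim: "(\<lambda>n. ?u n \<omega>) \<longlonglongrightarrow> ennreal ((norm (fourier1 f \<omega>))\<^sup>2)" for \<omega>
  proof (rule tendsto_ennrealI)
    have "(\<lambda>n. (norm (fourier1 f \<omega>))\<^sup>2 * exp (- (pi * (1 / real (Suc n) * \<omega>)\<^sup>2)))
       \<longlonglongrightarrow> (norm (fourier1 f \<omega>))\<^sup>2 * exp (- (pi * (0 * \<omega>)\<^sup>2))"
      by (intro tendsto_intros LIMSEQ_Suc[OF lim_1_over_n])
    then show "(\<lambda>n. (norm (fourier1 f \<omega>))\<^sup>2 * exp (- (pi * (1 / real (Suc n) * \<omega>)\<^sup>2)))
       \<longlonglongrightarrow> (norm (fourier1 f \<omega>))\<^sup>2" by simp
  qed
  have "(\<integral>\<^sup>+ \<omega>. ennreal ((norm (fourier1 f \<omega>))\<^sup>2) \<partial>lborel) = (\<integral>\<^sup>+ \<omega>. liminf (\<lambda>n. ?u n \<omega>) \<partial>lborel)"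
    using lim by (intro nn_integral_cong) (metis lim_imp_Liminf trivial_limit_sequentially)
  also have "\<dots> \<le> liminf (\<lambda>n. \<integral>\<^sup>+ \<omega>. ?u n \<omega> \<partial>lborel)"
    by (rule nn_integral_liminf) simp
  also have "\<dots> \<le> ennreal ((norm_L2 f)\<^sup>2)"
    by (intro Liminf_le always_eventually allI gauss_damped_fourier1_le[OF f]) auto
  finally have le: "(\<integral>\<^sup>+ \<omega>. ennreal ((norm (fourier1 f \<omega>))\<^sup>2) \<partial>lborel) \<le> ennreal ((norm_L2 f)\<^sup>2)" .
  show "sq_int (fourier1 f)" using le by (intro sq_int_nn_integral) auto
  have "(norm_L2 (fourier1 f))\<^sup>2 \<le> (norm_L2 f)\<^sup>2" using le by (intro sq_int_nn_integral) auto
  then show "norm_L2 (fourier1 f) \<le> norm_L2 f" by (rule power2_le_imp_le) simp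
qed

text \<open>For a real function, the positive and the negative part have the same transform, so after
  normalisation they are densities of the same probability measure.\<close>

lemma real_fourier1_zero_imp_AE_zero:
  fixes u :: "real \<Rightarrow> real"
  assumes u: "integrable lborel u" and z: "\<And>\<omega>. fourier1 (\<lambda>t. complex_of_real (u t)) \<omega> = 0"
  shows "AE t in lborel. u t = 0"
proof -
  have [measurable]: "u \<in> borel_measurable borel" using u by auto
  define p where "p t = max 0 (u t)" for t
  define n where "n t = max 0 (- u t)" for t
  have [measurable]: "p \<in> borel_measurable borel" "n \<in> borel_measurable borel"
    unfolding p_def n_def by measurable
  have p: "integrable lborel p" and n: "integrable lborel n"
    unfolding p_def n_def using u by auto
  have nn: "0 \<le> p t" "0 \<le> n t" "u t = p t - n t" for t by (auto simp: p_def n_def)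
  let ?cp = "\<lambda>t. complex_of_real (p t)" and ?cn = "\<lambda>t. complex_of_real (n t)"
  have eq: "fourier1 ?cp \<omega> = fourier1 ?cn \<omega>" for \<omega>
  proof -
    have "fourier1 ?cp \<omega> - fourier1 ?cn \<omega> = fourier1 (\<lambda>t. ?cp t - ?cn t) \<omega>"
      using p n by (intro fourier1_diff[symmetric]) auto
    then show ?thesis using z[of \<omega>] by (simp add: nn)
  qed
  \<comment> \<open>The common mass of both parts, read off from their transforms at frequency 0,
    serves as the normalising constant.\<close>
  define I where "I = integral\<^sup>L lborel p"
  have I: "integral\<^sup>L lborel n = I"
    using eq[of 0] unfolding fourier1_cis I_def by simp
  show ?thesis
  proof (cases "I = 0")
    case True
    then have "integral\<^sup>L lborel p = 0" "integral\<^sup>L lborel n = 0" using I by (auto simp: I_def)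
    then have "AE t in lborel. p t = 0" "AE t in lborel. n t = 0"
      using p n nn by (simp_all add: integral_nonneg_eq_0_iff_AE)
    then show ?thesis by eventually_elim (simp add: nn)
  next
    case False
    then have "I > 0" unfolding I_def using nn by (simp add: order.not_eq_order_implies_strict)
    \<comment> \<open>\<open>char\<close> uses the kernel exp(i s x), hence the argument
      \<open>- s / (2 * pi)\<close> of \<open>fourier1\<close>.\<close>
    have dist: "real_distribution (density lborel (\<lambda>t. ennreal (q t / I)))"
      and chr: "char (density lborel (\<lambda>t. ennreal (q t / I))) s = fourier1 (\<lambda>t. complex_of_real (q t)) (- s / (2 * pi)) / complex_of_real I"
      if q: "integrable lborel q" "\<And>t. 0 \<le> q t" "integral\<^sup>L lborel q = I" for q s
    proof -
      have [measurable]: "q \<in> borel_measurable borel" using q by auto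
      have "(\<integral>\<^sup>+ t. ennreal (q t / I) \<partial>lborel) = ennreal (LINT t|lborel. q t / I)"
        using q \<open>I > 0\<close> by (intro nn_integral_eq_integral) auto
      also have "\<dots> = 1" using q \<open>I > 0\<close> by simp
      finally have "prob_space (density lborel (\<lambda>t. ennreal (q t / I)))"
        by (intro prob_spaceI) (simp add: emeasure_density)
      then show "real_distribution (density lborel (\<lambda>t. ennreal (q t / I)))"
        by (intro real_distribution.intro real_distribution_axioms.intro) auto
      have "char (density lborel (\<lambda>t. ennreal (q t / I))) s = (LINT x|lborel. (q x / I) *\<^sub>R iexp (s * x))"
        unfolding char_def using q \<open>I > 0\<close> by (subst integral_density) auto
      also have "\<dots> = (LINT x|lborel. complex_of_real (q x) * cis (- (2 * pi * x * (- s / (2 * pi)))) / complex_of_real I)"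
        by (intro Bochner_Integration.integral_cong) (auto simp: cis_conv_exp scaleR_conv_of_real mult_ac)
      finally show "char (density lborel (\<lambda>t. ennreal (q t / I))) s = fourier1 (\<lambda>t. complex_of_real (q t)) (- s / (2 * pi)) / complex_of_real I"
        unfolding fourier1_cis by simp
    qed
    have "density lborel (\<lambda>t. ennreal (p t / I)) = density lborel (\<lambda>t. ennreal (n t / I))"
    proof (rule Levy_uniqueness)
      show "char (density lborel (\<lambda>t. ennreal (p t / I))) = char (density lborel (\<lambda>t. ennreal (n t / I)))"
        by (rule ext) (simp add: chr[OF p nn(1) I_def[symmetric]] chr[OF n nn(2) I] eq)
    qed (use dist[OF p nn(1) I_def[symmetric]] dist[OF n nn(2) I] in auto)
    then have "AE t in lborel. ennreal (p t / I) = ennreal (n t / I)"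
      by (intro sigma_finite_measure.density_unique sigma_finite_lborel) auto
    then show ?thesis
    proof eventually_elim
      case (elim t)
      then have "p t / I = n t / I" using nn \<open>I > 0\<close> by (subst (asm) ennreal_inj) auto
      then show ?case using nn \<open>I > 0\<close> by simp
    qed
  qed
qed

text \<open>The transform of the conjugate is the reflected conjugate of the transform, so it
  vanishes as well; this reduces the claim to the real and the imaginary part.\<close>

theorem fourier1_zero_imp_AE_zero:
  assumes f: "integrable lborel f" and z: "\<And>\<omega>. fourier1 f \<omega> = 0"
  shows "AE t in lborel. f t = 0"
proof -
  have c: "fourier1 (\<lambda>t. cnj (f t)) \<omega> = 0" for \<omega>
  proof -
    have "fourier1 (\<lambda>t. cnj (f t)) \<omega> = cnj (fourier1 f (- \<omega>))"
      unfolding fourier1_cis Bochner_Integration.integral_cnj[symmetric] by (simp add: cis_cnj)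
    then show ?thesis by (simp add: z)
  qed
  have fc: "integrable lborel (\<lambda>t. cnj (f t))" using f by simp
  have "fourier1 (\<lambda>t. complex_of_real (Re (f t))) \<omega> = 0" for \<omega>
  proof -
    have "fourier1 (\<lambda>t. f t + cnj (f t)) \<omega> = 0" by (simp add: fourier1_add f fc z c)
    then have "fourier1 (\<lambda>t. 2 * complex_of_real (Re (f t))) \<omega> = 0" by (simp add: complex_add_cnj)
    then show ?thesis unfolding fourier1_cis mult.assoc by simp
  qed
  then have "AE t in lborel. Re (f t) = 0" using f by (intro real_fourier1_zero_imp_AE_zero) auto
  moreover have "fourier1 (\<lambda>t. complex_of_real (Im (f t))) \<omega> = 0" for \<omega>
  proof -
    have "fourier1 (\<lambda>t. f t - cnj (f t)) \<omega> = 0" by (simp add: fourier1_diff f fc z c)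
    then have "fourier1 (\<lambda>t. (2 * \<i>) * complex_of_real (Im (f t))) \<omega> = 0"
      by (simp add: complex_diff_cnj mult_ac)
    then show ?thesis unfolding fourier1_cis mult.assoc by simp
  qed
  then have "AE t in lborel. Im (f t) = 0" using f by (intro real_fourier1_zero_imp_AE_zero) auto
  ultimately show ?thesis by eventually_elim (simp add: complex_eq_iff)
qed

section \<open>The Fourier transform on \<open>L\<^sup>2\<close>\<close>

lemma sq_int_indicator_Icc: "sq_int (indicator {a..b :: real})"
proof -
  have "integrable lborel (indicator {a..b} :: real \<Rightarrow> real)"
    by (simp add: integrable_indicator_iff emeasure_lborel_Icc_eq)
  moreover have "(norm (indicator {a..b} t :: complex))\<^sup>2 = indicator {a..b} t" for t :: real
    by (simp add: indicator_def)
  ultimately show ?thesis unfolding sq_int_def by simp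
qed

lemma integrable_truncation:
  "sq_int f \<Longrightarrow> integrable lborel (\<lambda>t. indicator {a..b :: real} t * f t)"
  by (intro integrable_mult_sq_int sq_int_indicator_Icc)

lemma sq_int_truncation: "sq_int f \<Longrightarrow> sq_int (\<lambda>t. indicator {a..b :: real} t * f t)"
  by (intro sq_int_indicator_mult) auto

lemma truncation_tendsto:
  assumes "sq_int f"
  shows "(\<lambda>N. norm_L2 (\<lambda>t. f t - indicator {- real N..real N} t * f t)) \<longlonglongrightarrow> 0"
proof (rule L2_truncation_tendsto[OF assms])
  fix t :: real
  obtain N where "\<bar>t\<bar> \<le> real N" using real_arch_simple by blast
  then have "t \<in> {- real n..real n}" if "n \<ge> N" for n using that by auto
  then show "\<forall>\<^sub>F n in sequentially. t \<in> {- real n..real n}"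
    unfolding eventually_sequentially by blast
qed simp

lemma sq_int_fourier1_truncation:
  "sq_int f \<Longrightarrow> sq_int (fourier1 (\<lambda>t. indicator {a..b :: real} t * f t))"
  by (intro fourier1_L2_contraction integrable_truncation sq_int_truncation)

text \<open>The choice in \<open>fourierL2\<close> has a witness: by the contraction bound the
  transforms of the truncations form a Cauchy sequence.\<close>

lemma fourierL2_spec:
  assumes f: "sq_int f"
  shows "sq_int (fourierL2 f)"
    and "(\<lambda>N::nat. norm_L2 (\<lambda>\<omega>. fourierL2 f \<omega> - fourier1 (\<lambda>t. indicator {- real N..real N} t * f t) \<omega>)) \<longlonglongrightarrow> 0"
proof -
  let ?T = "\<lambda>(N::nat) t. indicator {- real N..real N} t * f t"
  have "\<exists>N::nat. \<forall>m\<ge>N. \<forall>n\<ge>N. norm_L2 (\<lambda>\<omega>. fourier1 (?T m) \<omega> - fourier1 (?T n) \<omega>) < e" if "e > 0" for e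
  proof -
    obtain N :: nat where "\<forall>m\<ge>N. \<forall>n\<ge>N. norm_L2 (\<lambda>t. ?T m t - ?T n t) < e"
      using Cauchy_L2_of_convergent[OF sq_int_truncation[OF f] f truncation_tendsto[OF f] \<open>e > 0\<close>] by blast
    moreover have "norm_L2 (\<lambda>\<omega>. fourier1 (?T m) \<omega> - fourier1 (?T n) \<omega>) \<le> norm_L2 (\<lambda>t. ?T m t - ?T n t)" for m n
    proof -
      have "fourier1 (\<lambda>t. ?T m t - ?T n t) = (\<lambda>\<omega>. fourier1 (?T m) \<omega> - fourier1 (?T n) \<omega>)"
        by (rule ext) (intro fourier1_diff integrable_truncation f)
      moreover have "norm_L2 (fourier1 (\<lambda>t. ?T m t - ?T n t)) \<le> norm_L2 (\<lambda>t. ?T m t - ?T n t)"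
        by (intro fourier1_L2_contraction Bochner_Integration.integrable_diff integrable_truncation f
            sq_int_diff sq_int_truncation)
      ultimately show ?thesis by simp
    qed
    ultimately show ?thesis by (meson le_less_trans)
  qed
  then obtain h where "sq_int h" "(\<lambda>n. norm_L2 (\<lambda>t. h t - fourier1 (?T n) t)) \<longlonglongrightarrow> 0"
    using L2_complete[of "\<lambda>N. fourier1 (?T N)"] sq_int_fourier1_truncation[OF f] by blast
  then have ex: "\<exists>h. sq_int h \<and> (\<lambda>n. norm_L2 (\<lambda>t. h t - fourier1 (?T n) t)) \<longlonglongrightarrow> 0" by blast
  show "sq_int (fourierL2 f)"
    and "(\<lambda>N::nat. norm_L2 (\<lambda>\<omega>. fourierL2 f \<omega> - fourier1 (?T N) \<omega>)) \<longlonglongrightarrow> 0"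
    using someI_ex[OF ex] unfolding fourierL2_def by auto
qed

lemma norm_fourierL2_le:
  assumes f: "sq_int f"
  shows "norm_L2 (fourierL2 f) \<le> norm_L2 f"
proof (rule LIMSEQ_le)
  show "(\<lambda>N::nat. norm_L2 (fourier1 (\<lambda>t. indicator {- real N..real N} t * f t))) \<longlonglongrightarrow> norm_L2 (fourierL2 f)"
    by (intro norm_L2_tendsto fourierL2_spec sq_int_fourier1_truncation f)
  show "(\<lambda>N::nat. norm_L2 (\<lambda>t. indicator {- real N..real N} t * f t)) \<longlonglongrightarrow> norm_L2 f"
    by (intro norm_L2_tendsto truncation_tendsto sq_int_truncation f)
  show "\<exists>N. \<forall>n\<ge>N. norm_L2 (fourier1 (\<lambda>t. indicator {- real n..real n} t * f t))
      \<le> norm_L2 (\<lambda>t. indicator {- real n..real n} t * f t)"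
    by (intro exI allI impI fourier1_L2_contraction integrable_truncation sq_int_truncation f)
qed

text \<open>For truncations of \<open>f\<close> this is Fubini. Both sides are inner products with a
  fixed L^2 function, hence continuous in \<open>f\<close>; \<open>\<phi>\<close> lies in both
  spaces so that its Fourier integral is defined pointwise and is square integrable.\<close>

theorem fourierL2_duality:
  assumes f: "sq_int f" and \<phi>: "integrable lborel \<phi>" "sq_int \<phi>"
  shows "(LINT \<omega>|lborel. fourierL2 f \<omega> * \<phi> \<omega>) = (LINT t|lborel. f t * fourier1 \<phi> t)"
proof -
  let ?T = "\<lambda>(N::nat) t. indicator {- real N..real N} t * f t"
  have "(\<lambda>N. inner_L2 (fourier1 (?T N)) (\<lambda>t. cnj (\<phi> t))) \<longlonglongrightarrow> inner_L2 (fourierL2 f) (\<lambda>t. cnj (\<phi> t))"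
    by (intro inner_L2_tendsto_left fourierL2_spec sq_int_fourier1_truncation f sq_int_cnj \<phi>)
  moreover have "(\<lambda>N. inner_L2 (?T N) (\<lambda>t. cnj (fourier1 \<phi> t))) \<longlonglongrightarrow> inner_L2 f (\<lambda>t. cnj (fourier1 \<phi> t))"
    by (intro inner_L2_tendsto_left truncation_tendsto sq_int_truncation f sq_int_cnj
        fourier1_L2_contraction \<phi>)
  moreover have "inner_L2 (fourier1 (?T N)) (\<lambda>t. cnj (\<phi> t)) = inner_L2 (?T N) (\<lambda>t. cnj (fourier1 \<phi> t))" for N
    unfolding inner_L2_def complex_cnj_cnj by (intro fourier1_duality integrable_truncation f \<phi>)
  ultimately have "inner_L2 (fourierL2 f) (\<lambda>t. cnj (\<phi> t)) = inner_L2 f (\<lambda>t. cnj (fourier1 \<phi> t))"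
    by (simp add: LIMSEQ_unique)
  then show ?thesis by (simp add: inner_L2_def)
qed

lemma sq_int_gauss: "sq_int (gauss 1)"
proof -
  have "(norm (gauss 1 t))\<^sup>2 = Re (gauss (sqrt 2) t)" for t
    by (simp add: gauss_def power_mult_distrib exp_double[symmetric])
  then show ?thesis unfolding sq_int_def using integrable_gauss[of "sqrt 2"] by simp
qed

lemma sq_int_affine:
  assumes f: "sq_int f" and c: "c \<noteq> 0"
  shows "sq_int (\<lambda>t. f (x + c * t))"
proof -
  have [measurable]: "f \<in> borel_measurable borel" using f sq_int_measurable by blast
  show ?thesis
    unfolding sq_int_def using lborel_integrable_real_affine[OF sq_int_integrable[OF f] c, of x] by simp
qed

lemma norm_L2_affine:
  assumes "c \<noteq> 0"
  shows "norm_L2 f = sqrt \<bar>c\<bar> * norm_L2 (\<lambda>t. f (x + c * t))"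
  unfolding norm_L2_def
  by (subst lborel_integral_real_affine[OF assms, where t = x]) (simp add: real_sqrt_mult)

lemma AE_lborel_affine:
  assumes "AE t in lborel. P t" and "(c::real) \<noteq> 0"
  shows "AE t in lborel. P (x + c * t)"
proof -
  have "AE t in distr lborel borel (\<lambda>t. x + c * t). P t"
    using assms(1) by (subst (asm) lborel_real_affine[OF assms(2), of x]) (simp add: AE_density assms(2))
  then show ?thesis by (rule AE_distrD[rotated]) simp
qed

section \<open>Gaussian packets, inversion and Plancherel\<close>

lemma sq_int_packet: "sq_int (\<lambda>t. cis (2 * pi * y * t) * gauss 1 t)"
  by (rule sq_int_bounded_mult[OF sq_int_gauss, where C = 1]) auto

lemma integrable_packet: "integrable lborel (\<lambda>t. cis (2 * pi * y * t) * gauss 1 t)"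
  using integrable_mult_cis[OF integrable_gauss, of 1 "2 * pi * y"] by (simp add: mult.commute)

text \<open>The difference of the pairings is the Fourier integral of
  \<open>(f - h) * gauss 1\<close>, which is integrable as a product of two L^2 functions.
  Injectivity applies, and the Gaussian has no zeros.\<close>

lemma L2_eqI_packets:
  assumes f: "sq_int f" and h: "sq_int h"
    and eq: "\<And>y. (LINT t|lborel. f t * (cis (2 * pi * y * t) * gauss 1 t))
        = (LINT t|lborel. h t * (cis (2 * pi * y * t) * gauss 1 t))"
  shows "AE t in lborel. f t = h t"
proof -
  let ?u = "\<lambda>t. (f t - h t) * gauss 1 t"
  have "fourier1 ?u \<omega> = 0" for \<omega>
  proof -
    have "fourier1 ?u \<omega> = (LINT t|lborel. f t * (cis (2 * pi * (- \<omega>) * t) * gauss 1 t)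
        - h t * (cis (2 * pi * (- \<omega>) * t) * gauss 1 t))"
      unfolding fourier1_cis by (intro Bochner_Integration.integral_cong) (auto simp: algebra_simps)
    also have "\<dots> = 0"
      unfolding Bochner_Integration.integral_diff[OF integrable_mult_sq_int[OF f sq_int_packet]
          integrable_mult_sq_int[OF h sq_int_packet]] eq by simp
    finally show ?thesis .
  qed
  then have "AE t in lborel. ?u t = 0"
    by (intro fourier1_zero_imp_AE_zero integrable_mult_sq_int sq_int_diff sq_int_gauss f h)
  then show ?thesis by eventually_elim (simp add: gauss_def)
qed

text \<open>The means by which all transforms below are computed: under duality the packet of
  frequency \<open>y\<close> becomes the Gaussian centred at \<open>y\<close>, so only pairings with
  explicit functions are compared.\<close>

lemma fourierL2_eqI:
  assumes f: "sq_int f" and h: "sq_int h"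
    and eq: "\<And>y. (LINT t|lborel. h t * (cis (2 * pi * y * t) * gauss 1 t))
        = (LINT t|lborel. f t * gauss 1 (t - y))"
  shows "AE t in lborel. fourierL2 f t = h t"
proof (rule L2_eqI_packets)
  fix y
  show "(LINT t|lborel. fourierL2 f t * (cis (2 * pi * y * t) * gauss 1 t))
        = (LINT t|lborel. h t * (cis (2 * pi * y * t) * gauss 1 t))"
    unfolding eq by (subst fourierL2_duality[OF f integrable_packet sq_int_packet])
      (simp add: fourier1_gauss_packet)
qed (use h fourierL2_spec f in auto)

lemma integrable_gauss_translate: "integrable lborel (\<lambda>t. gauss 1 (t - y))"
  using lborel_integrable_real_affine[OF integrable_gauss[of 1], of 1 "- y"] by simp

lemma sq_int_gauss_translate: "sq_int (\<lambda>t. gauss 1 (t - y))"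
  using sq_int_affine[OF sq_int_gauss, of 1 "- y"] by simp

text \<open>Duality twice: a packet becomes a translated Gaussian, and this becomes the packet of
  opposite frequency, whose sign the reflection absorbs.\<close>

theorem fourierL2_fourierL2:
  assumes f: "sq_int f"
  shows "AE t in lborel. fourierL2 (fourierL2 f) t = f (- t)"
proof (rule fourierL2_eqI)
  show "sq_int (\<lambda>t. f (- t))" using sq_int_affine[OF f, of "- 1" 0] by simp
  fix y
  have "(LINT t|lborel. fourierL2 f t * gauss 1 (t - y)) = (LINT t|lborel. f t * (cis (- (2 * pi * y * t)) * gauss 1 t))"
    by (subst fourierL2_duality[OF f integrable_gauss_translate sq_int_gauss_translate])
      (simp add: fourier1_gauss_translate)
  also have "\<dots> = (LINT t|lborel. f (- t) * (cis (2 * pi * y * t) * gauss 1 t))"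
    by (subst lborel_integral_real_affine[where c = "- 1" and t = 0]) (auto simp: gauss_def)
  finally show "(LINT t|lborel. f (- t) * (cis (2 * pi * y * t) * gauss 1 t)) = (LINT t|lborel. fourierL2 f t * gauss 1 (t - y))" ..
qed (intro fourierL2_spec f)

text \<open>Applying the contraction twice gives a reflection, which preserves the norm, so no norm
  can be lost in the first application.\<close>

theorem norm_fourierL2:
  assumes f: "sq_int f"
  shows "norm_L2 (fourierL2 f) = norm_L2 f"
proof (rule antisym)
  have [measurable]: "f \<in> borel_measurable borel" using f sq_int_measurable by blast
  have s2: "sq_int (fourierL2 (fourierL2 f))" using fourierL2_spec f by blast
  have "norm_L2 f = norm_L2 (\<lambda>t. f (- t))"
    using norm_L2_affine[of "- 1" f 0] by simp
  also have "\<dots> = norm_L2 (fourierL2 (fourierL2 f))"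
    using fourierL2_fourierL2[OF f] sq_int_measurable[OF s2]
    by (intro norm_L2_cong_AE) (auto elim: eventually_mono)
  also have "\<dots> \<le> norm_L2 (fourierL2 f)" by (intro norm_fourierL2_le fourierL2_spec f)
  finally show "norm_L2 f \<le> norm_L2 (fourierL2 f)" .
qed (rule norm_fourierL2_le[OF f])

lemma fourierL2_add_cmult:
  assumes f: "sq_int f" and h: "sq_int h"
  shows "AE t in lborel. fourierL2 (\<lambda>t. f t + c * h t) t = fourierL2 f t + c * fourierL2 h t"
proof (rule fourierL2_eqI)
  have s: "sq_int (fourierL2 f)" "sq_int (fourierL2 h)" using f h fourierL2_spec by auto
  show "sq_int (\<lambda>t. f t + c * h t)" "sq_int (\<lambda>t. fourierL2 f t + c * fourierL2 h t)"
    by (intro sq_int_add sq_int_cmult f h s)+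
  fix y
  let ?p = "\<lambda>t. cis (2 * pi * y * t) * gauss 1 t" and ?q = "\<lambda>t. gauss 1 (t - y)"
  have d: "(LINT t|lborel. fourierL2 u t * ?p t) = (LINT t|lborel. u t * ?q t)" if "sq_int u" for u
    by (subst fourierL2_duality[OF that integrable_packet sq_int_packet]) (simp add: fourier1_gauss_packet)
  have "(LINT t|lborel. (fourierL2 f t + c * fourierL2 h t) * ?p t)
      = (LINT t|lborel. fourierL2 f t * ?p t) + c * (LINT t|lborel. fourierL2 h t * ?p t)"
    unfolding distrib_right mult.assoc[of c]
    unfolding Bochner_Integration.integral_add[OF integrable_mult_sq_int[OF s(1) sq_int_packet]
        integrable_mult_right[OF integrable_mult_sq_int[OF s(2) sq_int_packet]]]
    by simp
  also have "\<dots> = (LINT t|lborel. f t * ?q t) + c * (LINT t|lborel. h t * ?q t)"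
    by (simp only: d f h)
  also have "\<dots> = (LINT t|lborel. (f t + c * h t) * ?q t)"
    unfolding distrib_right mult.assoc[of c]
    unfolding Bochner_Integration.integral_add[OF integrable_mult_sq_int[OF f sq_int_gauss_translate]
        integrable_mult_right[OF integrable_mult_sq_int[OF h sq_int_gauss_translate]]]
    by simp
  finally show "(LINT t|lborel. (fourierL2 f t + c * fourierL2 h t) * ?p t) = (LINT t|lborel. (f t + c * h t) * ?q t)" .
qed

text \<open>Polarisation: norms of \<open>f + c * h\<close> are preserved, and \<open>c = 1\<close>,
  \<open>c = \<i>\<close> give the real and the imaginary part of the inner product.\<close>

theorem inner_fourierL2:
  assumes f: "sq_int f" and h: "sq_int h"
  shows "inner_L2 (fourierL2 f) (fourierL2 h) = inner_L2 f h"
proof -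
  have s: "sq_int (fourierL2 f)" "sq_int (fourierL2 h)" using f h fourierL2_spec by auto
  have re: "Re (cnj c * inner_L2 (fourierL2 f) (fourierL2 h)) = Re (cnj c * inner_L2 f h)" for c
  proof -
    have "norm_L2 (\<lambda>t. fourierL2 f t + c * fourierL2 h t) = norm_L2 (fourierL2 (\<lambda>t. f t + c * h t))"
      using fourierL2_add_cmult[OF f h, of c]
      by (intro norm_L2_cong_AE sq_int_measurable sq_int_add sq_int_cmult s fourierL2_spec f h)
        (auto elim: eventually_mono)
    also have "\<dots> = norm_L2 (\<lambda>t. f t + c * h t)"
      by (intro norm_fourierL2 sq_int_add sq_int_cmult f h)
    finally have "(norm_L2 (\<lambda>t. fourierL2 f t + c * fourierL2 h t))\<^sup>2 = (norm_L2 (\<lambda>t. f t + c * h t))\<^sup>2"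
      by simp
    then show ?thesis
      using f h s by (simp add: power2_norm_L2_add sq_int_cmult norm_L2_cmult norm_fourierL2
          inner_L2_cmult_right)
  qed
  show ?thesis using re[of 1] re[of \<i>] by (simp add: complex_eq_iff)
qed

text \<open>\<open>invfourier1\<close> is \<open>fourier1\<close> at the reflected point, so both
  functions are L^2 limits of the same sequence and agree up to a null set.\<close>

lemma invfourierL2_fourierL2:
  assumes f: "sq_int f"
  shows "sq_int (invfourierL2 f)" "AE t in lborel. invfourierL2 f t = fourierL2 f (- t)"
proof -
  let ?T = "\<lambda>(N::nat) t. indicator {- real N..real N} t * f t"
  let ?P = "\<lambda>h. sq_int h \<and> (\<lambda>N. norm_L2 (\<lambda>t. h t - invfourier1 (?T N) t)) \<longlonglongrightarrow> 0"
  have s: "sq_int (\<lambda>t. fourierL2 f (- t))" using sq_int_affine[OF fourierL2_spec(1)[OF f], of "- 1" 0] by simp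
  have "norm_L2 (\<lambda>t. fourierL2 f (- t) - fourier1 (?T N) (- t)) = norm_L2 (\<lambda>t. fourierL2 f t - fourier1 (?T N) t)" for N
    using norm_L2_affine[of "- 1" "\<lambda>t. fourierL2 f t - fourier1 (?T N) t" 0] by simp
  then have P: "?P (\<lambda>t. fourierL2 f (- t))"
    using s fourierL2_spec(2)[OF f] by (simp add: invfourier1_fourier1)
  then have Q: "?P (invfourierL2 f)"
    unfolding invfourierL2_def by (rule someI[where P = ?P])
  then show "sq_int (invfourierL2 f)" by blast
  have "sq_int (invfourier1 (?T N))" for N
    using sq_int_affine[OF sq_int_fourier1_truncation[OF f], of "- 1" "- real N" "real N" 0]
    unfolding invfourier1_fourier1[abs_def] by simp
  then show "AE t in lborel. invfourierL2 f t = fourierL2 f (- t)"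
    using P Q by (intro norm_L2_limit_unique[where s = "\<lambda>N. invfourier1 (?T N)"]) auto
qed

section \<open>Fourier series on an interval of length two\<close>

text \<open>The character has period 2 but the integral runs over the whole line, so this is a
  Fourier coefficient for functions supported in an interval of length 2. The absent normalisation
  causes the factor 2 in the Parseval identities.\<close>

definition fcoeff :: "(real \<Rightarrow> complex) \<Rightarrow> int \<Rightarrow> complex" where
  "fcoeff u m = (LINT \<omega>|lborel. u \<omega> * cis (pi * of_int m * \<omega>))"

definition fcoeff_null :: "(real \<Rightarrow> complex) \<Rightarrow> bool" where
  "fcoeff_null u \<longleftrightarrow> integrable lborel u \<and> (\<forall>m. fcoeff u m = 0)"

lemma fcoeff_cmult: "fcoeff (\<lambda>\<omega>. c * u \<omega>) m = c * fcoeff u m"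
  unfolding fcoeff_def mult.assoc by simp

lemma fcoeff_add:
  "integrable lborel u \<Longrightarrow> integrable lborel v \<Longrightarrow> fcoeff (\<lambda>\<omega>. u \<omega> + v \<omega>) m = fcoeff u m + fcoeff v m"
  unfolding fcoeff_def by (simp add: distrib_right integrable_mult_cis)

lemma fcoeff_null_add: "fcoeff_null u \<Longrightarrow> fcoeff_null v \<Longrightarrow> fcoeff_null (\<lambda>\<omega>. u \<omega> + v \<omega>)"
  by (simp add: fcoeff_null_def fcoeff_add)

lemma fcoeff_null_cmult: "fcoeff_null u \<Longrightarrow> fcoeff_null (\<lambda>\<omega>. c * u \<omega>)"
  by (simp add: fcoeff_null_def fcoeff_cmult)

lemma fcoeff_null_cis:
  assumes "fcoeff_null u"
  shows "fcoeff_null (\<lambda>\<omega>. u \<omega> * cis (pi * of_int k * \<omega>))"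
proof -
  have "fcoeff (\<lambda>\<omega>. u \<omega> * cis (pi * of_int k * \<omega>)) m = fcoeff u (k + m)" for m
    unfolding fcoeff_def by (intro Bochner_Integration.integral_cong)
      (auto simp: mult.assoc cis_mult algebra_simps)
  then show ?thesis using assms by (simp add: fcoeff_null_def integrable_mult_cis)
qed

text \<open>The functions that preserve \<open>fcoeff_null\<close> under multiplication form an algebra containing
  the characters, hence all polynomials in \<open>cis (\<pi> \<omega>)\<close>.\<close>

lemma fcoeff_null_poly:
  assumes "real_polynomial_function p" "fcoeff_null u"
  shows "fcoeff_null (\<lambda>\<omega>. complex_of_real (p (cis (pi * \<omega>))) * u \<omega>)"
  using assms
proof (induction arbitrary: u rule: real_polynomial_function.induct)
  case (linear f)
  interpret bounded_linear f by fact
  have f: "f z = Re z * f 1 + Im z * f \<i>" for z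
  proof -
    have "z = Re z *\<^sub>R 1 + Im z *\<^sub>R \<i>" by (simp add: complex_eq_iff)
    then have "f z = f (Re z *\<^sub>R 1 + Im z *\<^sub>R \<i>)" by simp
    then show ?thesis by (simp add: add scale)
  qed
  let ?p = "\<lambda>\<omega>. u \<omega> * cis (pi * of_int 1 * \<omega>)" and ?m = "\<lambda>\<omega>. u \<omega> * cis (pi * of_int (-1) * \<omega>)"
  let ?a = "complex_of_real (f 1) / 2 + complex_of_real (f \<i>) / (2 * \<i>)"
  let ?b = "complex_of_real (f 1) / 2 - complex_of_real (f \<i>) / (2 * \<i>)"
  have "complex_of_real (f (cis (pi * \<omega>))) * u \<omega> = ?a * ?p \<omega> + ?b * ?m \<omega>" for \<omega>
  proof -
    have cs: "complex_of_real (cos (pi * \<omega>)) = (cis (pi * \<omega>) + cis (- (pi * \<omega>))) / 2"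
      "complex_of_real (sin (pi * \<omega>)) = (cis (pi * \<omega>) - cis (- (pi * \<omega>))) / (2 * \<i>)"
      by (simp_all add: complex_eq_iff Re_divide Im_divide)
    have "complex_of_real (f (cis (pi * \<omega>))) = ?a * cis (pi * \<omega>) + ?b * cis (- (pi * \<omega>))"
      unfolding f[of "cis (pi * \<omega>)"] of_real_add of_real_mult cis.simps cs
      by (simp add: algebra_simps add_divide_distrib diff_divide_distrib)
    then have "complex_of_real (f (cis (pi * \<omega>))) * u \<omega> = (?a * cis (pi * \<omega>) + ?b * cis (- (pi * \<omega>))) * u \<omega>"
      by (rule arg_cong)
    also have "\<dots> = ?a * ?p \<omega> + ?b * ?m \<omega>"
      by (subst distrib_right) (simp add: mult_ac)
    finally show ?thesis .
  qed
  moreover have "fcoeff_null (\<lambda>\<omega>. ?a * ?p \<omega> + ?b * ?m \<omega>)"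
    by (intro fcoeff_null_add fcoeff_null_cmult fcoeff_null_cis linear.prems)
  ultimately show ?case by presburger
next
  case (const c)
  then show ?case by (rule fcoeff_null_cmult)
next
  case (add f g)
  then show ?case using fcoeff_null_add[OF add.IH(1)[OF add.prems] add.IH(2)[OF add.prems]]
    by (simp add: distrib_right)
next
  case (mult f g)
  then show ?case using mult.IH(1)[OF mult.IH(2)[OF mult.prems]] by (simp add: mult.assoc)
qed

text \<open>By Stone-Weierstrass, \<open>\<psi>\<close> is uniformly close on the circle to a
  polynomial, against which \<open>u\<close> integrates to zero.\<close>

lemma fcoeff_null_continuous:
  assumes u: "fcoeff_null u" and \<psi>: "continuous_on (sphere 0 1) \<psi>"
    and [measurable]: "(\<lambda>\<omega>. \<psi> (cis (pi * \<omega>))) \<in> borel_measurable borel"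
  shows "(LINT \<omega>|lborel. u \<omega> * \<psi> (cis (pi * \<omega>))) = 0"
proof (rule ccontr)
  let ?I = "LINT \<omega>|lborel. u \<omega> * \<psi> (cis (pi * \<omega>))"
  assume "?I \<noteq> 0"
  have ui: "integrable lborel u" using u by (simp add: fcoeff_null_def)
  then have [measurable]: "u \<in> borel_measurable borel" by auto
  define J where "J = (LINT \<omega>|lborel. norm (u \<omega>))"
  have "J \<ge> 0" by (simp add: J_def)
  \<comment> \<open>Chosen so that \<open>J * e < norm ?I\<close>; the summand 1 covers
    \<open>J = 0\<close>.\<close>
  define e where "e = norm ?I / (2 * (J + 1))"
  have "e > 0" using \<open>?I \<noteq> 0\<close> \<open>J \<ge> 0\<close> by (simp add: e_def)
  obtain g where g: "polynomial_function g" and close: "\<And>z. z \<in> sphere 0 1 \<Longrightarrow> norm (\<psi> z - g z) < e"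
    using Stone_Weierstrass_polynomial_function[OF compact_sphere \<psi> \<open>e > 0\<close>] by blast
  have gr: "real_polynomial_function (Re \<circ> g)" "real_polynomial_function (Im \<circ> g)"
    using g bounded_linear_Re bounded_linear_Im unfolding polynomial_function_def by auto
  have "fcoeff_null (\<lambda>\<omega>. complex_of_real ((Re \<circ> g) (cis (pi * \<omega>))) * u \<omega>
      + \<i> * (complex_of_real ((Im \<circ> g) (cis (pi * \<omega>))) * u \<omega>))"
    by (intro fcoeff_null_add fcoeff_null_cmult fcoeff_null_poly gr u)
  also have "(\<lambda>\<omega>. complex_of_real ((Re \<circ> g) (cis (pi * \<omega>))) * u \<omega>
      + \<i> * (complex_of_real ((Im \<circ> g) (cis (pi * \<omega>))) * u \<omega>)) = (\<lambda>\<omega>. u \<omega> * g (cis (pi * \<omega>)))"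
    by (simp add: fun_eq_iff complex_eq_iff)
  finally have g0: "fcoeff_null (\<lambda>\<omega>. u \<omega> * g (cis (pi * \<omega>)))" .
  then have gi: "integrable lborel (\<lambda>\<omega>. u \<omega> * g (cis (pi * \<omega>)))" by (simp add: fcoeff_null_def)
  have "fcoeff (\<lambda>\<omega>. u \<omega> * g (cis (pi * \<omega>))) 0 = 0" using g0 unfolding fcoeff_null_def by blast
  then have gz: "(LINT \<omega>|lborel. u \<omega> * g (cis (pi * \<omega>))) = 0"
    by (simp add: fcoeff_def)
  have "compact (\<psi> ` sphere 0 1)" using \<psi> by (intro compact_continuous_image) auto
  then obtain B where B: "\<And>z. z \<in> sphere 0 1 \<Longrightarrow> norm (\<psi> z) \<le> B"
    by (meson bounded_iff compact_imp_bounded image_eqI)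
  have "integrable lborel (\<lambda>\<omega>. u \<omega> * \<psi> (cis (pi * \<omega>)))"
    by (intro integrable_mult_bounded[where C = B] ui) (auto intro: B)
  then have "?I = (LINT \<omega>|lborel. u \<omega> * \<psi> (cis (pi * \<omega>)) - u \<omega> * g (cis (pi * \<omega>)))"
    using gi gz by simp
  also have "norm \<dots> \<le> (LINT \<omega>|lborel. norm (u \<omega>) * e)"
  proof (rule order_trans[OF integral_norm_bound integral_mono])
    show "integrable lborel (\<lambda>\<omega>. norm (u \<omega> * \<psi> (cis (pi * \<omega>)) - u \<omega> * g (cis (pi * \<omega>))))"
      using gi \<open>integrable lborel (\<lambda>\<omega>. u \<omega> * \<psi> (cis (pi * \<omega>)))\<close> by auto
    fix \<omega> :: real
    have "norm (\<psi> (cis (pi * \<omega>)) - g (cis (pi * \<omega>))) \<le> e"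
      using close[of "cis (pi * \<omega>)"] by simp
    then have "norm (u \<omega>) * norm (\<psi> (cis (pi * \<omega>)) - g (cis (pi * \<omega>))) \<le> norm (u \<omega>) * e"
      by (rule mult_left_mono) simp
    then show "norm (u \<omega> * \<psi> (cis (pi * \<omega>)) - u \<omega> * g (cis (pi * \<omega>))) \<le> norm (u \<omega>) * e"
      by (simp add: right_diff_distrib[symmetric] norm_mult)
  qed (use ui in auto)
  also have "\<dots> = J * e" by (simp add: J_def)
  also have "\<dots> < norm ?I"
  proof -
    have "J / (2 * (J + 1)) < 1" using \<open>J \<ge> 0\<close> by (simp add: field_simps)
    then show ?thesis using \<open>?I \<noteq> 0\<close> mult_strict_right_mono[of "J / (2 * (J + 1))" 1 "norm ?I"]
      by (simp add: e_def)
  qed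
  finally show False by simp
qed

text \<open>\<open>Arg2pi\<close> jumps at \<open>z = 1\<close>. The cut-off vanishes there and so
  restores continuity on the whole circle.\<close>

lemma continuous_on_Arg2pi_cutoff:
  "continuous_on (sphere 0 1) (\<lambda>z. cis (x * Arg2pi z) * complex_of_real (min 1 (k * norm (z - 1))))"
    (is "continuous_on _ ?\<psi>") if "k \<ge> 0"
proof (rule continuous_at_imp_continuous_on, rule ballI)
  fix z :: complex assume z: "z \<in> sphere 0 1"
  show "isCont ?\<psi> z"
  proof (cases "z = 1")
    case True
    have "(?\<psi> \<longlongrightarrow> 0) (at 1)"
    proof (rule Lim_null_comparison)
      have "norm (?\<psi> w) \<le> k * norm (w - 1)" for w
        using that by (simp add: norm_mult del: of_real_mult)
      then show "\<forall>\<^sub>F w in at 1. norm (?\<psi> w) \<le> k * norm (w - 1)" by simp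
      have "((\<lambda>w::complex. k * norm (w - 1)) \<longlongrightarrow> k * norm (1 - 1 :: complex)) (at 1)"
        by (intro tendsto_intros)
      then show "((\<lambda>w. k * norm (w - 1 :: complex)) \<longlongrightarrow> 0) (at 1)" by simp
    qed
    then show ?thesis unfolding True isCont_def by simp
  next
    case False
    have "z \<notin> \<real>\<^sub>\<ge>\<^sub>0"
    proof
      assume "z \<in> \<real>\<^sub>\<ge>\<^sub>0"
      then obtain r where "z = complex_of_real r" "r \<ge> 0" by (auto elim: nonneg_Reals_cases)
      then show False using z False by simp
    qed
    then have "isCont Arg2pi z" by (rule continuous_at_Arg2pi)
    moreover have "isCont cis (x * Arg2pi z)"
      using continuous_on_cis[OF continuous_on_id[of UNIV]] by (simp add: continuous_on_eq_continuous_at)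
    ultimately show ?thesis
      by (intro continuous_intros isCont_o2[of _ "\<lambda>z. x * Arg2pi z" cis]) auto
  qed
qed

lemma Arg2pi_cis: "0 \<le> \<omega> \<Longrightarrow> \<omega> < 2 \<Longrightarrow> Arg2pi (cis (pi * \<omega>)) = pi * \<omega>"
  using Arg2pi_exp[of "\<i> * complex_of_real (pi * \<omega>)"] by (simp add: cis_conv_exp)

text \<open>Completeness of the characters is reduced to injectivity of the Fourier integral: on
  \<open>{0..<2}\<close> every frequency, even one without period 2, is a function of
  \<open>cis (pi * \<omega>)\<close>. The cut-off makes it continuous on the circle and is removed
  by dominated convergence.\<close>

theorem fcoeff_null_imp_AE_zero:
  assumes u: "fcoeff_null u" and supp: "\<And>\<omega>. \<omega> \<notin> {0..<2} \<Longrightarrow> u \<omega> = 0"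
  shows "AE \<omega> in lborel. u \<omega> = 0"
proof (rule fourier1_zero_imp_AE_zero)
  show ui: "integrable lborel u" using u by (simp add: fcoeff_null_def)
  then have [measurable]: "u \<in> borel_measurable borel" by auto
  fix y
  \<comment> \<open>On \<open>{0..<2}\<close>, \<open>Arg2pi (cis (pi * \<omega>))\<close> equals
    \<open>pi * \<omega>\<close>, so the factor \<open>- 2 * y\<close> reproduces
    \<open>cis (- (2 * pi * \<omega> * y))\<close>.\<close>
  let ?\<psi> = "\<lambda>k z. cis (- 2 * y * Arg2pi z) * complex_of_real (min 1 (real k * norm (z - 1)))"
  let ?v = "\<lambda>k \<omega>. u \<omega> * (cis (- (2 * pi * \<omega> * y)) * complex_of_real (min 1 (real k * norm (cis (pi * \<omega>) - 1))))"
  have v: "u \<omega> * ?\<psi> k (cis (pi * \<omega>)) = ?v k \<omega>" for k \<omega>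
    using supp[of \<omega>] Arg2pi_cis[of \<omega>] by (cases "\<omega> \<in> {0..<2}") (auto simp: mult_ac)
  have "(LINT \<omega>|lborel. ?v k \<omega>) = 0" for k
  proof -
    have "(LINT \<omega>|lborel. u \<omega> * ?\<psi> k (cis (pi * \<omega>))) = 0"
    proof (rule fcoeff_null_continuous[OF u continuous_on_Arg2pi_cutoff])
      have "continuous_on UNIV (\<lambda>\<omega>. ?\<psi> k (cis (pi * \<omega>)))"
        by (rule continuous_on_compose2[OF continuous_on_Arg2pi_cutoff])
          (auto intro!: continuous_intros)
      then show "(\<lambda>\<omega>. ?\<psi> k (cis (pi * \<omega>))) \<in> borel_measurable borel"
        by (rule borel_measurable_continuous_onI)
    qed simp
    then show ?thesis unfolding v .
  qed
  moreover have "(\<lambda>k. LINT \<omega>|lborel. ?v k \<omega>) \<longlonglongrightarrow> (LINT \<omega>|lborel. u \<omega> * cis (- (2 * pi * \<omega> * y)))"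
  proof (rule integral_dominated_convergence[where w = "\<lambda>\<omega>. norm (u \<omega>)"])
    \<comment> \<open>Within \<open>{0..<2}\<close> the point 0 is the only one where the cut-off is
      0 for every \<open>k\<close>.\<close>
    have "AE \<omega> in lborel. \<omega> \<noteq> (0::real)" by (rule AE_lborel_singleton)
    then show "AE \<omega> in lborel. (\<lambda>k. ?v k \<omega>) \<longlonglongrightarrow> u \<omega> * cis (- (2 * pi * \<omega> * y))"
    proof eventually_elim
      case (elim \<omega>)
      show ?case
      proof (cases "\<omega> \<in> {0..<2}")
        case True
        have "cis (pi * \<omega>) \<noteq> 1"
          using Arg2pi_cis[of \<omega>] True elim Arg2pi_of_real[of 1] by auto
        then have pos: "norm (cis (pi * \<omega>) - 1) > 0" by simp
        obtain K where K: "1 / norm (cis (pi * \<omega>) - 1) \<le> real K" using real_arch_simple by blast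
        have "?v k \<omega> = u \<omega> * cis (- (2 * pi * \<omega> * y))" if "k \<ge> K" for k
        proof -
          have "1 / norm (cis (pi * \<omega>) - 1) \<le> real k" using K that by linarith
          then have "1 \<le> real k * norm (cis (pi * \<omega>) - 1)" using pos by (simp add: field_simps)
          then have "min 1 (real k * norm (cis (pi * \<omega>) - 1)) = 1" by simp
          then show ?thesis by (simp only: of_real_1 mult_1_right)
        qed
        then have "\<forall>\<^sub>F k in sequentially. ?v k \<omega> = u \<omega> * cis (- (2 * pi * \<omega> * y))"
          unfolding eventually_sequentially by blast
        then show ?thesis by (rule tendsto_eventually)
      qed (simp add: supp)
    qed
    show "AE \<omega> in lborel. norm (?v k \<omega>) \<le> norm (u \<omega>)" for k
      by (auto simp: norm_mult mult_left_le simp del: of_real_mult)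
  qed (use ui in auto)
  ultimately show "fourier1 u y = 0"
    unfolding fourier1_cis by (simp add: LIMSEQ_const_iff)
qed

section \<open>Orthonormal expansions and Parseval on [0, 2)\<close>

lemma power2_norm_L2_orthonormal_sum:
  assumes "finite I" "\<And>i. sq_int (e i)" "\<And>i j. inner_L2 (e i) (e j) = (if i = j then 1 else 0)"
  shows "(norm_L2 (\<lambda>t. \<Sum>i\<in>I. c i * e i t))\<^sup>2 = (\<Sum>i\<in>I. (norm (c i))\<^sup>2)"
  using assms(1)
proof induction
  case empty
  show ?case by (simp add: power2_norm_L2)
next
  case (insert x I)
  have s: "sq_int (\<lambda>t. c i * e i t)" for i by (intro sq_int_cmult assms)
  have "(norm_L2 (e x))\<^sup>2 = 1"
    using inner_L2_self[of "e x"] assms(3)[of x x] by (metis of_real_eq_1_iff)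
  moreover have "inner_L2 (\<lambda>t. c x * e x t) (\<lambda>t. \<Sum>i\<in>I. c i * e i t) = 0"
  proof -
    have "inner_L2 (\<lambda>t. \<Sum>i\<in>I. c i * e i t) (\<lambda>t. c x * e x t) = (\<Sum>i\<in>I. c i * (cnj (c x) * inner_L2 (e i) (e x)))"
      by (subst inner_L2_sum_left) (auto simp: s inner_L2_cmult_left inner_L2_cmult_right)
    also have "\<dots> = 0" using insert by (intro sum.neutral) (auto simp: assms(3))
    finally show ?thesis using inner_L2_commute[of "\<lambda>t. c x * e x t" "\<lambda>t. \<Sum>i\<in>I. c i * e i t"] by simp
  qed
  ultimately show ?case
    using insert power2_norm_L2_add[OF s[of x] sq_int_sum[of I, OF s]]
    by (simp add: norm_L2_cmult power_mult_distrib)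
qed

lemma inner_L2_orthonormal_sum:
  assumes "finite I" "\<And>i. sq_int (e i)" "\<And>i j. inner_L2 (e i) (e j) = (if i = j then 1 else 0)"
  shows "inner_L2 (\<lambda>t. \<Sum>i\<in>I. c i * e i t) (e j) = (if j \<in> I then c j else 0)"
proof -
  have "inner_L2 (\<lambda>t. \<Sum>i\<in>I. c i * e i t) (e j) = (\<Sum>i\<in>I. c i * inner_L2 (e i) (e j))"
    by (subst inner_L2_sum_left) (auto simp: sq_int_cmult assms(2) inner_L2_cmult_left)
  also have "\<dots> = (\<Sum>i\<in>I. if i = j then c i else 0)" by (intro sum.cong) (auto simp: assms(3))
  finally show ?thesis using assms(1) by simp
qed

text \<open>\<open>s\<close> is the projection of \<open>u\<close> onto the closed span of the
  system. The sum is expressed through \<open>s\<close> because completeness is supplied only in the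
  application.\<close>

theorem L2_orthonormal_expansion:
  fixes e :: "nat \<Rightarrow> real \<Rightarrow> complex"
  assumes e: "\<And>i. sq_int (e i)" "\<And>i j. inner_L2 (e i) (e j) = (if i = j then 1 else 0)"
    and u: "sq_int u"
  obtains s where "sq_int s" "\<And>i. inner_L2 s (e i) = inner_L2 u (e i)"
    "(\<lambda>i. (norm (inner_L2 u (e i)))\<^sup>2) sums Re (inner_L2 s u)"
proof -
  define c where "c i = inner_L2 u (e i)" for i
  define S where "S N t = (\<Sum>i<N. c i * e i t)" for N t
  have S: "sq_int (S N)" for N unfolding S_def by (intro sq_int_sum sq_int_cmult e)
  have Su: "inner_L2 (S N) u = complex_of_real (\<Sum>i<N. (norm (c i))\<^sup>2)" for N
  proof -
    have "inner_L2 (S N) u = (\<Sum>i<N. c i * inner_L2 (e i) u)"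
      unfolding S_def using e u by (subst inner_L2_sum_left) (auto simp: sq_int_cmult inner_L2_cmult_left)
    also have "\<dots> = (\<Sum>i<N. complex_of_real ((norm (c i))\<^sup>2))"
      by (intro sum.cong refl) (simp only: inner_L2_commute[of "e _" u] c_def[symmetric] complex_norm_square)
    finally show ?thesis by simp
  qed
  have bessel: "(\<Sum>i<N. (norm (c i))\<^sup>2) \<le> (norm_L2 u)\<^sup>2" for N
  proof -
    have "0 \<le> (norm_L2 (\<lambda>t. S N t - u t))\<^sup>2" by simp
    also have "\<dots> = (norm_L2 u)\<^sup>2 - (\<Sum>i<N. (norm (c i))\<^sup>2)"
      using power2_norm_L2_orthonormal_sum[OF _ e, of "{..<N}" c]
      unfolding power2_norm_L2_diff[OF S u] Su by (simp add: S_def[abs_def] del: of_real_sum)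
    finally show ?thesis by simp
  qed
  have "(\<Sum>i\<le>N. (norm (c i))\<^sup>2) \<le> (norm_L2 u)\<^sup>2" for N
    using bessel[of "Suc N"] unfolding lessThan_Suc_atMost .
  then have sm: "summable (\<lambda>i. (norm (c i))\<^sup>2)"
    by (intro bounded_imp_summable[where B = "(norm_L2 u)\<^sup>2"]) auto
  have diff: "(norm_L2 (\<lambda>t. S m t - S n t))\<^sup>2 = (\<Sum>i=n..<m. (norm (c i))\<^sup>2)" if "n \<le> m" for m n
  proof -
    have "S m t - S n t = (\<Sum>i=n..<m. c i * e i t)" for t
      using that unfolding S_def lessThan_atLeast0 by (subst sum_diff_nat_ivl) auto
    then show ?thesis using power2_norm_L2_orthonormal_sum[OF _ e, of "{n..<m}" c] by simp
  qed
  have "\<exists>N::nat. \<forall>m\<ge>N. \<forall>n\<ge>N. norm_L2 (\<lambda>t. S m t - S n t) < \<epsilon>" if "\<epsilon> > 0" for \<epsilon>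
  proof -
    have "\<epsilon>\<^sup>2 > 0" using that by simp
    then obtain N where N: "\<And>m n. m \<ge> N \<Longrightarrow> norm (\<Sum>i=m..<n. (norm (c i))\<^sup>2) < \<epsilon>\<^sup>2"
      using sm unfolding summable_Cauchy by blast
    have *: "norm_L2 (\<lambda>t. S m t - S n t) < \<epsilon>" if "N \<le> n" "n \<le> m" for m n
    proof -
      have "(norm_L2 (\<lambda>t. S m t - S n t))\<^sup>2 < \<epsilon>\<^sup>2" using N[of n m] that by (simp add: diff)
      then show ?thesis using \<open>\<epsilon> > 0\<close> by (meson less_le_not_le not_le power_mono norm_L2_nonneg)
    qed
    have "norm_L2 (\<lambda>t. S m t - S n t) < \<epsilon>" if "N \<le> n" "N \<le> m" for m n
      using *[of n m] *[of m n] that norm_L2_minus_commute[of "S m" "S n"] by (cases "n \<le> m") auto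
    then show ?thesis by blast
  qed
  then obtain s where s: "sq_int s" and lim: "(\<lambda>n. norm_L2 (\<lambda>t. s t - S n t)) \<longlonglongrightarrow> 0"
    using L2_complete[of S] S by blast
  have "inner_L2 s (e i) = inner_L2 u (e i)" for i
  proof (rule LIMSEQ_unique)
    show "(\<lambda>n. inner_L2 (S n) (e i)) \<longlonglongrightarrow> inner_L2 s (e i)"
      by (intro inner_L2_tendsto_left S s e lim)
    have "inner_L2 (S n) (e i) = inner_L2 u (e i)" if "n \<ge> Suc i" for n
      unfolding S_def using inner_L2_orthonormal_sum[OF _ e, of "{..<n}" c i] that by (simp add: c_def)
    then show "(\<lambda>n. inner_L2 (S n) (e i)) \<longlonglongrightarrow> inner_L2 u (e i)"
      by (intro tendsto_eventually) (auto simp: eventually_sequentially)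
  qed
  moreover have "(\<lambda>i. (norm (inner_L2 u (e i)))\<^sup>2) sums Re (inner_L2 s u)"
  proof -
    have "(\<lambda>n. Re (inner_L2 (S n) u)) \<longlonglongrightarrow> Re (inner_L2 s u)"
      by (intro tendsto_Re inner_L2_tendsto_left S s u lim)
    then show ?thesis unfolding sums_def Su c_def by simp
  qed
  ultimately show ?thesis using that s by blast
qed

lemma integral_cis_period:
  "(LINT \<omega>|lborel. indicator {0..2} \<omega> *\<^sub>R cis (pi * of_int k * \<omega>)) = (if k = 0 then 2 else 0)"
proof (cases "k = 0")
  case True
  have "(LINT \<omega>|lborel. indicator {0..2::real} \<omega> *\<^sub>R (1::complex)) = 2"
    by (subst integral_scaleR_left) (auto simp: scaleR_conv_of_real)
  then show ?thesis using True by simp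
next
  case False
  let ?c = "complex_of_real (pi * of_int k)"
  have c: "?c \<noteq> 0" using False by simp
  have "(LINT \<omega>|lborel. indicator {0..2} \<omega> *\<^sub>R cis (pi * of_int k * \<omega>))
     = cis (pi * of_int k * 2) / (\<i> * ?c) - cis (pi * of_int k * 0) / (\<i> * ?c)"
  proof (rule integral_FTC_Icc)
    fix \<omega> :: real
    have "((\<lambda>\<omega>. exp (\<i> * ?c * complex_of_real \<omega>) / (\<i> * ?c)) has_vector_derivative
       exp (\<i> * ?c * complex_of_real \<omega>)) (at \<omega> within {0..2})"
      using c by (auto intro!: derivative_eq_intros has_vector_derivative_real_field)
    then show "((\<lambda>\<omega>. cis (pi * of_int k * \<omega>) / (\<i> * ?c)) has_vector_derivative cis (pi * of_int k * \<omega>)) (at \<omega> within {0..2})"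
      by (simp add: cis_conv_exp mult.assoc)
  qed (auto intro!: continuous_intros)
  also have "cis (pi * of_int k * 2) = 1"
    using cis_multiple_2pi[of "of_int k"] by (simp add: mult_ac)
  finally show ?thesis using False by simp
qed

text \<open>Conjugate to the character in \<open>fcoeff\<close>, so that for \<open>u\<close>
  supported in \<open>{0..<2}\<close> the inner product with \<open>fbasis m\<close> is
  \<open>fcoeff u m\<close> divided by \<open>sqrt 2\<close>.\<close>

definition fbasis :: "int \<Rightarrow> real \<Rightarrow> complex" where
  "fbasis m \<omega> = indicator {0..<2} \<omega> * cis (- (pi * of_int m * \<omega>)) / complex_of_real (sqrt 2)"

lemma sq_int_fbasis: "sq_int (fbasis m)"
proof -
  have "sq_int (\<lambda>\<omega>. (indicator {0..<2} \<omega> * cis (- (pi * of_int m * \<omega>)) / complex_of_real (sqrt 2)) * indicator {0..2::real} \<omega>)"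
    by (intro sq_int_bounded_mult[OF sq_int_indicator_Icc, where C = 1])
      (auto simp: norm_mult norm_divide indicator_def)
  also have "(\<lambda>\<omega>. (indicator {0..<2} \<omega> * cis (- (pi * of_int m * \<omega>)) / complex_of_real (sqrt 2)) * indicator {0..2::real} \<omega>)
     = fbasis m"
    by (auto simp: fbasis_def indicator_def fun_eq_iff)
  finally show ?thesis .
qed

lemma inner_fbasis: "inner_L2 (fbasis i) (fbasis j) = (if i = j then 1 else 0)"
proof -
  have "inner_L2 (fbasis i) (fbasis j) = (LINT \<omega>|lborel. (indicator {0..2} \<omega> *\<^sub>R cis (pi * of_int (j - i) * \<omega>)) / 2)"
    unfolding inner_L2_def
  proof (rule integral_cong_AE)
    have "AE \<omega> in lborel. \<omega> \<noteq> (2::real)" by (rule AE_lborel_singleton)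
    then show "AE \<omega> in lborel. fbasis i \<omega> * cnj (fbasis j \<omega>) = (indicator {0..2} \<omega> *\<^sub>R cis (pi * of_int (j - i) * \<omega>)) / 2"
      by eventually_elim (auto simp: fbasis_def indicator_def cis_cnj cis_mult algebra_simps
          simp flip: of_real_mult)
  qed (use sq_int_measurable[OF sq_int_fbasis] in measurable)
  also have "\<dots> = (LINT \<omega>|lborel. indicator {0..2} \<omega> *\<^sub>R cis (pi * of_int (j - i) * \<omega>)) / 2"
    by simp
  finally show ?thesis unfolding integral_cis_period by auto
qed

lemma inner_fbasis_fcoeff:
  assumes "\<And>\<omega>. \<omega> \<notin> {0..<2} \<Longrightarrow> u \<omega> = 0"
  shows "inner_L2 u (fbasis m) = fcoeff u m / complex_of_real (sqrt 2)"
proof -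
  have "u \<omega> * cnj (fbasis m \<omega>) = u \<omega> * cis (pi * of_int m * \<omega>) / complex_of_real (sqrt 2)" for \<omega>
    using assms[of \<omega>] by (cases "\<omega> \<in> {0..<2}") (auto simp: fbasis_def cis_cnj)
  then show ?thesis unfolding inner_L2_def fcoeff_def by simp
qed

theorem fcoeff_parseval_square:
  assumes u: "sq_int u" and supp: "\<And>\<omega>. \<omega> \<notin> {0..<2} \<Longrightarrow> u \<omega> = 0"
  shows "((\<lambda>m. (norm (fcoeff u m))\<^sup>2) has_sum (2 * (norm_L2 u)\<^sup>2)) UNIV"
proof -
  let ?e = "\<lambda>n. fbasis (int_decode n)"
  obtain s where s: "sq_int s" and s_e: "\<And>i. inner_L2 s (?e i) = inner_L2 u (?e i)"
    and sums: "(\<lambda>i. (norm (inner_L2 u (?e i)))\<^sup>2) sums Re (inner_L2 s u)"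
    using L2_orthonormal_expansion[of ?e u] sq_int_fbasis inner_fbasis u by (auto simp: int_decode_eq)
  \<comment> \<open>\<open>s\<close> is known through its coefficients alone, so it is compared with
    \<open>u\<close> on \<open>{0..<2}\<close>; elsewhere \<open>u = 0\<close>, and \<open>s\<close>
    does not contribute to \<open>inner_L2 s u\<close>.\<close>
  let ?w = "\<lambda>\<omega>. indicator {0..<2} \<omega> * (u \<omega> - s \<omega>)"
  have w: "sq_int ?w" using u s by (intro sq_int_indicator_mult sq_int_diff) auto
  have "integrable lborel (\<lambda>\<omega>. indicator {0..2} \<omega> * ?w \<omega>)" by (rule integrable_truncation[OF w])
  then have wi: "integrable lborel ?w"
    by (rule back_subst[of "integrable lborel"]) (auto simp: indicator_def fun_eq_iff)
  have "fcoeff ?w m = 0" for m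
  proof -
    have "fcoeff ?w m / complex_of_real (sqrt 2) = inner_L2 ?w (fbasis m)"
      by (rule inner_fbasis_fcoeff[symmetric]) simp
    also have "\<dots> = inner_L2 (\<lambda>\<omega>. u \<omega> - s \<omega>) (fbasis m)"
      unfolding inner_L2_def by (intro Bochner_Integration.integral_cong) (auto simp: fbasis_def indicator_def)
    also have "\<dots> = inner_L2 u (?e (int_encode m)) - inner_L2 s (?e (int_encode m))"
      using u s by (simp add: inner_L2_diff_left sq_int_fbasis)
    finally show ?thesis using s_e[of "int_encode m"] by simp
  qed
  then have "AE \<omega> in lborel. ?w \<omega> = 0"
    using wi by (intro fcoeff_null_imp_AE_zero) (auto simp: fcoeff_null_def)
  then have "AE \<omega> in lborel. s \<omega> * cnj (u \<omega>) = u \<omega> * cnj (u \<omega>)"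
    by eventually_elim (use supp in \<open>auto simp: indicator_def split: if_splits\<close>)
  then have "inner_L2 s u = inner_L2 u u"
    unfolding inner_L2_def using s u
    by (intro integral_cong_AE borel_measurable_integrable integrable_mult_cnj_sq_int)
  then have "(\<lambda>i. 2 * (norm (inner_L2 u (?e i)))\<^sup>2) sums (2 * (norm_L2 u)\<^sup>2)"
    using sums_mult[OF sums, of 2] by (simp add: inner_L2_self)
  moreover have "2 * (norm (inner_L2 u (?e i)))\<^sup>2 = (norm (fcoeff u (int_decode i)))\<^sup>2" for i
    using inner_fbasis_fcoeff[OF supp] by (simp add: norm_divide power_divide)
  ultimately have "((\<lambda>i. (norm (fcoeff u (int_decode i)))\<^sup>2) has_sum (2 * (norm_L2 u)\<^sup>2)) UNIV"
    by (intro sums_nonneg_imp_has_sum) auto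
  then show ?thesis
    by (subst (asm) has_sum_reindex_bij_betw[OF bij_int_decode, where f = "\<lambda>m. (norm (fcoeff u m))\<^sup>2"])
qed

lemma polarization_complex:
  "z * cnj w = (complex_of_real ((norm (z + w))\<^sup>2) - complex_of_real ((norm (z - w))\<^sup>2)
     + \<i> * complex_of_real ((norm (z + \<i> * w))\<^sup>2) - \<i> * complex_of_real ((norm (z - \<i> * w))\<^sup>2)) / 4"
  unfolding complex_norm_square by (simp add: algebra_simps)

lemma polarization_L2:
  assumes u: "sq_int u" and v: "sq_int v"
  shows "inner_L2 u v = (complex_of_real ((norm_L2 (\<lambda>t. u t + v t))\<^sup>2) - complex_of_real ((norm_L2 (\<lambda>t. u t - v t))\<^sup>2)
     + \<i> * complex_of_real ((norm_L2 (\<lambda>t. u t + \<i> * v t))\<^sup>2) - \<i> * complex_of_real ((norm_L2 (\<lambda>t. u t - \<i> * v t))\<^sup>2)) / 4"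
proof -
  have iv: "sq_int (\<lambda>t. \<i> * v t)" by (intro sq_int_cmult v)
  show ?thesis
    unfolding power2_norm_L2_add[OF u v] power2_norm_L2_diff[OF u v] power2_norm_L2_add[OF u iv]
      power2_norm_L2_diff[OF u iv] inner_L2_cmult_right
    by (simp add: complex_eq_iff)
qed

text \<open>Polarisation in the coefficients and in L^2 at once, from the square identity for
  \<open>u + c * v\<close> with \<open>c\<close> running through the fourth roots of unity.\<close>

theorem fcoeff_parseval:
  assumes u: "sq_int u" and v: "sq_int v"
    and supp: "\<And>\<omega>. \<omega> \<notin> {0..<2} \<Longrightarrow> u \<omega> = 0" "\<And>\<omega>. \<omega> \<notin> {0..<2} \<Longrightarrow> v \<omega> = 0"
  shows "((\<lambda>m. fcoeff u m * cnj (fcoeff v m)) has_sum (2 * inner_L2 u v)) UNIV"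
proof -
  have i: "integrable lborel w" if "sq_int w" "\<And>\<omega>. \<omega> \<notin> {0..<2} \<Longrightarrow> w \<omega> = 0" for w :: "real \<Rightarrow> complex"
    by (rule back_subst[of "integrable lborel", OF integrable_truncation[OF that(1), of 0 2]])
      (use that(2) in \<open>fastforce intro!: ext simp: indicator_def\<close>)
  have p: "((\<lambda>m. complex_of_real ((norm (fcoeff u m + c * fcoeff v m))\<^sup>2)) has_sum
      complex_of_real (2 * (norm_L2 (\<lambda>t. u t + c * v t))\<^sup>2)) UNIV" for c
  proof -
    have "fcoeff (\<lambda>t. u t + c * v t) m = fcoeff u m + c * fcoeff v m" for m
      using i[OF u supp(1)] i[OF v supp(2)] by (simp add: fcoeff_add fcoeff_cmult)
    then have "((\<lambda>m. (norm (fcoeff u m + c * fcoeff v m))\<^sup>2) has_sum (2 * (norm_L2 (\<lambda>t. u t + c * v t))\<^sup>2)) UNIV"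
      using fcoeff_parseval_square[of "\<lambda>t. u t + c * v t"] u v supp by (simp add: sq_int_add sq_int_cmult)
    then show ?thesis by (rule has_sum_of_real)
  qed
  have "((\<lambda>m. (1/4) * (complex_of_real ((norm (fcoeff u m + 1 * fcoeff v m))\<^sup>2)
      + (- 1) * complex_of_real ((norm (fcoeff u m + (- 1) * fcoeff v m))\<^sup>2)
      + \<i> * complex_of_real ((norm (fcoeff u m + \<i> * fcoeff v m))\<^sup>2)
      + (- \<i>) * complex_of_real ((norm (fcoeff u m + (- \<i>) * fcoeff v m))\<^sup>2)))
    has_sum (1/4) * (complex_of_real (2 * (norm_L2 (\<lambda>t. u t + 1 * v t))\<^sup>2)
      + (- 1) * complex_of_real (2 * (norm_L2 (\<lambda>t. u t + (- 1) * v t))\<^sup>2)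
      + \<i> * complex_of_real (2 * (norm_L2 (\<lambda>t. u t + \<i> * v t))\<^sup>2)
      + (- \<i>) * complex_of_real (2 * (norm_L2 (\<lambda>t. u t + (- \<i>) * v t))\<^sup>2))) UNIV"
    by (intro has_sum_add has_sum_cmult_right p)
  then show ?thesis
    unfolding polarization_complex[of "fcoeff u _"] polarization_L2[OF u v]
    by (simp add: algebra_simps add_divide_distrib diff_divide_distrib)
qed

text \<open>Moves a cell to the origin at the price of a phase; for \<open>x = 1\<close> the phase
  is the sign (-1)^m.\<close>

lemma fcoeff_translate:
  "fcoeff u m = cis (pi * of_int m * x) * fcoeff (\<lambda>\<omega>. u (\<omega> + x)) m"
proof -
  have "fcoeff u m = (LINT \<omega>|lborel. u (x + \<omega>) * cis (pi * of_int m * (x + \<omega>)))"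
    unfolding fcoeff_def by (subst lborel_integral_real_affine[where c = 1 and t = x]) auto
  also have "\<dots> = (LINT \<omega>|lborel. cis (pi * of_int m * x) * (u (\<omega> + x) * cis (pi * of_int m * \<omega>)))"
    by (intro Bochner_Integration.integral_cong)
      (auto simp: distrib_left add.commute mult_ac simp flip: cis_mult)
  finally show ?thesis unfolding fcoeff_def by simp
qed

lemma cis_pi_int: "cis (pi * of_int k) = (if even k then 1 else - 1)"
proof (cases "even k")
  case True
  then obtain j where "k = 2 * j" by blast
  then show ?thesis using cis_multiple_2pi[of "of_int j"] by (simp add: mult_ac)
next
  case False
  then obtain j where "k = 2 * j + 1" by (blast elim: oddE)
  then show ?thesis using cis_multiple_2pi[of "of_int j"] cis_mult[of pi "2 * pi * of_int j"]
    by (simp add: algebra_simps)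
qed

text \<open>For the unit vector \<open>e i\<close>, the term with \<open>k = i\<close> already
  exhausts the sum of squares, so all other terms vanish.\<close>

lemma parseval_frame_imp_orthonormal:
  fixes e :: "'i \<Rightarrow> real \<Rightarrow> complex"
  assumes e: "\<And>i. sq_int (e i)"
    and parseval: "\<And>f. sq_int f \<Longrightarrow> ((\<lambda>i. (norm (inner_L2 f (e i)))\<^sup>2) has_sum (norm_L2 f)\<^sup>2) UNIV"
    and unit: "\<And>i. norm_L2 (e i) = 1"
  shows "onb_L2 e"
  unfolding onb_L2_def
proof (intro conjI allI impI)
  show "sq_int (e i)" for i by (rule e)
  show "inner_L2 (e i) (e j) = (if i = j then 1 else 0)" for i j
  proof (cases "i = j")
    case True
    then show ?thesis using inner_L2_self[of "e i"] unit[of i] by simp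
  next
    case False
    have "(\<Sum>k\<in>{i, j}. (norm (inner_L2 (e i) (e k)))\<^sup>2) \<le> (norm_L2 (e i))\<^sup>2"
      by (rule finite_sum_le_has_sum[OF parseval[OF e]]) auto
    then have "(norm (inner_L2 (e i) (e j)))\<^sup>2 \<le> 0"
      using False unit[of i] inner_L2_self[of "e i"] by simp
    then show ?thesis using False by simp
  qed
  fix f assume f: "sq_int f" and z: "\<forall>i. inner_L2 f (e i) = 0"
  have "((\<lambda>i. 0 :: real) has_sum (norm_L2 f)\<^sup>2) (UNIV :: 'i set)"
    using parseval[OF f] z by simp
  then have "(norm_L2 f)\<^sup>2 = 0" by (rule has_sum_unique) simp
  then show "AE t in lborel. f t = 0" using norm_L2_eq_0_iff[OF f] by simp
qed

text \<open>The sum of squares for \<open>e i\<close> contains the fourth power of its norm, and the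
  total is the second power.\<close>

lemma norm_L2_le_1_of_parseval:
  fixes e :: "'i \<Rightarrow> real \<Rightarrow> complex"
  assumes e: "\<And>i. sq_int (e i)"
    and parseval: "\<And>f. sq_int f \<Longrightarrow> ((\<lambda>i. (norm (inner_L2 f (e i)))\<^sup>2) has_sum (norm_L2 f)\<^sup>2) UNIV"
  shows "(norm_L2 (e i))\<^sup>2 \<le> 1"
proof -
  have "(\<Sum>k\<in>{i}. (norm (inner_L2 (e i) (e k)))\<^sup>2) \<le> (norm_L2 (e i))\<^sup>2"
    by (rule finite_sum_le_has_sum[OF parseval[OF e]]) auto
  then have "(norm_L2 (e i))\<^sup>2 * (norm_L2 (e i))\<^sup>2 \<le> 1 * (norm_L2 (e i))\<^sup>2"
    unfolding sum.insert_remove[OF finite.emptyI] inner_L2_self norm_of_real by (simp add: power2_eq_square)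
  then show ?thesis
    by (cases "norm_L2 (e i) = 0") (simp_all only: mult_le_cancel_right, auto)
qed

section \<open>Wilson systems on the frequency side\<close>

text \<open>\<open>r\<close> stands for the real transform of U g, and \<open>atom m n\<close> for
  the image of a Gabor function up to a unimodular constant; \<open>a\<close>, \<open>b\<close> and
  \<open>d\<close> no longer occur.\<close>

locale real_gabor_frame =
  fixes r :: "real \<Rightarrow> real" and atom :: "int \<Rightarrow> int \<Rightarrow> real \<Rightarrow> complex"
  defines "atom m n \<omega> \<equiv> complex_of_real (r (\<omega> - of_int n)) * cis (- (pi * of_int m * \<omega>))"
  assumes r: "sq_int (\<lambda>\<omega>. complex_of_real (r \<omega>))"
    and tight: "\<And>F. sq_int F \<Longrightarrow>
      ((\<lambda>(m, n). (norm (inner_L2 F (atom m n)))\<^sup>2) has_sum (2 * (norm_L2 F)\<^sup>2)) UNIV"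
begin

lemma r_measurable [measurable]: "r \<in> borel_measurable borel"
proof -
  have "(\<lambda>\<omega>. Re (complex_of_real (r \<omega>))) \<in> borel_measurable borel"
    using sq_int_measurable[OF r] by measurable
  then show ?thesis by simp
qed

lemma sq_int_translate: "sq_int (\<lambda>\<omega>. complex_of_real (r (\<omega> + x)))"
  using sq_int_affine[OF r, of 1 x] by (simp add: add.commute)

lemma sq_int_atom: "sq_int (atom m n)"
proof -
  have "sq_int (\<lambda>\<omega>. cis (- (pi * of_int m * \<omega>)) * complex_of_real (r (\<omega> + - of_int n)))"
    by (rule sq_int_bounded_mult[OF sq_int_translate, where C = 1]) auto
  then show ?thesis by (simp add: atom_def[abs_def] mult.commute)
qed

section \<open>The cross term as a form in two functions\<close>

definition coef :: "(real \<Rightarrow> complex) \<Rightarrow> int \<Rightarrow> int \<Rightarrow> complex" where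
  "coef F m n = inner_L2 F (atom m n)"

lemma coef_fcoeff: "coef F m n = fcoeff (\<lambda>\<omega>. F \<omega> * complex_of_real (r (\<omega> - of_int n))) m"
  unfolding coef_def inner_L2_def fcoeff_def atom_def by (simp add: cis_cnj mult_ac)

text \<open>The two \<open>cis\<close> factors make up the sign (-1)^(m+n). The Wilson sums involve
  \<open>F = H\<close>, but the vanishing is proved for pieces in two different cells.\<close>

definition cross :: "(real \<Rightarrow> complex) \<Rightarrow> (real \<Rightarrow> complex) \<Rightarrow> int \<times> int \<Rightarrow> complex" where
  "cross F H = (\<lambda>(m, n). cis (pi * of_int m) * cis (pi * of_int n) * (coef F m n * cnj (coef H m (- n))))"

lemma coef_has_sum: "sq_int F \<Longrightarrow> ((\<lambda>(m, n). (norm (coef F m n))\<^sup>2) has_sum (2 * (norm_L2 F)\<^sup>2)) UNIV"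
  unfolding coef_def by (rule tight)

lemma coef_reflect_has_sum:
  assumes "sq_int F"
  shows "((\<lambda>(m, n). (norm (coef F m (- n)))\<^sup>2) has_sum (2 * (norm_L2 F)\<^sup>2)) UNIV"
proof -
  have "bij_betw (\<lambda>(m::int, n::int). (m, - n)) UNIV UNIV"
    by (rule bij_betwI[where g = "\<lambda>(m, n). (m, - n)"]) auto
  then show ?thesis
    using coef_has_sum[OF assms] has_sum_reindex_bij_betw[of "\<lambda>(m::int, n::int). (m, - n)" UNIV UNIV
        "\<lambda>(m, n). (norm (coef F m n))\<^sup>2"]
    by (simp add: case_prod_unfold)
qed

lemma norm_cross_le: "norm (cross F H (m, n)) \<le> (norm (coef F m n))\<^sup>2 + (norm (coef H m (- n)))\<^sup>2"
  using norm_mult_le_sum_squares[of "coef F m n" "cnj (coef H m (- n))"]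
  by (simp add: cross_def norm_mult)

lemma cross_bound_has_sum:
  assumes "sq_int F" "sq_int H"
  shows "((\<lambda>(m, n). (norm (coef F m n))\<^sup>2 + (norm (coef H m (- n)))\<^sup>2) has_sum
    (2 * (norm_L2 F)\<^sup>2 + 2 * (norm_L2 H)\<^sup>2)) UNIV"
  using has_sum_add[OF coef_has_sum[OF assms(1)] coef_reflect_has_sum[OF assms(2)]]
  by (simp add: case_prod_unfold)

lemma cross_abs_summable:
  assumes "sq_int F" "sq_int H"
  shows "(\<lambda>x. norm (cross F H x)) summable_on UNIV"
  using cross_bound_has_sum[OF assms] norm_cross_le[of F H]
  by (intro Infinite_Sum.abs_summable_on_comparison_test'[OF has_sum_imp_summable]) auto

lemma cross_summable: "sq_int F \<Longrightarrow> sq_int H \<Longrightarrow> cross F H summable_on UNIV"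
  using cross_abs_summable by (rule abs_summable_summable)

definition Cross :: "(real \<Rightarrow> complex) \<Rightarrow> (real \<Rightarrow> complex) \<Rightarrow> complex" where
  "Cross F H = infsum (cross F H) UNIV"

lemma Cross_has_sum: "sq_int F \<Longrightarrow> sq_int H \<Longrightarrow> (cross F H has_sum Cross F H) UNIV"
  unfolding Cross_def by (intro has_sum_infsum cross_summable)

lemma norm_Cross_le:
  assumes "sq_int F" "sq_int H"
  shows "norm (Cross F H) \<le> 2 * (norm_L2 F)\<^sup>2 + 2 * (norm_L2 H)\<^sup>2"
proof -
  have "norm (Cross F H) \<le> infsum (\<lambda>x. norm (cross F H x)) UNIV"
    unfolding Cross_def by (rule norm_infsum_bound[OF cross_abs_summable[OF assms]])
  also have "\<dots> \<le> 2 * (norm_L2 F)\<^sup>2 + 2 * (norm_L2 H)\<^sup>2"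
    using norm_cross_le[of F H]
    by (intro has_sum_mono[OF has_sum_infsum[OF cross_abs_summable[OF assms]] cross_bound_has_sum[OF assms]]) auto
  finally show ?thesis .
qed

lemma Cross_add_left:
  assumes "sq_int F" "sq_int G" "sq_int H"
  shows "Cross (\<lambda>t. F t + G t) H = Cross F H + Cross G H"
proof -
  have "cross (\<lambda>t. F t + G t) H = (\<lambda>x. cross F H x + cross G H x)"
    using assms by (auto simp: cross_def coef_def fun_eq_iff inner_L2_add_left sq_int_atom algebra_simps)
  then show ?thesis unfolding Cross_def using infsum_add[OF cross_summable cross_summable] assms by metis
qed

lemma Cross_cmult_left: "Cross (\<lambda>t. c * F t) H = c * Cross F H"
proof -
  have "cross (\<lambda>t. c * F t) H = (\<lambda>x. c * cross F H x)"
    by (auto simp: cross_def coef_def fun_eq_iff inner_L2_cmult_left)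
  then show ?thesis unfolding Cross_def by (simp add: infsum_cmult_right')
qed

text \<open>Reflecting \<open>n\<close> exchanges the two coefficients, and the sign is real and
  even in \<open>n\<close>.\<close>

lemma Cross_commute: "Cross H F = cnj (Cross F H)"
proof -
  have b: "bij_betw (\<lambda>(m::int, n::int). (m, - n)) UNIV UNIV"
    by (rule bij_betwI[where g = "\<lambda>(m, n). (m, - n)"]) auto
  have "cross H F x = cnj (cross F H ((\<lambda>(m, n). (m, - n)) x))" for x
    by (cases x) (simp add: cross_def cis_pi_int)
  then have "Cross H F = infsum (\<lambda>x. cnj (cross F H ((\<lambda>(m, n). (m, - n)) x))) UNIV"
    unfolding Cross_def by presburger
  also have "\<dots> = infsum (\<lambda>x. cnj (cross F H x)) UNIV"
    by (rule infsum_reindex_bij_betw[OF b])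
  finally show ?thesis unfolding Cross_def by (simp add: infsum_cnj)
qed

text \<open>\<open>Cross\<close> is bounded by a sum of squares and not by a product, so continuity
  is extracted by scaling: multiplying \<open>F - S N\<close> by any \<open>\<tau> > 0\<close>
  bounds \<open>\<tau> * norm (Cross F H)\<close> in the limit by a constant independent of
  \<open>\<tau>\<close>.\<close>

lemma Cross_zero_closed:
  assumes s: "\<And>N::nat. sq_int (S N)" and F: "sq_int F" and H: "sq_int H"
    and lim: "(\<lambda>N. norm_L2 (\<lambda>t. F t - S N t)) \<longlonglongrightarrow> 0" and z: "\<And>N. Cross (S N) H = 0"
  shows "Cross F H = 0"
proof -
  have le: "\<tau> * norm (Cross F H) \<le> 2 * (norm_L2 H)\<^sup>2" if "\<tau> > 0" for \<tau>
  proof (rule LIMSEQ_le_const)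
    show "(\<lambda>N. 2 * (\<tau> * norm_L2 (\<lambda>t. F t - S N t))\<^sup>2 + 2 * (norm_L2 H)\<^sup>2) \<longlonglongrightarrow> 2 * (norm_L2 H)\<^sup>2"
      using tendsto_add[OF tendsto_mult[OF tendsto_const[of 2] tendsto_power[OF tendsto_mult[OF tendsto_const[of \<tau>] lim], of 2]] tendsto_const[of "2 * (norm_L2 H)\<^sup>2"]]
      by simp
    have "\<tau> * norm (Cross F H) \<le> 2 * (\<tau> * norm_L2 (\<lambda>t. F t - S N t))\<^sup>2 + 2 * (norm_L2 H)\<^sup>2" for N
    proof -
      have d: "sq_int (\<lambda>t. F t - S N t)" by (intro sq_int_diff F s)
      have "Cross F H = Cross (\<lambda>t. F t - S N t) H"
        using Cross_add_left[OF d s[of N] H] z[of N] by simp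
      then have "\<tau> * norm (Cross F H) = norm (Cross (\<lambda>t. complex_of_real \<tau> * (F t - S N t)) H)"
        using that by (simp add: Cross_cmult_left norm_mult)
      also have "\<dots> \<le> 2 * (norm_L2 (\<lambda>t. complex_of_real \<tau> * (F t - S N t)))\<^sup>2 + 2 * (norm_L2 H)\<^sup>2"
        by (intro norm_Cross_le sq_int_cmult d H)
      finally show ?thesis using that by (simp add: norm_L2_cmult)
    qed
    then show "\<exists>N. \<forall>n\<ge>N. \<tau> * norm (Cross F H) \<le> 2 * (\<tau> * norm_L2 (\<lambda>t. F t - S n t))\<^sup>2 + 2 * (norm_L2 H)\<^sup>2"
      by blast
  qed
  show ?thesis
  proof (rule ccontr)
    assume "Cross F H \<noteq> 0"
    then have pos: "norm (Cross F H) > 0" by simp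
    moreover have "(2 * (norm_L2 H)\<^sup>2 + 1) / norm (Cross F H) > 0"
      using pos by (intro divide_pos_pos add_nonneg_pos) auto
    ultimately show False using le[of "(2 * (norm_L2 H)\<^sup>2 + 1) / norm (Cross F H)"] by simp
  qed
qed

text \<open>Boundedness keeps the products with translates of \<open>r\<close> square integrable. A
  unit cell is half of a period, which leaves room for a disjoint shifted copy.\<close>

definition local_at :: "int \<Rightarrow> (real \<Rightarrow> complex) \<Rightarrow> bool" where
  "local_at p F \<longleftrightarrow> F \<in> borel_measurable borel \<and> (\<exists>C. \<forall>t. norm (F t) \<le> C) \<and>
     (\<forall>t. t \<notin> {of_int p..<of_int p + 1} \<longrightarrow> F t = 0)"

lemma local_at_translate:
  assumes "local_at p F"
  shows "\<omega> \<notin> {0..<1} \<Longrightarrow> F (\<omega> + of_int p) = 0"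
    "(\<lambda>\<omega>. F (\<omega> + of_int p)) \<in> borel_measurable borel" "\<exists>C. \<forall>\<omega>. norm (F (\<omega> + of_int p)) \<le> C"
  using assms unfolding local_at_def by (auto intro: measurable_compose[of _ _ borel])

lemma sq_int_local:
  assumes "local_at p F"
  shows "sq_int F"
proof -
  obtain C where "\<forall>t. norm (F t) \<le> C" using assms unfolding local_at_def by blast
  then have "sq_int (\<lambda>t. F t * indicator {of_int p..of_int p + 1} t)"
    using assms unfolding local_at_def by (intro sq_int_bounded_mult[OF sq_int_indicator_Icc, where C = C]) auto
  also have "(\<lambda>t. F t * indicator {of_int p..of_int p + 1} t) = F"
    using assms unfolding local_at_def by (fastforce intro!: ext simp: indicator_def)
  finally show ?thesis .
qed

text \<open>Summing over \<open>m\<close> by Parseval leaves terms invariant under \<open>n \<mapsto> p - q - n\<close>, while the sign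
  \<open>(-1)\<^sup>n\<close> changes: here it matters that \<open>r\<close> is real.\<close>

lemma Cross_local:
  assumes F: "local_at p F" and H: "local_at q H"
  shows "Cross F H = 0"
proof -
  \<comment> \<open>Both cells are moved to \<open>{0..<1}\<close>; the phases this costs merge with
    the sign (-1)^m in \<open>cr\<close>.\<close>
  define u where "u n \<omega> = F (\<omega> + of_int p) * complex_of_real (r (\<omega> + of_int (p - n)))" for n \<omega>
  define v where "v n \<omega> = H (\<omega> + of_int q) * complex_of_real (r (\<omega> + of_int (q + n)))" for n \<omega>
  have u: "sq_int (u n)" and v: "sq_int (v n)" for n
    unfolding u_def v_def using local_at_translate(2,3)[OF F] local_at_translate(2,3)[OF H]
    by (auto intro!: sq_int_bounded_mult[OF sq_int_translate])
  have supp: "\<omega> \<notin> {0..<1} \<Longrightarrow> u n \<omega> = 0" "\<omega> \<notin> {0..<1} \<Longrightarrow> v n \<omega> = 0" for n \<omega>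
    unfolding u_def v_def using local_at_translate(1)[OF F] local_at_translate(1)[OF H] by auto
  have cF: "coef F m n = cis (pi * of_int m * of_int p) * fcoeff (u n) m"
    and cH: "coef H m (- n) = cis (pi * of_int m * of_int q) * fcoeff (v n) m" for m n
    unfolding coef_fcoeff u_def v_def
    by (subst fcoeff_translate[where x = "of_int p"], simp add: algebra_simps)
      (subst fcoeff_translate[where x = "of_int q"], simp add: algebra_simps)
  define \<beta> where "\<beta> n = (if odd (p - q) then 2 * inner_L2 (u n) (v n) else 0)" for n
  have cr: "cross F H (m, n) = cis (pi * of_int n) * (cis (pi * of_int (m * (1 + p - q))) * (fcoeff (u n) m * cnj (fcoeff (v n) m)))" for m n
    unfolding cross_def cF cH of_int_mult of_int_add of_int_diff
    by (simp add: cis_cnj cis_mult algebra_simps)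
  have sum_m: "((\<lambda>m. cross F H (m, n)) has_sum (cis (pi * of_int n) * \<beta> n)) UNIV" for n
    unfolding cr
  proof (rule has_sum_cmult_right, cases "odd (p - q)")
    \<comment> \<open>Here \<open>1 + p - q\<close> is even, so the phase is trivial and Parseval
      applies directly.\<close>
    case True
    then have "cis (pi * of_int (m * (1 + p - q))) = 1" for m
      unfolding cis_pi_int by auto
    moreover have "((\<lambda>m. fcoeff (u n) m * cnj (fcoeff (v n) m)) has_sum (2 * inner_L2 (u n) (v n))) UNIV"
      using supp by (intro fcoeff_parseval u v) auto
    ultimately show "((\<lambda>m. cis (pi * of_int (m * (1 + p - q))) * (fcoeff (u n) m * cnj (fcoeff (v n) m))) has_sum \<beta> n) UNIV"
      using True by (simp add: \<beta>_def)
  next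
    \<comment> \<open>The sign (-1)^m that remains shifts \<open>u n\<close> by half a period, into
      \<open>{1..<2}\<close> and so off the support of \<open>v n\<close>.\<close>
    case False
    let ?w = "\<lambda>\<omega>. u n (\<omega> - 1)"
    have "cis (pi * of_int (m * (1 + p - q))) * fcoeff (u n) m = fcoeff ?w m" for m
      using False fcoeff_translate[of ?w m 1, unfolded mult_1_right cis_pi_int] unfolding cis_pi_int by simp
    then have eq: "cis (pi * of_int (m * (1 + p - q))) * (fcoeff (u n) m * cnj (fcoeff (v n) m)) = fcoeff ?w m * cnj (fcoeff (v n) m)" for m
      by (metis mult.assoc)
    have w: "sq_int ?w" using sq_int_affine[OF u[of n], of 1 "- 1"] by (simp add: algebra_simps)
    have ps: "((\<lambda>m. fcoeff ?w m * cnj (fcoeff (v n) m)) has_sum (2 * inner_L2 ?w (v n))) UNIV"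
      using supp by (intro fcoeff_parseval w v) auto
    have zero: "?w \<omega> * cnj (v n \<omega>) = 0" for \<omega>
      using supp(1)[of "\<omega> - 1" n] supp(2)[of \<omega> n] by (cases "\<omega> \<in> {0..<1}") auto
    have inz: "inner_L2 ?w (v n) = 0" unfolding inner_L2_def zero by (rule integral_zero)
    have "\<beta> n = 2 * inner_L2 ?w (v n)" using False by (simp only: inz \<beta>_def) simp
    then show "((\<lambda>m. cis (pi * of_int (m * (1 + p - q))) * (fcoeff (u n) m * cnj (fcoeff (v n) m))) has_sum \<beta> n) UNIV"
      unfolding eq using ps by simp
  qed
  have "((\<lambda>(n, m). cross F H (m, n)) has_sum Cross F H) (UNIV \<times> UNIV)"
    using Cross_has_sum[OF sq_int_local[OF F] sq_int_local[OF H]]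
    by (subst (asm) UNIV_Times_UNIV[symmetric], subst (asm) has_sum_swap) simp
  then have tot: "((\<lambda>n. cis (pi * of_int n) * \<beta> n) has_sum Cross F H) UNIV"
    by (rule has_sum_SigmaD) (use sum_m in simp)
  show ?thesis
  proof (cases "odd (p - q)")
    case False
    then have "((\<lambda>n. 0) has_sum Cross F H) (UNIV :: int set)" using tot by (simp add: \<beta>_def)
    then show ?thesis by (rule has_sum_unique) simp
  next
    case True
    \<comment> \<open>The substitution exchanges the two translates of \<open>r\<close>, one of
      which stands under the conjugation; for real \<open>r\<close> the product is
      unchanged.\<close>
    have \<beta>: "\<beta> (p - q - n) = \<beta> n" for n
    proof -
      have eq: "u (p - q - n) \<omega> * cnj (v (p - q - n) \<omega>) = u n \<omega> * cnj (v n \<omega>)" for \<omega>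
        unfolding u_def v_def by (simp add: algebra_simps)
      show ?thesis unfolding \<beta>_def inner_L2_def eq ..
    qed
    have sgn: "cis (pi * of_int (p - q - n)) = - cis (pi * of_int n)" for n
      using True unfolding cis_pi_int by auto
    have "bij_betw (\<lambda>n. p - q - n) UNIV UNIV"
      by (rule bij_betwI[where g = "\<lambda>n. p - q - n"]) auto
    then have "((\<lambda>n. cis (pi * of_int (p - q - n)) * \<beta> (p - q - n)) has_sum Cross F H) UNIV"
      using tot has_sum_reindex_bij_betw[of "\<lambda>n. p - q - n" UNIV UNIV "\<lambda>n. cis (pi * of_int n) * \<beta> n"] by blast
    then have "((\<lambda>n. - (cis (pi * of_int n) * \<beta> n)) has_sum Cross F H) UNIV"
      unfolding \<beta> sgn by simp
    then have "Cross F H = - Cross F H"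
      using has_sum_uminusI[OF tot] by (rule has_sum_unique)
    then show ?thesis by simp
  qed
qed

lemma Cross_sum_left:
  "finite I \<Longrightarrow> (\<And>i. i \<in> I \<Longrightarrow> sq_int (F i)) \<Longrightarrow> sq_int H \<Longrightarrow>
    Cross (\<lambda>t. \<Sum>i\<in>I. F i t) H = (\<Sum>i\<in>I. Cross (F i) H)"
proof (induction I rule: finite_induct)
  case empty
  show ?case using Cross_cmult_left[of 0 "\<lambda>t. 0" H] by simp
next
  case (insert x I)
  then show ?case using Cross_add_left[of "F x" "\<lambda>t. \<Sum>i\<in>I. F i t" H] by (simp add: sq_int_sum)
qed

text \<open>Cutting \<open>F\<close> down to bounded values and to \<open>- real N \<le> t\<close>,
  \<open>t < real N\<close> leaves finitely many local pieces; additivity and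
  \<open>Cross_zero_closed\<close> finish.\<close>

lemma Cross_zero_of_local:
  assumes z: "\<And>p G. local_at p G \<Longrightarrow> Cross G H = 0" and F: "sq_int F" and H: "sq_int H"
  shows "Cross F H = 0"
proof -
  have [measurable]: "F \<in> borel_measurable borel" using F sq_int_measurable by blast
  define A where "A N = {t. norm (F t) \<le> real N \<and> - real N \<le> t \<and> t < real N}" for N :: nat
  have [measurable]: "A N \<in> sets borel" for N unfolding A_def by measurable
  define G where "G N p t = indicator (A N \<inter> {of_int p..<of_int p + 1}) t * F t" for N p t
  have loc: "local_at p (G N p)" for N p
    unfolding local_at_def
  proof (intro conjI allI impI exI)
    show "norm (G N p t) \<le> real N" for t by (auto simp: G_def A_def indicator_def)
    show "G N p \<in> borel_measurable borel" unfolding G_def by measurable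
  qed (auto simp: G_def)
  show ?thesis
  proof (rule Cross_zero_closed[OF _ F H])
    show "sq_int (\<lambda>t. indicator (A N) t * F t)" for N by (intro sq_int_indicator_mult F) auto
    show "(\<lambda>N. norm_L2 (\<lambda>t. F t - indicator (A N) t * F t)) \<longlonglongrightarrow> 0"
    proof (rule L2_truncation_tendsto[OF F])
      fix t
      obtain N where N: "norm (F t) + \<bar>t\<bar> + 1 \<le> real N" using real_arch_simple by blast
      have "t \<in> A n" if "n \<ge> N" for n
      proof -
        have "norm (F t) + \<bar>t\<bar> + 1 \<le> real n" using N that by linarith
        then show ?thesis using norm_ge_zero[of "F t"] unfolding A_def mem_Collect_eq by linarith
      qed
      then show "\<forall>\<^sub>F n in sequentially. t \<in> A n" unfolding eventually_sequentially by blast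
    qed simp
    fix N
    have "indicator (A N) t * F t = (\<Sum>p\<in>{- int N..int N}. G N p t)" for t
    proof -
      have "(\<Sum>p\<in>{- int N..int N}. G N p t) = (\<Sum>p\<in>{- int N..int N}. if p = \<lfloor>t\<rfloor> then indicator (A N) t * F t else 0)"
      proof (intro sum.cong refl)
        fix p
        have "t \<in> {of_int p..<of_int p + 1} \<longleftrightarrow> p = \<lfloor>t\<rfloor>"
          using floor_unique[of p t] by auto
        then show "G N p t = (if p = \<lfloor>t\<rfloor> then indicator (A N) t * F t else 0)"
          by (auto simp: G_def indicator_def)
      qed
      also have "\<dots> = (if \<lfloor>t\<rfloor> \<in> {- int N..int N} then indicator (A N) t * F t else 0)"
        by simp
      also have "\<dots> = indicator (A N) t * F t"
      proof (cases "t \<in> A N")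
        case True
        then have "- int N \<le> \<lfloor>t\<rfloor>" "\<lfloor>t\<rfloor> \<le> int N"
          unfolding A_def by (auto simp: le_floor_iff floor_le_iff)
        then show ?thesis by simp
      qed simp
      finally show ?thesis ..
    qed
    then show "Cross (\<lambda>t. indicator (A N) t * F t) H = 0"
      using Cross_sum_left[of "{- int N..int N}" "G N" H] sq_int_local[OF loc] H z[OF loc] by simp
  qed
qed

text \<open>The reduction to local functions acts on the left argument; conjugate symmetry carries
  it over to the right one.\<close>

theorem Cross_zero:
  assumes "sq_int F" "sq_int H"
  shows "Cross F H = 0"
proof (rule Cross_zero_of_local[OF _ assms])
  fix p G assume G: "local_at p G"
  have "Cross H G = 0"
    by (rule Cross_zero_of_local[OF Cross_local[OF _ G] assms(2) sq_int_local[OF G]])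
  then show "Cross G H = 0" using Cross_commute[of G H] by simp
qed

text \<open>The frame identity is tested on the indicator of \<open>{0..<1}\<close>, of norm 1.
  Parseval in \<open>m\<close> turns its frame sum 2 into twice the sum over \<open>n\<close> of the
  integrals of \<open>r\<^sup>2\<close> over disjoint unit intervals.\<close>

lemma one_le_norm_r: "1 \<le> (norm_L2 (\<lambda>\<omega>. complex_of_real (r \<omega>)))\<^sup>2"
proof -
  let ?F = "indicator {0..<1::real} :: real \<Rightarrow> complex"
  let ?u = "\<lambda>n \<omega>. ?F \<omega> * complex_of_real (r (\<omega> - of_int n))"
  let ?I = "\<lambda>n. LINT \<omega>|lborel. indicator {- of_int n..<1 - of_int n} \<omega> * (r \<omega>)\<^sup>2"
  have r2: "integrable lborel (\<lambda>\<omega>. (r \<omega>)\<^sup>2)" using sq_int_integrable[OF r] by simp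
  have ri: "integrable lborel (\<lambda>\<omega>. indicator {- of_int n..<1 - of_int n} \<omega> * (r \<omega>)\<^sup>2)" for n :: int
    using integrable_mult_indicator[OF _ r2, of "{- of_int n..<1 - of_int n}"] by simp
  have nF: "(norm_L2 ?F)\<^sup>2 = 1"
  proof -
    have "(norm_L2 ?F)\<^sup>2 = (LINT t|lborel. indicator {0..<1::real} t)"
      unfolding power2_norm_L2 by (intro Bochner_Integration.integral_cong) (auto simp: indicator_def)
    then show ?thesis by simp
  qed
  have F: "sq_int ?F"
    by (rule sq_int_local[of 0]) (auto simp: local_at_def indicator_def intro!: exI[of _ 1])
  have u: "sq_int (?u n)" for n
    using sq_int_indicator_mult[OF sq_int_translate[of "- of_int n"], of "{0..<1}"] by simp
  have sF: "((\<lambda>(n, m). (norm (coef ?F m n))\<^sup>2) has_sum 2) (UNIV \<times> UNIV)"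
    using coef_has_sum[OF F] unfolding nF
    by (subst (asm) UNIV_Times_UNIV[symmetric], subst (asm) has_sum_swap) simp
  have sI: "((\<lambda>m. (norm (coef ?F m n))\<^sup>2) has_sum (2 * ?I n)) UNIV" for n
  proof -
    have "(norm_L2 (?u n))\<^sup>2 = (LINT \<omega>|lborel. indicator {0..<1} \<omega> * (r (\<omega> - of_int n))\<^sup>2)"
      unfolding power2_norm_L2 by (intro Bochner_Integration.integral_cong) (auto simp: indicator_def)
    also have "\<dots> = ?I n"
      by (subst lborel_integral_real_affine[where c = 1 and t = "of_int n"])
        (auto simp: indicator_def intro!: Bochner_Integration.integral_cong)
    finally have nu: "(norm_L2 (?u n))\<^sup>2 = ?I n" .
    have "((\<lambda>m. (norm (fcoeff (?u n) m))\<^sup>2) has_sum (2 * (norm_L2 (?u n))\<^sup>2)) UNIV"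
      by (rule fcoeff_parseval_square[OF u]) (auto simp: indicator_def)
    then show ?thesis unfolding coef_fcoeff nu .
  qed
  have "((\<lambda>n. 2 * ?I n) has_sum 2) UNIV"
    by (rule has_sum_SigmaD[OF sF]) (simp only: prod.case sI)
  then have "2 \<le> 2 * (norm_L2 (\<lambda>\<omega>. complex_of_real (r \<omega>)))\<^sup>2"
  proof (rule has_sum_le_finite_sums)
    fix N :: "int set" assume N: "finite N"
    have "(\<Sum>n\<in>N. ?I n) = (LINT \<omega>|lborel. (\<Sum>n\<in>N. indicator {- of_int n..<1 - of_int n} \<omega> * (r \<omega>)\<^sup>2))"
      using ri by (subst Bochner_Integration.integral_sum) auto
    also have "\<dots> \<le> (LINT \<omega>|lborel. (r \<omega>)\<^sup>2)"
    proof (rule integral_mono)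
      show "integrable lborel (\<lambda>\<omega>. \<Sum>n\<in>N. indicator {- of_int n..<1 - of_int n} \<omega> * (r \<omega>)\<^sup>2)"
        using ri by (intro Bochner_Integration.integrable_sum) auto
      fix \<omega>
      have "(\<Sum>n\<in>N. indicator {- of_int n..<1 - of_int n} \<omega> * (r \<omega>)\<^sup>2) = (\<Sum>n\<in>N. if n = - \<lfloor>\<omega>\<rfloor> then (r \<omega>)\<^sup>2 else 0)"
      proof (intro sum.cong refl)
        fix n
        have "\<omega> \<in> {- of_int n..<1 - of_int n} \<longleftrightarrow> n = - \<lfloor>\<omega>\<rfloor>"
          using floor_eq_iff[of \<omega> "- n"] by auto
        then show "indicator {- of_int n..<1 - of_int n} \<omega> * (r \<omega>)\<^sup>2 = (if n = - \<lfloor>\<omega>\<rfloor> then (r \<omega>)\<^sup>2 else 0)"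
          by (auto simp: indicator_def)
      qed
      also have "\<dots> \<le> (r \<omega>)\<^sup>2" using N by simp
      finally show "(\<Sum>n\<in>N. indicator {- of_int n..<1 - of_int n} \<omega> * (r \<omega>)\<^sup>2) \<le> (r \<omega>)\<^sup>2" .
    qed (rule r2)
    finally show "(\<Sum>n\<in>N. 2 * ?I n) \<le> 2 * (norm_L2 (\<lambda>\<omega>. complex_of_real (r \<omega>)))\<^sup>2"
      unfolding power2_norm_L2 by (simp add: sum_distrib_left[symmetric])
  qed
  then show ?thesis by simp
qed

text \<open>The chirp constants of \<open>wilson\<close> and its factor \<open>\<i>\<close> for odd
  \<open>m + n\<close> are unimodular and left out; the alternation of sum and difference is the
  sign \<open>cis (pi * of_int (m + int n))\<close>.\<close>

definition wils :: "int \<Rightarrow> nat \<Rightarrow> real \<Rightarrow> complex" where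
  "wils m n \<omega> = (if n = 0 then atom (2 * m) 0 \<omega>
     else (1 / complex_of_real (sqrt 2)) * (atom m (int n) \<omega> + cis (pi * of_int (m + int n)) * atom m (- int n) \<omega>))"

lemma wils_0: "wils m 0 = atom (2 * m) 0"
  by (simp add: wils_def fun_eq_iff)

lemma wils_pos:
  "n \<noteq> 0 \<Longrightarrow> wils m n = (\<lambda>\<omega>. (1 / complex_of_real (sqrt 2)) *
     (atom m (int n) \<omega> + cis (pi * of_int (m + int n)) * atom m (- int n) \<omega>))"
  by (simp add: wils_def fun_eq_iff)

lemma sq_int_wils: "sq_int (wils m n)"
proof (cases "n = 0")
  case False
  show ?thesis unfolding wils_pos[OF False] by (intro sq_int_cmult sq_int_add sq_int_atom)
qed (simp add: wils_0 sq_int_atom)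

lemma inner_wils:
  assumes F: "sq_int F"
  shows "inner_L2 F (wils m n) = (if n = 0 then coef F (2 * m) 0
    else (1 / complex_of_real (sqrt 2)) * (coef F m (int n) + cis (pi * of_int (m + int n)) * coef F m (- int n)))"
proof (cases "n = 0")
  case False
  have c: "cnj (cis (pi * of_int k)) = cis (pi * of_int k)" for k by (simp add: cis_pi_int)
  show ?thesis
    unfolding wils_pos[OF False] coef_def inner_L2_cmult_right
      inner_L2_add_right[OF sq_int_atom sq_int_cmult[OF sq_int_atom] F] c
    using False by simp
qed (simp add: wils_0 coef_def)

theorem wils_parseval:
  assumes F: "sq_int F"
  shows "((\<lambda>(m, n). (norm (inner_L2 F (wils m n)))\<^sup>2) has_sum (norm_L2 F)\<^sup>2) UNIV"
proof -
  define A where "A = (\<lambda>(m, n). (1/2) * ((norm (coef F m n))\<^sup>2 + Re (cross F F (m, n))))"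
  have "((\<lambda>x. (1/2) * ((case x of (m, n) \<Rightarrow> (norm (coef F m n))\<^sup>2) + Re (cross F F x))) has_sum (1/2) * (2 * (norm_L2 F)\<^sup>2 + Re 0)) UNIV"
    using Cross_has_sum[OF F F] unfolding Cross_zero[OF F F]
    by (intro has_sum_cmult_right has_sum_add coef_has_sum F has_sum_Re)
  then have A: "(A has_sum (norm_L2 F)\<^sup>2) UNIV"
    by (simp add: A_def case_prod_unfold)
  \<comment> \<open>The indices whose \<open>A\<close>-values add up to one Wilson coefficient. For
    \<open>n = 0\<close> the cross term is (-1)^m times the squared modulus, so
    \<open>A (2 * m, 0)\<close> is the full square and \<open>A (2 * m + 1, 0)\<close> is 0; hence a
    Wilson system keeps just the even shifts there.\<close>
  define B :: "int \<times> nat \<Rightarrow> (int \<times> int) set" where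
    "B = (\<lambda>(m, n). if n = 0 then {(2 * m, 0), (2 * m + 1, 0)} else {(m, int n), (m, - int n)})"
  \<comment> \<open>The unique fibre that contains a given pair.\<close>
  define j :: "int \<times> int \<Rightarrow> int \<times> nat" where
    "j = (\<lambda>(m, n). if n = 0 then (m div 2, 0) else (m, nat \<bar>n\<bar>))"
  have "bij_betw snd (Sigma UNIV B) UNIV"
  proof (rule bij_betwI[where g = "\<lambda>x. (j x, x)"])
    show "(\<lambda>x. (j x, x)) \<in> UNIV \<rightarrow> Sigma UNIV B"
    proof (intro funcsetI SigmaI UNIV_I)
      fix x :: "int \<times> int"
      obtain m n where x: "x = (m, n)" by fastforce
      have "m = 2 * (m div 2) \<or> m = 2 * (m div 2) + 1" by presburger
      then show "x \<in> B (j x)" unfolding x j_def B_def by (auto simp: abs_if)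
    qed
    show "(j (snd y), snd y) = y" if "y \<in> Sigma UNIV B" for y
      using that by (auto simp: B_def j_def split: if_splits)
  qed auto
  then have SA: "((\<lambda>y. A (snd y)) has_sum (norm_L2 F)\<^sup>2) (Sigma UNIV B)"
    using A has_sum_reindex_bij_betw[of snd "Sigma UNIV B" UNIV A] by blast
  have SB: "((\<lambda>y. A (snd (x, y))) has_sum (case x of (m, n) \<Rightarrow> (norm (inner_L2 F (wils m n)))\<^sup>2)) (B x)" for x
  proof -
    obtain m n where x: "x = (m, n)" by fastforce
    have "sum A (B x) = (norm (inner_L2 F (wils m n)))\<^sup>2"
    proof (cases "n = 0")
      case True
      have "Re (coef F k 0 * cnj (coef F k 0)) = (norm (coef F k 0))\<^sup>2" for k
        using complex_norm_square[of "coef F k 0"] by (metis Re_complex_of_real)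
      then show ?thesis
        using True by (simp add: x B_def A_def cross_def inner_wils[OF F] cis_pi_int del: of_int_mult of_int_add)
    next
      case False
      let ?s = "cis (pi * of_int (m + int n))" and ?c = "coef F m (int n)" and ?d = "coef F m (- int n)"
      have s: "cis (pi * of_int m) * cis (pi * of_int (int n)) = ?s" "cis (pi * of_int m) * cis (pi * of_int (- int n)) = ?s"
        unfolding cis_pi_int by auto
      have *: "(norm (x + \<sigma> * y))\<^sup>2 = (norm x)\<^sup>2 + (norm y)\<^sup>2 + Re (\<sigma> * (x * cnj y)) + Re (\<sigma> * (y * cnj x))"
        if "\<sigma> = 1 \<or> \<sigma> = - 1" for x y \<sigma> :: complex
        unfolding cmod_power2 using that by (auto simp: power2_eq_square algebra_simps)
      have "sum A (B x) = A (m, int n) + A (m, - int n)" using False by (simp add: x B_def)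
      also have "\<dots> = (1/2) * ((norm ?c)\<^sup>2 + (norm ?d)\<^sup>2 + Re (?s * (?c * cnj ?d)) + Re (?s * (?d * cnj ?c)))"
        unfolding A_def cross_def prod.case s by (simp add: algebra_simps)
      also have "\<dots> = (1/2) * (norm (?c + ?s * ?d))\<^sup>2"
        by (subst *) (auto simp: cis_pi_int simp del: of_int_add)
      also have "\<dots> = (norm (inner_L2 F (wils m n)))\<^sup>2"
        using False by (simp add: inner_wils[OF F] norm_mult norm_divide power_mult_distrib power_divide del: of_int_add)
      finally show ?thesis .
    qed
    moreover have "finite (B x)" by (simp add: x B_def)
    ultimately show ?thesis using has_sum_finite[of "B x" A] by (simp add: x)
  qed
  show ?thesis by (rule has_sum_SigmaD[OF SA SB])
qed

section \<open>Norms of the Wilson functions\<close>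

lemma norm_atom: "norm_L2 (atom m n) = norm_L2 (\<lambda>\<omega>. complex_of_real (r \<omega>))"
proof -
  have "norm_L2 (\<lambda>\<omega>. complex_of_real (r \<omega>)) = norm_L2 (\<lambda>\<omega>. complex_of_real (r (- of_int n + 1 * \<omega>)))"
    using norm_L2_affine[of 1 "\<lambda>\<omega>. complex_of_real (r \<omega>)" "- of_int n"] by simp
  also have "\<dots> = norm_L2 (atom m n)"
    unfolding norm_L2_def atom_def by (simp add: norm_mult)
  finally show ?thesis ..
qed

theorem norm_wils: "norm_L2 (wils m n) = 1"
proof -
  let ?R = "(norm_L2 (\<lambda>\<omega>. complex_of_real (r \<omega>)))\<^sup>2"
  have le: "(norm_L2 (wils m n))\<^sup>2 \<le> 1" for m n
  proof -
    have "(norm_L2 (wils (fst (m, n)) (snd (m, n))))\<^sup>2 \<le> 1"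
      by (rule norm_L2_le_1_of_parseval[where e = "\<lambda>x. wils (fst x) (snd x)"])
        (rule sq_int_wils, rule wils_parseval[unfolded case_prod_unfold])
    then show ?thesis by simp
  qed
  have "?R \<le> 1" using le[of 0 0] by (simp add: wils_0 norm_atom)
  then have R: "?R = 1" using one_le_norm_r by simp
  have sq1: "x = 1" if "x\<^sup>2 = 1" "0 \<le> x" for x :: real
    using that by (metis abs_of_nonneg real_sqrt_abs real_sqrt_one)
  show ?thesis
  proof (cases "n = 0")
    case True
    then show ?thesis using sq1[OF R] by (simp add: wils_0 norm_atom)
  next
    case False
    \<comment> \<open>The characters cancel in this inner product, so it is the same for all
      \<open>k\<close> in place of 0. The squared norm is then 1 plus or minus
      \<open>\<kappa>\<close> by the parity of \<open>k + int n\<close>, and both values are at most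
      1.\<close>
    define \<kappa> where "\<kappa> = Re (inner_L2 (atom 0 (int n)) (atom 0 (- int n)))"
    have \<kappa>: "Re (inner_L2 (atom k (int n)) (atom k (- int n))) = \<kappa>" for k
    proof -
      have eq: "atom k (int n) \<omega> * cnj (atom k (- int n) \<omega>) = atom 0 (int n) \<omega> * cnj (atom 0 (- int n) \<omega>)" for \<omega>
        by (simp add: atom_def cis_cnj mult_ac cis_mult)
      show ?thesis unfolding \<kappa>_def inner_L2_def eq ..
    qed
    have nw: "(norm_L2 (wils k n))\<^sup>2 = 1 + (if even (k + int n) then \<kappa> else - \<kappa>)" for k
    proof -
      let ?s = "cis (pi * of_int (k + int n))"
      have "(norm_L2 (wils k n))\<^sup>2 = (1/2) * (norm_L2 (\<lambda>\<omega>. atom k (int n) \<omega> + ?s * atom k (- int n) \<omega>))\<^sup>2"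
        unfolding wils_pos[OF False] norm_L2_cmult by (simp add: norm_divide power_mult_distrib power_divide)
      also have "\<dots> = (1/2) * (?R + ?R + 2 * Re (cnj ?s * inner_L2 (atom k (int n)) (atom k (- int n))))"
        by (simp add: power2_norm_L2_add sq_int_atom sq_int_cmult norm_L2_cmult norm_atom inner_L2_cmult_right
            del: of_int_add)
      finally show ?thesis using R \<kappa>[of k] unfolding cis_pi_int by (cases "even (k + int n)") auto
    qed
    have "\<kappa> = 0" using le[of 0 n] le[of 1 n] unfolding nw by (cases "even n") auto
    then have "(norm_L2 (wils m n))\<^sup>2 = 1" using nw[of m] by simp
    then show ?thesis by (rule sq1) simp
  qed
qed

end

section \<open>Metaplectic reduction\<close>

lemma tfshift_cis: "tfshift g x y t = cis (2 * pi * y * t) * g (t - x)"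
  unfolding tfshift_def exp_eq_cis ..

lemma sq_int_tfshift:
  assumes "sq_int g"
  shows "sq_int (tfshift g x y)"
proof -
  have "sq_int (\<lambda>t. g (- x + 1 * t))" using assms by (rule sq_int_affine) simp
  then have "sq_int (\<lambda>t. cis (2 * pi * y * t) * g (- x + 1 * t))"
    by (rule sq_int_bounded_mult[where C = 1]) auto
  then show ?thesis unfolding tfshift_cis[abs_def] by simp
qed

lemma fourierL2_tfshift:
  assumes g: "sq_int g"
  shows "AE \<omega> in lborel. fourierL2 (tfshift g x y) \<omega> = cis (- (2 * pi * x * (\<omega> - y))) * fourierL2 g (\<omega> - y)"
proof (rule fourierL2_eqI[OF sq_int_tfshift[OF g]])
  have "sq_int (\<lambda>\<omega>. fourierL2 g (- y + 1 * \<omega>))" by (intro sq_int_affine fourierL2_spec g) simp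
  then have "sq_int (\<lambda>\<omega>. cis (- (2 * pi * x * (\<omega> - y))) * fourierL2 g (- y + 1 * \<omega>))"
    by (rule sq_int_bounded_mult[where C = 1]) auto
  then show "sq_int (\<lambda>\<omega>. cis (- (2 * pi * x * (\<omega> - y))) * fourierL2 g (\<omega> - y))" by simp
  fix z
  let ?P = "\<lambda>\<omega>. cis (2 * pi * z * \<omega>) * gauss 1 \<omega>"
  \<comment> \<open>What becomes of the packet and the phase when \<open>\<omega>\<close> is
    replaced by \<open>\<omega> + y\<close>; the form \<open>\<omega> - (- y)\<close> fits
    \<open>fourier1_translate\<close>.\<close>
  let ?\<phi> = "\<lambda>\<omega>. cis (2 * pi * (- x) * \<omega>) * ?P (\<omega> - (- y))"
  have \<phi>: "integrable lborel ?\<phi>" "sq_int ?\<phi>"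
  proof -
    have "integrable lborel (\<lambda>\<omega>. ?P (y + 1 * \<omega>))" using integrable_packet by (rule lborel_integrable_real_affine) simp
    then have "integrable lborel (\<lambda>\<omega>. ?P (y + 1 * \<omega>) * cis (2 * pi * (- x) * \<omega>))"
      by (rule integrable_mult_cis)
    then show "integrable lborel ?\<phi>" by (simp add: add.commute mult_ac)
    have "sq_int (\<lambda>\<omega>. ?P (y + 1 * \<omega>))" using sq_int_packet by (rule sq_int_affine) simp
    then have "sq_int (\<lambda>\<omega>. cis (2 * pi * (- x) * \<omega>) * ?P (y + 1 * \<omega>))"
      by (rule sq_int_bounded_mult[where C = 1]) auto
    then show "sq_int ?\<phi>" by (simp add: add.commute)
  qed
  have \<phi>_hat: "fourier1 ?\<phi> t = cis (2 * pi * y * (t + x)) * gauss 1 (t + x - z)" for t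
    unfolding fourier1_modulate fourier1_translate[of ?P "- y"] fourier1_gauss_packet by (simp add: fourier1_gauss_1)
  have "(LINT \<omega>|lborel. cis (- (2 * pi * x * (\<omega> - y))) * fourierL2 g (\<omega> - y) * ?P \<omega>)
      = (LINT \<omega>|lborel. fourierL2 g \<omega> * ?\<phi> \<omega>)"
    by (subst lborel_integral_real_affine[where c = 1 and t = y]) (auto simp: mult_ac add.commute)
  also have "\<dots> = (LINT t|lborel. g t * fourier1 ?\<phi> t)" by (rule fourierL2_duality[OF g \<phi>])
  also have "\<dots> = (LINT t|lborel. tfshift g x y t * gauss 1 (t - z))"
    unfolding \<phi>_hat tfshift_cis
    by (subst lborel_integral_real_affine[where c = 1 and t = "- x"]) (auto simp: mult_ac)
  finally show "(LINT \<omega>|lborel. cis (- (2 * pi * x * (\<omega> - y))) * fourierL2 g (\<omega> - y) * ?P \<omega>)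
     = (LINT t|lborel. tfshift g x y t * gauss 1 (t - z))" .
qed

lemma sq_int_dil:
  assumes "sq_int f" "c > 0"
  shows "sq_int (dil c f)"
proof -
  have "sq_int (\<lambda>t. f (0 + c * t))" using assms by (intro sq_int_affine) auto
  then show ?thesis unfolding dil_def by (intro sq_int_cmult) simp
qed

lemma fourierL2_dil:
  assumes f: "sq_int f" and c: "c > 0"
  shows "AE \<omega> in lborel. fourierL2 (dil c f) \<omega> = dil (1 / c) (fourierL2 f) \<omega>"
proof (rule fourierL2_eqI[OF sq_int_dil[OF f c]])
  show "sq_int (dil (1 / c) (fourierL2 f))" using c by (intro sq_int_dil fourierL2_spec f) auto
  fix z
  let ?P = "\<lambda>\<omega>. cis (2 * pi * z * \<omega>) * gauss 1 \<omega>"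
  have \<phi>: "integrable lborel (\<lambda>\<omega>. ?P (c * \<omega>))" "sq_int (\<lambda>\<omega>. ?P (c * \<omega>))"
    using lborel_integrable_real_affine[OF integrable_packet[of z], of c 0] sq_int_affine[OF sq_int_packet[of z], of c 0] c
    by auto
  have sc: "c *\<^sub>R (complex_of_real (sqrt (1 / c)) * I) = complex_of_real (sqrt c) * I" for I
  proof -
    have "c * sqrt (1 / c) = sqrt c" using c by (simp add: real_sqrt_divide real_div_sqrt)
    then show ?thesis by (metis mult.assoc of_real_mult scaleR_conv_of_real)
  qed
  have "(LINT \<omega>|lborel. dil (1 / c) (fourierL2 f) \<omega> * ?P \<omega>)
     = c *\<^sub>R (LINT \<omega>|lborel. complex_of_real (sqrt (1 / c)) * (fourierL2 f \<omega> * ?P (c * \<omega>)))"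
    unfolding dil_def using c by (subst lborel_integral_real_affine[where c = c and t = 0]) (auto simp: mult.assoc)
  also have "\<dots> = complex_of_real (sqrt c) * (LINT \<omega>|lborel. fourierL2 f \<omega> * ?P (c * \<omega>))"
    unfolding integral_mult_right_zero by (rule sc)
  also have "(LINT \<omega>|lborel. fourierL2 f \<omega> * ?P (c * \<omega>)) = (LINT t|lborel. f t * fourier1 (\<lambda>\<omega>. ?P (c * \<omega>)) t)"
    by (rule fourierL2_duality[OF f \<phi>])
  also have "\<dots> = (LINT t|lborel. f t * (complex_of_real (1 / c) * gauss 1 (t / c - z)))"
    using c fourier1_dilate[of c ?P] by (simp add: fourier1_gauss_packet)
  also have "\<dots> = complex_of_real (1 / c) * (LINT t|lborel. f t * gauss 1 (t / c - z))"
    unfolding mult.left_commute[of "f _"] integral_mult_right_zero ..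
  also have "\<dots> = (LINT t|lborel. f (c * t) * gauss 1 (t - z))"
    using c by (subst lborel_integral_real_affine[where c = c and t = 0]) (auto simp: scaleR_conv_of_real)
  also have "complex_of_real (sqrt c) * \<dots> = (LINT t|lborel. dil c f t * gauss 1 (t - z))"
    unfolding dil_def using c by (simp add: mult.assoc)
  finally show "(LINT \<omega>|lborel. dil (1 / c) (fourierL2 f) \<omega> * ?P \<omega>) = (LINT t|lborel. dil c f t * gauss 1 (t - z))" .
qed

lemma fourierL2_cmult:
  assumes h: "sq_int h"
  shows "AE t in lborel. fourierL2 (\<lambda>t. c * h t) t = c * fourierL2 h t"
proof -
  have "norm_L2 (fourierL2 (\<lambda>t. 0)) = 0"
    unfolding norm_fourierL2[OF sq_int_zero] by (simp add: norm_L2_def)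
  then have "AE t in lborel. fourierL2 (\<lambda>t. 0) t = 0"
    using norm_L2_eq_0_iff fourierL2_spec(1)[OF sq_int_zero] by blast
  with fourierL2_add_cmult[OF sq_int_zero h, of c] show ?thesis
    by eventually_elim simp
qed

text \<open>The operator \<open>f \<mapsto> \<F> (U f)\<close>, in closed form.\<close>

definition FU :: "real \<Rightarrow> real \<Rightarrow> (real \<Rightarrow> complex) \<Rightarrow> real \<Rightarrow> complex" where
  "FU b d f \<omega> = complex_of_real (sqrt d) * (cis (pi * b * d * \<omega>\<^sup>2) * fourierL2 f (d * \<omega>))"

lemma sq_int_FU:
  assumes "sq_int f" "d > 0"
  shows "sq_int (FU b d f)"
proof -
  have "sq_int (\<lambda>\<omega>. fourierL2 f (0 + d * \<omega>))" using assms by (intro sq_int_affine fourierL2_spec) auto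
  then have "sq_int (\<lambda>\<omega>. cis (pi * b * d * \<omega>\<^sup>2) * fourierL2 f (0 + d * \<omega>))"
    by (rule sq_int_bounded_mult[where C = 1]) auto
  then show ?thesis unfolding FU_def[abs_def] by (intro sq_int_cmult) simp
qed

text \<open>The chirp is unimodular, and the Jacobian of the dilation is balanced by one factor
  \<open>sqrt d\<close> from each side.\<close>

lemma inner_FU:
  assumes f: "sq_int f" and h: "sq_int h" and d: "d > 0"
  shows "inner_L2 (FU b d f) (FU b d h) = inner_L2 f h"
proof -
  have "FU b d f \<omega> * cnj (FU b d h \<omega>) = complex_of_real d * (fourierL2 f (d * \<omega>) * cnj (fourierL2 h (d * \<omega>)))" for \<omega>
  proof -
    have "cis (pi * b * d * \<omega>\<^sup>2) * cnj (cis (pi * b * d * \<omega>\<^sup>2)) = 1"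
      by (simp add: cis_cnj cis_mult)
    moreover have "complex_of_real (sqrt d) * complex_of_real (sqrt d) = complex_of_real d"
      using d by (simp flip: of_real_mult)
    moreover have "FU b d f \<omega> * cnj (FU b d h \<omega>) = (complex_of_real (sqrt d) * complex_of_real (sqrt d)) *
        (cis (pi * b * d * \<omega>\<^sup>2) * cnj (cis (pi * b * d * \<omega>\<^sup>2))) * (fourierL2 f (d * \<omega>) * cnj (fourierL2 h (d * \<omega>)))"
      by (simp add: FU_def mult_ac)
    ultimately show ?thesis by simp
  qed
  then have "inner_L2 (FU b d f) (FU b d h)
      = complex_of_real d * (LINT \<omega>|lborel. fourierL2 f (d * \<omega>) * cnj (fourierL2 h (d * \<omega>)))"
    unfolding inner_L2_def by simp
  also have "\<dots> = inner_L2 (fourierL2 f) (fourierL2 h)"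
    unfolding inner_L2_def using d
    by (subst lborel_integral_real_affine[where c = d and t = 0]) (auto simp: scaleR_conv_of_real)
  finally show ?thesis by (simp add: inner_fourierL2 f h)
qed

lemma norm_FU:
  assumes "sq_int f" "d > 0"
  shows "norm_L2 (FU b d f) = norm_L2 f"
proof -
  have "(norm_L2 (FU b d f))\<^sup>2 = (norm_L2 f)\<^sup>2"
    using inner_FU[OF assms(1) assms, of b] unfolding inner_L2_self by (simp only: of_real_eq_iff)
  then show ?thesis by (simp add: power2_eq_iff_nonneg)
qed

lemma FU_surj:
  assumes F: "sq_int F" and d: "d > 0"
  obtains f where "sq_int f" "AE \<omega> in lborel. FU b d f \<omega> = F \<omega>"
proof -
  \<comment> \<open>Inverse chirp, inverse dilation and a reflection. The reflection undoes the one
    in \<open>fourierL2_fourierL2\<close>, so that \<open>fourierL2 G\<close> is a preimage of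
    \<open>F\<close>.\<close>
  define G where "G t = complex_of_real (1 / sqrt d) * (cis (- (pi * b * t\<^sup>2 / d)) * F (0 + (- 1 / d) * t))" for t
  have "sq_int (\<lambda>t. F (0 + (- 1 / d) * t))" using d by (intro sq_int_affine F) auto
  then have "sq_int (\<lambda>t. cis (- (pi * b * t\<^sup>2 / d)) * F (0 + (- 1 / d) * t))"
    by (rule sq_int_bounded_mult[where C = 1]) auto
  then have G: "sq_int G" unfolding G_def[abs_def] by (intro sq_int_cmult)
  have "AE \<omega> in lborel. fourierL2 (fourierL2 G) (0 + d * \<omega>) = G (- (0 + d * \<omega>))"
    using d by (intro AE_lborel_affine[OF fourierL2_fourierL2[OF G]]) auto
  then have "AE \<omega> in lborel. FU b d (fourierL2 G) \<omega> = F \<omega>"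
  proof eventually_elim
    case (elim \<omega>)
    have "pi * b * (- (0 + d * \<omega>))\<^sup>2 / d = pi * b * d * \<omega>\<^sup>2"
      using d by (simp add: power2_eq_square)
    then show ?case
      using d elim by (simp add: FU_def G_def mult.assoc[symmetric] cis_mult)
  qed
  then show ?thesis using that[of "fourierL2 G"] fourierL2_spec(1)[OF G] by blast
qed

text \<open>The combination has the shape of a Wilson function: a constant times the sum of one
  Gabor function and a sign times another.\<close>

lemma FU_lincomb:
  assumes f: "sq_int f" and h: "sq_int h" and d: "d > 0"
  shows "AE \<omega> in lborel. FU b d (\<lambda>t. c * (f t + s * h t)) \<omega> = c * (FU b d f \<omega> + s * FU b d h \<omega>)"
proof -
  have "AE \<omega> in lborel. fourierL2 (\<lambda>t. c * (f t + s * h t)) (0 + d * \<omega>) = c * fourierL2 (\<lambda>t. f t + s * h t) (0 + d * \<omega>)"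
    using d by (intro AE_lborel_affine[OF fourierL2_cmult] sq_int_add sq_int_cmult f h) auto
  moreover have "AE \<omega> in lborel. fourierL2 (\<lambda>t. f t + s * h t) (0 + d * \<omega>) = fourierL2 f (0 + d * \<omega>) + s * fourierL2 h (0 + d * \<omega>)"
    using d by (intro AE_lborel_affine[OF fourierL2_add_cmult] f h) auto
  ultimately show ?thesis by eventually_elim (simp add: FU_def algebra_simps)
qed

text \<open>Completing the square: the chirp at \<open>\<omega>\<close> and the phase from the shear
  \<open>n * b\<close> combine to the chirp at \<open>\<omega> - n\<close> and a constant. In the
  phase from \<open>m * a\<close>, \<open>a * d = 1 / 2\<close> leaves the character of period 2 and
  the sign (-1)^(mn).\<close>

lemma FU_tfshift:
  assumes g: "sq_int g" and d: "d > 0" and ad: "a * d = 1 / 2"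
  shows "AE \<omega> in lborel. FU b d (tfshift g (of_int m * a + of_int n * b) (of_int n * d)) \<omega>
    = cis (pi * b * d * (of_int n)\<^sup>2) * cis (pi * of_int (m * n)) * cis (- (pi * of_int m * \<omega>)) * FU b d g (\<omega> - of_int n)"
proof -
  let ?x = "of_int m * a + of_int n * b" and ?y = "of_int n * d"
  have "AE \<omega> in lborel. fourierL2 (tfshift g ?x ?y) (0 + d * \<omega>)
      = cis (- (2 * pi * ?x * (0 + d * \<omega> - ?y))) * fourierL2 g (0 + d * \<omega> - ?y)"
    using d by (intro AE_lborel_affine[OF fourierL2_tfshift[OF g]]) auto
  then show ?thesis
  proof eventually_elim
    case (elim \<omega>)
    have "pi * b * d * \<omega>\<^sup>2 + - (2 * pi * ?x * (d * \<omega> - ?y))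
        = pi * b * d * (of_int n)\<^sup>2 + pi * of_int (m * n) + - (pi * of_int m * \<omega>) + pi * b * d * (\<omega> - of_int n)\<^sup>2"
    proof -
      have "2 * pi * ?x * (d * \<omega> - ?y) = 2 * pi * of_int m * (a * d) * (\<omega> - of_int n) + 2 * pi * of_int n * b * d * (\<omega> - of_int n)"
        by (simp add: algebra_simps)
      then show ?thesis unfolding ad by (simp add: algebra_simps power2_eq_square)
    qed
    then have "cis (pi * b * d * \<omega>\<^sup>2) * cis (- (2 * pi * ?x * (d * \<omega> - ?y)))
       = cis (pi * b * d * (of_int n)\<^sup>2) * cis (pi * of_int (m * n)) * cis (- (pi * of_int m * \<omega>)) * cis (pi * b * d * (\<omega> - of_int n)\<^sup>2)"
      by (simp only: cis_mult)
    moreover have "d * \<omega> - ?y = d * (\<omega> - of_int n)" by (simp add: algebra_simps)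
    ultimately show ?case
      using elim unfolding FU_def by (simp only: add_0_left mult.assoc mult.left_commute[of "complex_of_real (sqrt d)"])
        (metis (no_types, opaque_lifting) mult.assoc)
  qed
qed

text \<open>The transform inverts the dilation and meets the inner transform, which gives a
  reflection. The chirp is even, and the reflection turns \<open>invfourierL2 g\<close> into
  \<open>fourierL2 g\<close>.\<close>

lemma fourierL2_opU:
  assumes g: "sq_int g" and d: "d > 0"
  shows "AE \<omega> in lborel. fourierL2 (opU b d g) \<omega> = FU b d g \<omega>"
proof -
  let ?k = "chirp (- b / d) (invfourierL2 g)"
  have k_eq: "?k t = cis (pi * (b / d) * t\<^sup>2) * invfourierL2 g t" for t
    unfolding chirp_def exp_eq_cis by simp
  have k: "sq_int ?k"
    unfolding k_eq[abs_def] by (rule sq_int_bounded_mult[where C = 1]) (auto intro: invfourierL2_fourierL2 g)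
  have "AE \<omega> in lborel. fourierL2 (opU b d g) \<omega> = dil (1 / (1 / d)) (fourierL2 (fourierL2 ?k)) \<omega>"
    unfolding opU_def using d by (intro fourierL2_dil fourierL2_spec k) auto
  moreover have "AE \<omega> in lborel. fourierL2 (fourierL2 ?k) (0 + d * \<omega>) = ?k (- (0 + d * \<omega>))"
    using d by (intro AE_lborel_affine[OF fourierL2_fourierL2[OF k]]) auto
  moreover have "AE \<omega> in lborel. invfourierL2 g (0 + (- d) * \<omega>) = fourierL2 g (- (0 + (- d) * \<omega>))"
    using d by (intro AE_lborel_affine[OF invfourierL2_fourierL2(2)[OF g]]) auto
  ultimately show ?thesis
  proof eventually_elim
    case (elim \<omega>)
    have "pi * (b / d) * (d * \<omega>)\<^sup>2 = pi * b * d * \<omega>\<^sup>2" using d by (simp add: power2_eq_square)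
    then show ?case using elim d k_eq[of "- (d * \<omega>)"] by (simp add: dil_def FU_def)
  qed
qed

theorem theorem2p5:
  fixes a b d :: real and g :: "real \<Rightarrow> complex"
  assumes "a > 0" and "d > 0" and "0 \<le> b" and "b < a" and "a * d = 1 / 2"
    and "sq_int g"
    and "AE \<omega> in lborel. fourierL2 (opU b d g) \<omega> \<in> \<real>"
    and "tight_frame_L2 (\<lambda>(m::int, n::int). tfshift g (of_int m * a + of_int n * b) (of_int n * d)) 2"
  shows "onb_L2 (\<lambda>(m::int, n::nat). wilson g a b d m n)"
proof -
  note d = \<open>d > 0\<close> and ad = \<open>a * d = 1 / 2\<close> and g = \<open>sq_int g\<close>
  \<comment> \<open>The transform of U g is real almost everywhere; its real part is a
    representative that is real everywhere.\<close>
  define r where "r \<omega> = Re (FU b d g \<omega>)" for \<omega>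
  define gab where "gab m n = tfshift g (of_int m * a + of_int n * b) (of_int n * d)" for m n :: int
  have FUg: "sq_int (FU b d g)" by (rule sq_int_FU[OF g d])
  have gab: "sq_int (gab m n)" for m n unfolding gab_def by (rule sq_int_tfshift[OF g])
  have r_eq: "AE \<omega> in lborel. complex_of_real (r \<omega>) = FU b d g \<omega>"
    using assms(7) fourierL2_opU[OF g d, of b] by eventually_elim (auto simp: r_def)
  have r: "sq_int (\<lambda>\<omega>. complex_of_real (r \<omega>))"
  proof (rule sq_int_AE_cong[OF FUg _ r_eq])
    show "(\<lambda>\<omega>. complex_of_real (r \<omega>)) \<in> borel_measurable borel"
      unfolding r_def using sq_int_measurable[OF FUg] by measurable
  qed
  define atom where "atom m n \<omega> = complex_of_real (r (\<omega> - of_int n)) * cis (- (pi * of_int m * \<omega>))"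
    for m n :: int and \<omega> :: real
  define \<theta> where "\<theta> m n = cis (pi * b * d * (of_int n)\<^sup>2) * cis (pi * of_int (m * n))" for m n :: int
  have \<theta>: "norm (\<theta> m n) = 1" for m n by (simp add: \<theta>_def norm_mult)
  have FU_gab: "AE \<omega> in lborel. FU b d (gab m n) \<omega> = \<theta> m n * atom m n \<omega>" for m n
  proof -
    have "AE \<omega> in lborel. complex_of_real (r (- of_int n + 1 * \<omega>)) = FU b d g (- of_int n + 1 * \<omega>)"
      by (rule AE_lborel_affine[OF r_eq]) simp
    with FU_tfshift[OF g d ad, of b m n] show ?thesis
      by eventually_elim (simp add: gab_def \<theta>_def atom_def mult_ac)
  qed
  have atom: "sq_int (atom m n)" for m n
  proof -
    have "sq_int (\<lambda>\<omega>. complex_of_real (r (- of_int n + 1 * \<omega>)))" using r by (rule sq_int_affine) simp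
    then have "sq_int (\<lambda>\<omega>. cis (- (pi * of_int m * \<omega>)) * complex_of_real (r (- of_int n + 1 * \<omega>)))"
      by (rule sq_int_bounded_mult[where C = 1]) auto
    then show ?thesis by (simp add: atom_def[abs_def] mult.commute)
  qed
  have "real_gabor_frame r"
    unfolding real_gabor_frame_def atom_def[symmetric]
  proof (intro conjI allI impI)
    show "sq_int (\<lambda>\<omega>. complex_of_real (r \<omega>))" by (rule r)
    fix F assume F: "sq_int F"
    \<comment> \<open>The frame hypothesis lives on the time side; surjectivity of
      \<open>FU b d\<close> transfers it to an arbitrary \<open>F\<close>.\<close>
    obtain f where f: "sq_int f" and fF: "AE \<omega> in lborel. FU b d f \<omega> = F \<omega>"
      using FU_surj[OF F d] by blast
    have "norm (inner_L2 f (gab m n)) = norm (inner_L2 F (atom m n))" for m n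
    proof -
      have "inner_L2 f (gab m n) = inner_L2 (FU b d f) (FU b d (gab m n))" by (simp add: inner_FU f gab d)
      also have "\<dots> = inner_L2 F (\<lambda>\<omega>. \<theta> m n * atom m n \<omega>)"
        by (intro inner_L2_cong_AE sq_int_FU f F gab d sq_int_cmult atom fF FU_gab)
      finally show ?thesis by (simp add: inner_L2_cmult_right norm_mult \<theta>)
    qed
    moreover have "norm_L2 F = norm_L2 f"
      using norm_L2_cong_AE[OF sq_int_measurable sq_int_measurable fF] norm_FU[OF f d, of b] sq_int_FU[OF f d] F by simp
    moreover have "((\<lambda>i. (norm (inner_L2 f (case i of (m, n) \<Rightarrow> gab m n)))\<^sup>2) has_sum (2 * (norm_L2 f)\<^sup>2)) UNIV"
      using assms(8) f unfolding tight_frame_L2_def gab_def by blast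
    ultimately show "((\<lambda>(m, n). (norm (inner_L2 F (atom m n)))\<^sup>2) has_sum (2 * (norm_L2 F)\<^sup>2)) UNIV"
      by (simp add: case_prod_unfold)
  qed
  then interpret real_gabor_frame r atom
    by (simp_all add: atom_def)
  have wilson_wils: "sq_int (wilson g a b d m n) \<and>
    (\<exists>\<eta>. norm \<eta> = 1 \<and> (AE \<omega> in lborel. FU b d (wilson g a b d m n) \<omega> = \<eta> * wils m n \<omega>))" for m n
  proof (cases "n = 0")
    case True
    then have "wilson g a b d m n = gab (2 * m) 0" by (simp add: wilson_def gab_def)
    then show ?thesis
      using FU_gab[of "2 * m" 0] \<theta>[of "2 * m" 0] gab True by (auto simp: wils_0)
  next
    case n: False
    \<comment> \<open>\<open>\<gamma>\<close> survives as a unimodular factor, whereas the chirp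
      constant in \<open>c\<close> cancels the one in \<open>\<theta> m (int n)\<close>.\<close>
    define \<gamma> where "\<gamma> = (if even (m + int n) then 1 else \<i>)"
    define c where "c = \<gamma> / complex_of_real (sqrt 2) * cis (- (pi * b * d * (real n)\<^sup>2))"
    let ?s = "cis (pi * of_int (m + int n))"
    have W: "wilson g a b d m n = (\<lambda>t. c * (gab m (int n) t + ?s * gab m (- int n) t))"
      unfolding wilson_def gab_def exp_eq_cis c_def \<gamma>_def cis_pi_int using n by (auto simp: fun_eq_iff)
    have sqW: "sq_int (wilson g a b d m n)" unfolding W by (intro sq_int_cmult sq_int_add gab)
    let ?\<eta> = "\<gamma> * cis (pi * of_int (m * int n))"
    \<comment> \<open>\<open>\<theta>\<close> depends on \<open>n\<close> through
      \<open>n\<^sup>2\<close> and the parity of \<open>m * n\<close>, so both Gabor functions get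
      the same phase and their relative sign persists.\<close>
    have th: "\<theta> m (- int n) = \<theta> m (int n)" unfolding \<theta>_def cis_pi_int by simp
    have cth: "c * \<theta> m (int n) = ?\<eta> * (1 / complex_of_real (sqrt 2))"
      unfolding c_def \<theta>_def by (simp add: cis_mult)
    have "AE \<omega> in lborel. FU b d (wilson g a b d m n) \<omega> = ?\<eta> * wils m n \<omega>"
      using FU_gab[of m "int n"] FU_gab[of m "- int n"] FU_lincomb[OF gab gab d, of b c m "int n" ?s m "- int n"]
    proof eventually_elim
      case (elim \<omega>)
      have "FU b d (wilson g a b d m n) \<omega> = (c * \<theta> m (int n)) * (atom m (int n) \<omega> + ?s * atom m (- int n) \<omega>)"
        unfolding W elim th by (simp add: algebra_simps del: of_int_add)
      then show ?case unfolding cth wils_pos[OF n] by (simp only: mult.assoc)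
    qed
    moreover have "norm ?\<eta> = 1" by (simp add: \<gamma>_def norm_mult)
    ultimately show ?thesis using sqW by blast
  qed
  then have sq_int_wilson: "sq_int (wilson g a b d m n)"
    and FU_wilson: "\<exists>\<eta>. norm \<eta> = 1 \<and> (AE \<omega> in lborel. FU b d (wilson g a b d m n) \<omega> = \<eta> * wils m n \<omega>)" for m n
    by blast+
  show ?thesis
  \<comment> \<open>This criterion involves norms and moduli of coefficients, from which the phases
    \<open>\<eta>\<close> drop out.\<close>
  proof (rule parseval_frame_imp_orthonormal)
    show "sq_int (case i of (m, n) \<Rightarrow> wilson g a b d m n)" for i
      using sq_int_wilson by (simp add: case_prod_unfold)
    show "norm_L2 (case i of (m, n) \<Rightarrow> wilson g a b d m n) = 1" for i
    proof -
      obtain m n where i: "i = (m, n)" by fastforce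
      obtain \<eta> where \<eta>: "norm \<eta> = 1" "AE \<omega> in lborel. FU b d (wilson g a b d m n) \<omega> = \<eta> * wils m n \<omega>"
        using FU_wilson by blast
      have "norm_L2 (wilson g a b d m n) = norm_L2 (FU b d (wilson g a b d m n))"
        by (simp add: norm_FU sq_int_wilson d)
      also have "\<dots> = norm_L2 (\<lambda>\<omega>. \<eta> * wils m n \<omega>)"
        by (intro norm_L2_cong_AE sq_int_measurable sq_int_FU sq_int_wilson d sq_int_cmult sq_int_wils \<eta>)
      finally show ?thesis using i \<eta>(1) by (simp add: norm_L2_cmult norm_wils)
    qed
    fix f assume f: "sq_int f"
    have "norm (inner_L2 f (wilson g a b d m n)) = norm (inner_L2 (FU b d f) (wils m n))" for m n
    proof -
      obtain \<eta> where \<eta>: "norm \<eta> = 1" "AE \<omega> in lborel. FU b d (wilson g a b d m n) \<omega> = \<eta> * wils m n \<omega>"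
        using FU_wilson by blast
      have "inner_L2 f (wilson g a b d m n) = inner_L2 (FU b d f) (FU b d (wilson g a b d m n))"
        by (simp add: inner_FU f sq_int_wilson d)
      also have "\<dots> = inner_L2 (FU b d f) (\<lambda>\<omega>. \<eta> * wils m n \<omega>)"
        by (intro inner_L2_cong_AE sq_int_FU sq_int_wilson d f sq_int_cmult sq_int_wils \<eta>) simp
      finally show ?thesis using \<eta>(1) by (simp add: inner_L2_cmult_right norm_mult)
    qed
    then show "((\<lambda>i. (norm (inner_L2 f (case i of (m, n) \<Rightarrow> wilson g a b d m n)))\<^sup>2) has_sum (norm_L2 f)\<^sup>2) UNIV"
      using wils_parseval[OF sq_int_FU[OF f d, of b]] by (simp add: case_prod_unfold norm_FU[OF f d])
  qed
qed

end
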